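(* Let $\{M_k\}_{k\ge1}$ be a sequence of matrices with entries in $[-1,1]$, where $M_k$ has order $m_k\times n_k$ and $m_k,n_k\to\infty$ as $k\to\infty$. Let $\{X_k\}_{k\ge 1}$ be random matrices, each with independent entries in $[-1,1]$, such that $\mathbb{E}(X_k)=M_k$ for each $k$. Let $\mathcal{M}\subseteq[-1,1]$ be the union of the sets of entries of all the matrices $M_k$, and let $f:\mathcal{M}\to[0,1]$ be a function such that the $(i,j)$-th entry of $X_k$ is revealed with probability $f((M_k)_{ij})$ and hidden otherwise, independently of all else. Suppose that $\sup_k \operatorname{rank}(M_k)<\infty$. Let $\mu_k$ be the empirical distribution of the $m_kn_k$ entries of $M_k$. Suppose that for every subsequential weak limit $\mu$ of the sequence $\{\mu_k\}_{k\ge1}$, there is an extension of $f$ to a Lipschitz function from $[-1,1]$ into $[0,1]$ which has no zeros in the support of $\mu$. Then the modified USVT estimator $\hat M_k$ of $M_k$ based on the revealed entries of $X_k$ is consistent, that is, $$\lim_{k\to\infty}\mathbb{E}\Bigl[\frac1{m_kn_k}\sum_{i=1}^{m_k}\sum_{j=1}^{n_k}\bigl((\hat M_k)_{ij}-(M_k)_{ij}\bigr)^2\Bigr]=0.$$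
   Context: Fix a number $\eta\in(0,1)$ (the same for all $k$). The modified USVT estimator, for an $m\times n$ matrix $X$ with partially revealed entries, is defined as follows. 1. Let $Y$ be the $m\times n$ matrix whose $(i,j)$-th entry is $x_{ij}$ if the $(i,j)$-th entry of $X$ is revealed, and $0$ otherwise. 2. Let $Y=\sum_i\sigma_iu_iv_i^T$ be the singular value decomposition of $Y$, and let $A=\sum_{i:\ \sigma_i\ge(2+\eta)\max\{\sqrt m,\sqrt n\}}\sigma_iu_iv_i^T$. 3. Truncate each entry of $A$ to the interval $[-1,1]$ (values above $1$ are replaced by $1$, values below $-1$ by $-1$). Call the resulting matrix $\hat Q$. 4. Let $P$ be the $m\times n$ matrix whose $(i,j)$-th entry is $1$ if $x_{ij}$ is revealed and $0$ otherwise. Apply steps 2 and 3 to $P$ in place of $Y$; call the resulting matrix $\hat R$. 5. Let $W$ be the matrix with $w_{ij}=\hat q_{ij}/\hat r_{ij}$ if $\hat r_{ij}\ne0$ and $w_{ij}=0$ otherwise. Truncate the entries of $W$ to $[-1,1]$; the result is the estimator $\hat M$. *)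

theory Defs
  imports "HOL-Probability.Probability" "Jordan_Normal_Form.DL_Rank"
begin

(* Thin form, with min m n terms; vanishing singular values are allowed and the order of the
   singular values is not fixed.  The entry equation says Y = sum_i sigma_i u_i v_i^T. *)
definition is_svd ::
  "real mat \<Rightarrow> (nat \<Rightarrow> real) \<times> (nat \<Rightarrow> real Matrix.vec) \<times> (nat \<Rightarrow> real Matrix.vec) \<Rightarrow> bool"
where
  "is_svd Y = (\<lambda>(\<sigma>, u, v).
     let m = dim_row Y; n = dim_col Y; r = min m n in
       (\<forall>l<r. \<sigma> l \<ge> 0 \<and> u l \<in> carrier_vec m \<and> v l \<in> carrier_vec n) \<and>
       (\<forall>l<r. \<forall>l'<r. scalar_prod (u l) (u l') = (if l = l' then 1 else 0)) \<and>
       (\<forall>l<r. \<forall>l'<r. scalar_prod (v l) (v l') = (if l = l' then 1 else 0)) \<and>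
       (\<forall>i<m. \<forall>j<n. Y $$ (i, j) =
          (\<Sum>l<r. \<sigma> l * vec_index (u l) i * vec_index (v l) j)))"

(* The decomposition is unique only up to the choice of singular vectors; for t > 0 the
   thresholded matrix below does not depend on that choice. *)
definition svd ::
  "real mat \<Rightarrow> (nat \<Rightarrow> real) \<times> (nat \<Rightarrow> real Matrix.vec) \<times> (nat \<Rightarrow> real Matrix.vec)"
where
  "svd Y = (SOME d. is_svd Y d)"

definition sv_threshold :: "real \<Rightarrow> real mat \<Rightarrow> real mat" where
  "sv_threshold t Y = (case svd Y of (\<sigma>, u, v) \<Rightarrow>
     mat (dim_row Y) (dim_col Y) (\<lambda>(i, j).
       \<Sum>l | l < min (dim_row Y) (dim_col Y) \<and> \<sigma> l \<ge> t.
         \<sigma> l * vec_index (u l) i * vec_index (v l) j))"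

definition truncate_entry :: "real \<Rightarrow> real" where
  "truncate_entry x = max (- 1) (min 1 x)"

definition usvt :: "real \<Rightarrow> real mat \<Rightarrow> real mat" where
  "usvt \<eta> Y = map_mat truncate_entry
     (sv_threshold ((2 + \<eta>) * max (sqrt (real (dim_row Y))) (sqrt (real (dim_col Y)))) Y)"

definition revealed_part :: "real mat \<Rightarrow> (nat \<times> nat) set \<Rightarrow> real mat" where
  "revealed_part X R = mat (dim_row X) (dim_col X) (\<lambda>ij. if ij \<in> R then X $$ ij else 0)"

definition reveal_mask :: "nat \<Rightarrow> nat \<Rightarrow> (nat \<times> nat) set \<Rightarrow> real mat" where
  "reveal_mask m n R = mat m n (\<lambda>ij. if ij \<in> R then 1 else 0)"

definition modified_usvt :: "real \<Rightarrow> real mat \<Rightarrow> (nat \<times> nat) set \<Rightarrow> real mat" where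
  "modified_usvt \<eta> X R =
     (let Q = usvt \<eta> (revealed_part X R);
          S = usvt \<eta> (reveal_mask (dim_row X) (dim_col X) R);
          W = mat (dim_row X) (dim_col X)
                (\<lambda>ij. if S $$ ij \<noteq> 0 then Q $$ ij / S $$ ij else 0)
      in map_mat truncate_entry W)"

definition empirical_distribution :: "real mat \<Rightarrow> real measure" where
  "empirical_distribution M =
     distr (uniform_count_measure ({..<dim_row M} \<times> {..<dim_col M})) borel (\<lambda>ij. M $$ ij)"

definition subseq_weak_limit :: "(nat \<Rightarrow> real measure) \<Rightarrow> real measure \<Rightarrow> bool" where
  "subseq_weak_limit \<mu>s \<mu> \<longleftrightarrow>
     real_distribution \<mu> \<and> (\<exists>s. strict_mono s \<and> weak_conv_m (\<lambda>j. \<mu>s (s j)) \<mu>)"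

definition measure_support :: "real measure \<Rightarrow> real set" where
  "measure_support \<mu> = {x. \<forall>U. open U \<and> x \<in> U \<longrightarrow> emeasure \<mu> U > 0}"

end

theory Submission
  imports Defs "HOL-Real_Asymp.Real_Asymp"
begin

text \<open>
  Write \<open>Y = S + Z\<close> with \<open>S\<close> the mean and \<open>N = max m n\<close>.  Polynomial approximation turns the
  bounded-rank \<open>M\<close> into a bounded-rank approximation of \<open>S = (M * g M)\<close> (entrywise).  No bound on the
  operator norm of \<open>Z\<close> is needed: it suffices that the singular values of \<open>Z\<close> above
  \<open>(2 + \<eta> / 2) * sqrt N\<close> carry a small share of the energy, and this follows from
  \<open>E (tr ((Z\<^sup>T Z) ^ k)) \<le> 2 * 4 ^ k * m * n * N ^ (k - 1) + O(m * n * N ^ (k - 2))\<close> for a fixed large \<open>k\<close>.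
  In the moment only closed walks using every edge at least twice survive; those with the maximal
  number \<open>k + 1\<close> of vertices run around a tree, so they are determined by the set of times at which a new
  vertex appears together with these vertices.

  Applied to the data and to the reveal mask this yields \<open>M * g M\<close> and \<open>g M\<close>, and dividing is harmless
  off the entries with small \<open>g M\<close>.  Along a subsequence whose empirical distributions converge
  weakly, those entries have vanishing frequency because \<open>g\<close> is positive on the support of the limit.
  Measurability of the estimator holds although the singular value decomposition is a choice: the
  thresholded matrix is a pointwise limit of polynomials in the entries.
\<close>

section \<open>Orthonormal families\<close>

text \<open>The exponent \<open>k\<close> stays fixed while the dimensions grow. A fixed moment
  cannot exclude a few large singular values of the noise, but it limits how many there are and how
  much energy they carry, and the loss is a mean square. The walk count may therefore be crude in
  everything except the base 4: factors such as 2 or \<open>(2 * k + 1) ^ (2 * k + 1)\<close> are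
  constants, and the gap between \<open>2 + \<eta> / 2\<close> and 2 turns the leading term into a
  multiple of \<open>(4 / \<rho>) ^ k\<close> with \<open>\<rho> = (2 + \<eta> / 2)\<^sup>2\<close>.
  The dimensions \<open>m\<close> and \<open>n\<close> may grow at different rates, so every count
  keeps the factor \<open>m * n\<close>; replacing it by the square of the maximum would ruin the
  normalised error of elongated matrices. The extension of \<open>f\<close> may change with the weak
  limit, so there is no single continuous reveal function for the whole sequence. It becomes
  available only after passing to a convergent subsequence, which dictates the shape of the final
  argument.\<close>

definition ip :: "nat \<Rightarrow> (nat \<Rightarrow> real) \<Rightarrow> (nat \<Rightarrow> real) \<Rightarrow> real" where
  "ip d x y = (\<Sum>i<d. x i * y i)"

text \<open>The dimension is an argument and only values at indices below \<open>d\<close> count, so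
  left and right singular vectors share one type.\<close>

definition orthonormal :: "nat \<Rightarrow> nat set \<Rightarrow> (nat \<Rightarrow> nat \<Rightarrow> real) \<Rightarrow> bool" where
  "orthonormal d K v \<longleftrightarrow> (\<forall>l\<in>K. \<forall>l'\<in>K. ip d (v l) (v l') = of_bool (l = l'))"

definition app :: "nat \<Rightarrow> (nat \<Rightarrow> nat \<Rightarrow> real) \<Rightarrow> (nat \<Rightarrow> real) \<Rightarrow> nat \<Rightarrow> real" where
  "app d Y x = (\<lambda>i. \<Sum>j<d. Y i j * x j)"

definition tr :: "(nat \<Rightarrow> nat \<Rightarrow> real) \<Rightarrow> nat \<Rightarrow> nat \<Rightarrow> real" where
  "tr Y = (\<lambda>i j. Y j i)"

definition unit_fun :: "nat \<Rightarrow> nat \<Rightarrow> real" where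
  "unit_fun j = (\<lambda>i. of_bool (i = j))"

lemma ip_commute: "ip d x y = ip d y x"
  by (simp add: ip_def mult.commute)

lemma ip_cong: "(\<And>i. i < d \<Longrightarrow> x i = x' i) \<Longrightarrow> (\<And>i. i < d \<Longrightarrow> y i = y' i) \<Longrightarrow> ip d x y = ip d x' y'"
  unfolding ip_def by (rule sum.cong) auto

lemma ip_add_left: "ip d (\<lambda>i. x i + y i) z = ip d x z + ip d y z"
  and ip_diff_left: "ip d (\<lambda>i. x i - y i) z = ip d x z - ip d y z"
  and ip_scale_left: "ip d (\<lambda>i. c * x i) z = c * ip d x z"
  and ip_zero_left: "ip d (\<lambda>i. 0) z = 0"
  by (simp_all add: ip_def algebra_simps sum.distrib sum_subtractf sum_distrib_left)

lemma ip_add_right: "ip d z (\<lambda>i. x i + y i) = ip d z x + ip d z y"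
  and ip_diff_right: "ip d z (\<lambda>i. x i - y i) = ip d z x - ip d z y"
  and ip_scale_right: "ip d z (\<lambda>i. c * x i) = c * ip d z x"
  and ip_zero_right: "ip d z (\<lambda>i. 0) = 0"
  by (simp_all add: ip_def algebra_simps sum.distrib sum_subtractf sum_distrib_left)

lemmas ip_linear = ip_add_left ip_diff_left ip_scale_left ip_zero_left
  ip_add_right ip_diff_right ip_scale_right ip_zero_right

lemma ip_sum_left: "ip d (\<lambda>i. \<Sum>l\<in>K. c l * v l i) y = (\<Sum>l\<in>K. c l * ip d (v l) y)"
proof -
  have "ip d (\<lambda>i. \<Sum>l\<in>K. c l * v l i) y = (\<Sum>i<d. \<Sum>l\<in>K. c l * (v l i * y i))"
    by (simp add: ip_def sum_distrib_right mult.assoc)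
  also have "\<dots> = (\<Sum>l\<in>K. \<Sum>i<d. c l * (v l i * y i))"
    by (rule sum.swap)
  finally show ?thesis
    by (simp add: ip_def sum_distrib_left)
qed

lemma ip_sum_right: "ip d y (\<lambda>i. \<Sum>l\<in>K. c l * v l i) = (\<Sum>l\<in>K. c l * ip d y (v l))"
  by (subst ip_commute) (simp add: ip_sum_left ip_commute)

lemma ip_self: "ip d x x = (\<Sum>i<d. (x i)\<^sup>2)"
  by (simp add: ip_def power2_eq_square)

lemma ip_self_nonneg [simp]: "0 \<le> ip d x x"
  by (simp add: ip_self sum_nonneg)

lemma ip_self_eq_0_iff: "ip d x x = 0 \<longleftrightarrow> (\<forall>i<d. x i = 0)"
  by (auto simp: ip_self sum_nonneg_eq_0_iff)

lemma ip_Cauchy_Schwarz: "(ip d x y)\<^sup>2 \<le> ip d x x * ip d y y"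
  unfolding ip_self ip_def by (rule Cauchy_Schwarz_ineq_sum)

lemma ip_unit_fun: "j < d \<Longrightarrow> ip d (unit_fun j) x = x j"
  by (simp add: ip_def unit_fun_def of_bool_def if_distrib[of "\<lambda>z. z * _"] cong: if_cong)

lemma norm_add_le: "sqrt (ip d (\<lambda>i. x i + y i) (\<lambda>i. x i + y i)) \<le> sqrt (ip d x x) + sqrt (ip d y y)"
  using L2_set_triangle_ineq[of x y "{..<d}"] by (simp add: ip_self L2_set_def)

lemma norm2_add_le:
  "ip d (\<lambda>i. x i + y i) (\<lambda>i. x i + y i) \<le> 2 * ip d x x + 2 * ip d y y"
  unfolding ip_self sum_distrib_left sum.distrib[symmetric]
proof (rule sum_mono)
  fix i show "(x i + y i)\<^sup>2 \<le> 2 * (x i)\<^sup>2 + 2 * (y i)\<^sup>2"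
    using zero_le_power2[of "x i - y i"] unfolding power2_eq_square by (simp add: algebra_simps)
qed

lemma orthonormalD: "orthonormal d K v \<Longrightarrow> l \<in> K \<Longrightarrow> l' \<in> K \<Longrightarrow> ip d (v l) (v l') = of_bool (l = l')"
  by (auto simp: orthonormal_def)

lemma orthonormal_subset: "orthonormal d K v \<Longrightarrow> L \<subseteq> K \<Longrightarrow> orthonormal d L v"
  unfolding orthonormal_def by (meson subsetD)

lemma ip_lincomb_orthonormal:
  assumes "orthonormal d K v" "finite K" "l \<in> K"
  shows "ip d (\<lambda>i. \<Sum>l\<in>K. c l * v l i) (v l) = c l"
proof -
  have "ip d (\<lambda>i. \<Sum>l\<in>K. c l * v l i) (v l) = (\<Sum>l'\<in>K. c l' * of_bool (l' = l))"
    unfolding ip_sum_left using assms by (intro sum.cong) (auto simp: orthonormalD)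
  then show ?thesis
    using assms by (simp add: of_bool_def if_distrib[of "\<lambda>z. _ * z"] cong: if_cong)
qed

lemma norm2_lincomb_orthonormal:
  assumes "orthonormal d K v" "finite K"
  shows "ip d (\<lambda>i. \<Sum>l\<in>K. c l * v l i) (\<lambda>i. \<Sum>l\<in>K. c l * v l i) = (\<Sum>l\<in>K. (c l)\<^sup>2)"
  unfolding ip_sum_right
  by (intro sum.cong) (auto simp: ip_lincomb_orthonormal[OF assms] power2_eq_square)

definition proj :: "nat \<Rightarrow> nat set \<Rightarrow> (nat \<Rightarrow> nat \<Rightarrow> real) \<Rightarrow> (nat \<Rightarrow> real) \<Rightarrow> nat \<Rightarrow> real" where
  "proj d K v x = (\<lambda>i. \<Sum>l\<in>K. ip d x (v l) * v l i)"

definition resid :: "nat \<Rightarrow> nat set \<Rightarrow> (nat \<Rightarrow> nat \<Rightarrow> real) \<Rightarrow> (nat \<Rightarrow> real) \<Rightarrow> nat \<Rightarrow> real" where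
  "resid d K v x = (\<lambda>i. x i - proj d K v x i)"

lemma resid_orthogonal:
  assumes "orthonormal d K v" "finite K" "l \<in> K"
  shows "ip d (resid d K v x) (v l) = 0"
  unfolding resid_def proj_def ip_linear by (simp add: ip_lincomb_orthonormal[OF assms])

lemma norm2_proj:
  assumes "orthonormal d K v" "finite K"
  shows "ip d (proj d K v x) (proj d K v x) = (\<Sum>l\<in>K. (ip d x (v l))\<^sup>2)"
  unfolding proj_def by (rule norm2_lincomb_orthonormal[OF assms])

lemma ip_proj: "ip d x (proj d K v x) = (\<Sum>l\<in>K. (ip d x (v l))\<^sup>2)"
  unfolding proj_def ip_sum_right by (simp add: power2_eq_square)

lemma norm2_resid:
  assumes "orthonormal d K v" "finite K"
  shows "ip d (resid d K v x) (resid d K v x) = ip d x x - (\<Sum>l\<in>K. (ip d x (v l))\<^sup>2)"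
  unfolding resid_def ip_linear
  using norm2_proj[OF assms, of x] ip_proj[of d x K v] ip_commute[of d x "proj d K v x"] by simp

lemma Bessel:
  assumes "orthonormal d K v" "finite K"
  shows "(\<Sum>l\<in>K. (ip d x (v l))\<^sup>2) \<le> ip d x x"
  using norm2_resid[OF assms, of x] ip_self_nonneg[of d "resid d K v x"] by simp

lemma norm2_resid_le:
  assumes "orthonormal d K v" "finite K"
  shows "ip d (resid d K v x) (resid d K v x) \<le> ip d x x"
  using norm2_resid[OF assms, of x] by (simp add: sum_nonneg)

lemma resid_add: "resid d K v (\<lambda>i. x i + y i) = (\<lambda>i. resid d K v x i + resid d K v y i)"
  by (simp add: fun_eq_iff resid_def proj_def ip_linear algebra_simps sum.distrib)

lemma resid_scale: "resid d K v (\<lambda>i. c * x i) = (\<lambda>i. c * resid d K v x i)"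
  by (simp add: fun_eq_iff resid_def proj_def ip_linear algebra_simps sum_distrib_left)

lemma resid_lincomb:
  "resid d K v (\<lambda>i. \<Sum>l\<in>L. c l * u l i) i = (\<Sum>l\<in>L. c l * resid d K v (u l) i)"
proof -
  have "proj d K v (\<lambda>i. \<Sum>l\<in>L. c l * u l i) i = (\<Sum>k\<in>K. \<Sum>l\<in>L. c l * (ip d (u l) (v k) * v k i))"
    by (simp add: proj_def ip_sum_left sum_distrib_right mult.assoc)
  also have "\<dots> = (\<Sum>l\<in>L. c l * proj d K v (u l) i)"
    unfolding proj_def sum_distrib_left by (rule sum.swap)
  finally show ?thesis
    by (simp add: resid_def algebra_simps sum_subtractf)
qed

lemma resid_cong: "(\<And>i. i < d \<Longrightarrow> x i = y i) \<Longrightarrow> i < d \<Longrightarrow> resid d K v x i = resid d K v y i"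
  unfolding resid_def proj_def using ip_cong[of d x y] by simp

lemma resid_in_span:
  assumes "orthonormal d K v" "finite K"
  shows "resid d K v (\<lambda>i. \<Sum>l\<in>K. c l * v l i) i = 0"
  unfolding resid_def proj_def
  by (simp add: ip_lincomb_orthonormal[OF assms] cong: sum.cong)

text \<open>The left side is the trace of the complementary projection, computed in the standard
  basis. It serves twice: for \<open>k < d\<close> some residual is nonzero, for
  \<open>k = d\<close> all of them vanish.\<close>

lemma sum_norm2_resid_unit_fun:
  assumes "orthonormal d {..<k} v"
  shows "(\<Sum>i<d. ip d (resid d {..<k} v (unit_fun i)) (resid d {..<k} v (unit_fun i))) = real d - real k"
proof -
  have "(\<Sum>i<d. ip d (resid d {..<k} v (unit_fun i)) (resid d {..<k} v (unit_fun i)))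
      = (\<Sum>i<d. 1 - (\<Sum>l<k. (v l i)\<^sup>2))"
    by (intro sum.cong) (auto simp: norm2_resid[OF assms] ip_unit_fun, simp add: unit_fun_def)
  also have "\<dots> = real d - (\<Sum>i<d. \<Sum>l<k. (v l i)\<^sup>2)"
    by (simp add: sum_subtractf)
  also have "(\<Sum>i<d. \<Sum>l<k. (v l i)\<^sup>2) = (\<Sum>l<k. ip d (v l) (v l))"
    unfolding ip_self by (rule sum.swap)
  also have "\<dots> = real k"
    using assms by (simp add: orthonormalD)
  finally show ?thesis .
qed

lemma ex_unit_orthogonal:
  assumes v: "orthonormal d {..<k} v" and "k < d"
  shows "\<exists>x. (\<forall>i\<ge>d. x i = 0) \<and> ip d x x = 1 \<and> (\<forall>l<k. ip d x (v l) = 0)"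
proof -
  let ?r = "\<lambda>i. resid d {..<k} v (unit_fun i)"
  have "\<exists>i<d. ip d (?r i) (?r i) \<noteq> 0"
  proof (rule ccontr)
    assume "\<not> ?thesis"
    then have "(\<Sum>i<d. ip d (?r i) (?r i)) = 0" by simp
    then show False using sum_norm2_resid_unit_fun[OF v] \<open>k < d\<close> by simp
  qed
  then obtain i where i: "ip d (?r i) (?r i) \<noteq> 0" by blast
  define s where "s = 1 / sqrt (ip d (?r i) (?r i))"
  \<comment> \<open>Coordinates beyond \<open>d\<close> are set to 0 because the later maximisation
    runs over a compact set of functions on all of \<open>nat\<close>.\<close>
  define x where "x = (\<lambda>j. if j < d then s * ?r i j else 0)"
  have x: "ip d x z = s * ip d (?r i) z" "ip d z x = s * ip d z (?r i)" for z
    unfolding sum_distrib_left ip_def by (auto simp: x_def intro!: sum.cong)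
  have "s * (s * ip d (?r i) (?r i)) = 1"
    using i ip_self_nonneg[of d "?r i"] by (simp add: s_def field_simps flip: power2_eq_square)
  then have "ip d x x = 1" by (simp add: x)
  moreover have "ip d x (v l) = 0" if "l < k" for l
    using resid_orthogonal[OF v, of l] that by (simp add: x)
  ultimately show ?thesis
    by (intro exI[of _ x]) (auto simp: x_def)
qed

lemma Parseval_coord:
  assumes v: "orthonormal d {..<d} v" and ij: "i < d" "j < d"
  shows "(\<Sum>l<d. v l i * v l j) = of_bool (i = j)"
proof -
  let ?r = "\<lambda>i. resid d {..<d} v (unit_fun i)"
  have "(\<Sum>i<d. ip d (?r i) (?r i)) = 0"
    using sum_norm2_resid_unit_fun[OF v] by simp
  then have "ip d (?r i) (?r i) = 0"
    using ij by (simp add: sum_nonneg_eq_0_iff)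
  then have "?r i j = 0" using ij by (simp add: ip_self_eq_0_iff)
  then show ?thesis using ij
    by (auto simp: resid_def proj_def ip_unit_fun) (simp_all add: unit_fun_def)
qed

section \<open>Matrices acting on functions\<close>

lemma app_adjoint: "ip m (app n Y x) y = ip n x (app m (tr Y) y)"
proof -
  have "ip m (app n Y x) y = (\<Sum>i<m. \<Sum>j<n. Y i j * x j * y i)"
    by (simp add: ip_def app_def sum_distrib_right)
  also have "\<dots> = (\<Sum>j<n. \<Sum>i<m. Y i j * x j * y i)" by (rule sum.swap)
  finally show ?thesis
    by (simp add: ip_def app_def tr_def sum_distrib_left mult_ac)
qed

lemma tr_tr [simp]: "tr (tr Y) = Y"
  by (simp add: tr_def)

lemma app_adjoint': "ip n (app m (tr Y) y) x = ip m y (app n Y x)"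
  using app_adjoint[of m n Y x y] by (simp add: ip_commute)

lemma app_add: "app n Y (\<lambda>i. x i + y i) = (\<lambda>i. app n Y x i + app n Y y i)"
  and app_scale: "app n Y (\<lambda>i. c * x i) = (\<lambda>i. c * app n Y x i)"
  by (simp_all add: app_def fun_eq_iff algebra_simps sum.distrib sum_subtractf sum_distrib_left)

lemma app_cong: "(\<And>i. i < n \<Longrightarrow> x i = y i) \<Longrightarrow> app n Y x = app n Y y"
  by (simp add: app_def)

lemma app_lincomb: "app n Y (\<lambda>i. \<Sum>l\<in>L. c l * u l i) i = (\<Sum>l\<in>L. c l * app n Y (u l) i)"
proof -
  have "app n Y (\<lambda>i. \<Sum>l\<in>L. c l * u l i) i = (\<Sum>j<n. \<Sum>l\<in>L. c l * (Y i j * u l j))"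
    by (simp add: app_def sum_distrib_left mult_ac)
  also have "\<dots> = (\<Sum>l\<in>L. \<Sum>j<n. c l * (Y i j * u l j))" by (rule sum.swap)
  finally show ?thesis by (simp add: app_def sum_distrib_left)
qed

text \<open>Bessel's inequality applied to each row of \<open>Y\<close>; the right side is the
  squared Frobenius norm.\<close>

lemma sum_norm2_app_le:
  assumes "orthonormal n K v" "finite K"
  shows "(\<Sum>l\<in>K. ip m (app n Y (v l)) (app n Y (v l))) \<le> (\<Sum>i<m. \<Sum>j<n. (Y i j)\<^sup>2)"
proof -
  have "(\<Sum>l\<in>K. ip m (app n Y (v l)) (app n Y (v l))) = (\<Sum>l\<in>K. \<Sum>i<m. (ip n (Y i) (v l))\<^sup>2)"
    by (simp add: ip_self[of m] app_def ip_def[of n])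
  also have "\<dots> = (\<Sum>i<m. \<Sum>l\<in>K. (ip n (Y i) (v l))\<^sup>2)" by (rule sum.swap)
  also have "\<dots> \<le> (\<Sum>i<m. ip n (Y i) (Y i))" by (rule sum_mono) (rule Bessel[OF assms])
  finally show ?thesis by (simp add: ip_self)
qed

section \<open>Existence of the singular value decomposition\<close>

text \<open>In the product topology on functions from \<open>nat\<close>, closed and bounded is not
  enough. Pinning the coordinates beyond \<open>d\<close> to 0 puts the set inside a product of
  intervals, which is compact by Tychonoff.\<close>

lemma compact_unit_orthogonal:
  "compact {x. (\<forall>i\<ge>d. x i = 0) \<and> ip d x x = 1 \<and> (\<forall>l<k. ip d x (v l) = 0)}" (is "compact ?C")
proof -
  have c: "continuous_on UNIV (\<lambda>x. ip d x (v l))" "continuous_on UNIV (\<lambda>x. ip d x x)" for l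
    unfolding ip_def
    by (intro continuous_on_sum continuous_on_mult continuous_on_const continuous_on_product_coordinates)+
  have "?C = (\<Inter>i\<in>{d..}. {x. x i = 0}) \<inter> {x. ip d x x = 1} \<inter> (\<Inter>l\<in>{..<k}. {x. ip d x (v l) = 0})"
    by auto
  moreover have "closed \<dots>"
    using c by (intro closed_Int closed_INT ballI closed_Collect_eq continuous_on_const
        continuous_on_product_coordinates)
  ultimately have "closed ?C" by simp
  moreover have "compact (PiE UNIV (\<lambda>_::nat. {-1..1::real}))"
  proof -
    have "compactin (product_topology (\<lambda>_. euclidean) UNIV) (PiE UNIV (\<lambda>_::nat. {-1..1::real}))"
      by (subst compactin_PiE) auto
    then show ?thesis by (simp add: euclidean_product_topology)
  qed
  moreover have "?C \<subseteq> PiE UNIV (\<lambda>_. {-1..1})"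
  proof (intro subsetI PiE_I)
    fix x i assume x: "x \<in> ?C"
    show "x i \<in> {-1..1}"
    proof (cases "i < d")
      case True
      have "(x i)\<^sup>2 \<le> ip d x x"
        unfolding ip_self using True by (intro member_le_sum) auto
      then have "\<bar>x i\<bar> \<le> 1" using x by (simp add: abs_square_le_1)
      then show ?thesis by auto
    qed (use x in auto)
  qed auto
  ultimately show ?thesis
    using compact_Int_closed[of "PiE UNIV (\<lambda>_. {-1..1})" ?C] by (simp add: Int_absorb1)
qed

text \<open>A maximiser of the Rayleigh quotient: the maximum is attained over unit vectors and
  carried to all vectors by homogeneity.\<close>

lemma ex_max_on_orthogonal:
  assumes v: "orthonormal n {..<k} v" and "k < n"
  obtains x where "ip n x x = 1" "\<And>l. l < k \<Longrightarrow> ip n x (v l) = 0"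
    "\<And>z. (\<And>l. l < k \<Longrightarrow> ip n z (v l) = 0) \<Longrightarrow>
      ip m (app n Y z) (app n Y z) \<le> ip m (app n Y x) (app n Y x) * ip n z z"
proof -
  let ?C = "{x. (\<forall>i\<ge>n. x i = 0) \<and> ip n x x = 1 \<and> (\<forall>l<k. ip n x (v l) = 0)}"
  have "continuous_on ?C (\<lambda>x. ip m (app n Y x) (app n Y x))"
    unfolding ip_def app_def
    by (intro continuous_on_sum continuous_on_mult continuous_on_const subset_UNIV
        continuous_on_subset[OF continuous_on_product_coordinates])
  moreover have "?C \<noteq> {}" using ex_unit_orthogonal[OF assms] by blast
  ultimately have "\<exists>x\<in>?C. \<forall>y\<in>?C. ip m (app n Y y) (app n Y y) \<le> ip m (app n Y x) (app n Y x)"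
    by (intro continuous_attains_sup compact_unit_orthogonal)
  then obtain x where x: "x \<in> ?C"
    and max: "\<And>y. y \<in> ?C \<Longrightarrow> ip m (app n Y y) (app n Y y) \<le> ip m (app n Y x) (app n Y x)"
    by blast
  show thesis
  proof (rule that[of x])
    fix z assume z: "\<And>l. l < k \<Longrightarrow> ip n z (v l) = 0"
    show "ip m (app n Y z) (app n Y z) \<le> ip m (app n Y x) (app n Y x) * ip n z z"
    proof (cases "ip n z z = 0")
      case True
      then have "app n Y z = (\<lambda>_. 0)" by (simp add: ip_self_eq_0_iff app_def)
      then show ?thesis using True by (simp add: ip_linear)
    next
      case False
      define s where "s = 1 / sqrt (ip n z z)"
      have pos: "ip n z z > 0" using False ip_self_nonneg[of n z] by linarith
      have s2: "s * s = 1 / ip n z z" using pos by (simp add: s_def)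
      define y where "y = (\<lambda>j. if j < n then s * z j else 0)"
      have y: "ip n y w = s * ip n z w" "ip n w y = s * ip n w z" for w
        unfolding sum_distrib_left ip_def by (auto simp: y_def intro!: sum.cong)
      have ay: "app n Y y = (\<lambda>i. s * app n Y z i)"
        by (subst app_scale[symmetric]) (rule app_cong, simp add: y_def)
      have "ip n y y = (s * s) * ip n z z" by (simp only: y mult.assoc)
      then have "ip n y y = 1" using s2 pos by simp
      moreover have "\<forall>i\<ge>n. y i = 0" by (simp add: y_def)
      moreover have "\<forall>l<k. ip n y (v l) = 0" using z by (simp add: y)
      ultimately have "y \<in> ?C" by blast
      from max[OF this] have "s * s * ip m (app n Y z) (app n Y z) \<le> ip m (app n Y x) (app n Y x)"
        by (simp only: ay ip_linear mult.assoc)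
      then have "ip m (app n Y z) (app n Y z) / ip n z z \<le> ip m (app n Y x) (app n Y x)"
        unfolding s2 by simp
      then show ?thesis using pos by (simp only: pos_divide_le_eq)
    qed
  qed (use x in auto)
qed

text \<open>Both relations belong to the invariant of the construction: the one for
  \<open>tr Y\<close> keeps the next \<open>Y x\<close> orthogonal to the earlier
  \<open>u l\<close>, the one for \<open>Y\<close> keeps images under \<open>tr Y\<close> orthogonal
  to the earlier \<open>v l\<close>.\<close>

definition singular_system ::
  "nat \<Rightarrow> nat \<Rightarrow> (nat \<Rightarrow> nat \<Rightarrow> real) \<Rightarrow> nat \<Rightarrow> (nat \<Rightarrow> real) \<Rightarrow> (nat \<Rightarrow> nat \<Rightarrow> real) \<Rightarrow> (nat \<Rightarrow> nat \<Rightarrow> real) \<Rightarrow> bool"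
where
  "singular_system m n Y k \<sigma> u v \<longleftrightarrow>
     orthonormal m {..<k} u \<and> orthonormal n {..<k} v \<and>
     (\<forall>l<k. 0 \<le> \<sigma> l \<and> (\<forall>i<m. app n Y (v l) i = \<sigma> l * u l i) \<and>
            (\<forall>j<n. app m (tr Y) (u l) j = \<sigma> l * v l j))"

text \<open>For small \<open>s\<close> of the sign of \<open>b\<close> the linear term wins;
  \<open>1 + \<bar>c\<bar>\<close> in the denominator makes \<open>s\<close> small enough whatever
  \<open>c\<close> is.\<close>

lemma linear_le_quadratic_imp_0:
  fixes b c :: real
  assumes "\<And>s. 2 * s * b \<le> s\<^sup>2 * c"
  shows "b = 0"
proof (rule ccontr)
  assume "b \<noteq> 0"
  define s where "s = b / (1 + \<bar>c\<bar>)"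
  have "s * (1 + \<bar>c\<bar>) = b" by (simp add: s_def)
  moreover have "s\<^sup>2 * c \<le> s\<^sup>2 * (1 + \<bar>c\<bar>)" by (intro mult_left_mono) auto
  ultimately have "s\<^sup>2 * c \<le> s * b" by (simp add: power2_eq_square mult.assoc)
  moreover have "s * b > 0"
  proof -
    have "s * b = b\<^sup>2 / (1 + \<bar>c\<bar>)" by (simp add: s_def power2_eq_square)
    then show ?thesis using \<open>b \<noteq> 0\<close> by (simp add: zero_less_divide_iff add_pos_nonneg)
  qed
  ultimately show False using assms[of s] by linarith
qed

text \<open>The new right vector maximises the length of \<open>Y x\<close> among the unit vectors
  orthogonal to the earlier ones; the left vector is \<open>Y x\<close> normalised, unless the
  maximum is 0.\<close>

lemma singular_system_extend:
  assumes sys: "singular_system m n Y k \<sigma> u v" and k: "k < m" "k < n"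
  shows "\<exists>\<sigma>' u' v'. singular_system m n Y (Suc k) \<sigma>' u' v'"
proof -
  from sys have u: "orthonormal m {..<k} u" and v: "orthonormal n {..<k} v"
    and \<sigma>: "\<And>l. l < k \<Longrightarrow> 0 \<le> \<sigma> l"
    and Yv: "\<And>l i. l < k \<Longrightarrow> i < m \<Longrightarrow> app n Y (v l) i = \<sigma> l * u l i"
    and Yu: "\<And>l j. l < k \<Longrightarrow> j < n \<Longrightarrow> app m (tr Y) (u l) j = \<sigma> l * v l j"
    by (auto simp: singular_system_def)
  have ipYv: "ip m y (app n Y (v l)) = \<sigma> l * ip m y (u l)" if "l < k" for l y
    unfolding ip_scale_right[symmetric] by (rule ip_cong) (auto simp: Yv that)
  have ipYu: "ip n x (app m (tr Y) (u l)) = \<sigma> l * ip n x (v l)" if "l < k" for l x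
    unfolding ip_scale_right[symmetric] by (rule ip_cong) (auto simp: Yu that)
  obtain x where x1: "ip n x x = 1" and xv: "\<And>l. l < k \<Longrightarrow> ip n x (v l) = 0"
    and max: "\<And>z. (\<And>l. l < k \<Longrightarrow> ip n z (v l) = 0) \<Longrightarrow>
      ip m (app n Y z) (app n Y z) \<le> ip m (app n Y x) (app n Y x) * ip n z z"
    using ex_max_on_orthogonal[OF v k(2)] by metis
  define lam where "lam = ip m (app n Y x) (app n Y x)"
  have "lam \<ge> 0" by (simp add: lam_def)
  have Yxu: "ip m (app n Y x) (u l) = 0" if "l < k" for l
    using that by (simp add: app_adjoint ipYu xv)
  have "\<exists>s y. 0 \<le> s \<and> ip m y y = 1 \<and> (\<forall>l<k. ip m y (u l) = 0) \<and>
      (\<forall>i<m. app n Y x i = s * y i) \<and> (\<forall>j<n. app m (tr Y) y j = s * x j)"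
  proof (cases "lam = 0")
    case True
    \<comment> \<open>A zero maximum means that \<open>Y\<close> vanishes on the whole complement,
      and \<open>Y x\<close> yields no left vector. Any unit vector orthogonal to the
      \<open>u l\<close> will do: its image under \<open>tr Y\<close> lies in that complement and
      hence is 0.\<close>
    have null: "ip m (app n Y z) (app n Y z) = 0" if "\<And>l. l < k \<Longrightarrow> ip n z (v l) = 0" for z
      using max[OF that] True ip_self_nonneg[of m "app n Y z"] unfolding lam_def by simp
    obtain y where y: "ip m y y = 1" "\<And>l. l < k \<Longrightarrow> ip m y (u l) = 0"
      using ex_unit_orthogonal[OF u k(1)] by blast
    let ?w = "app m (tr Y) y"
    have "ip n ?w (v l) = 0" if "l < k" for l
      using that by (simp add: app_adjoint' ipYv y)
    from null[OF this] have "\<forall>i<m. app n Y ?w i = 0" by (simp add: ip_self_eq_0_iff)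
    then have "ip m y (app n Y ?w) = 0" by (simp add: ip_def)
    then have "ip n ?w ?w = 0" by (simp add: app_adjoint')
    moreover have "\<forall>i<m. app n Y x i = 0" using null[OF xv] by (simp add: ip_self_eq_0_iff)
    ultimately show ?thesis using y
      by (intro exI[of _ 0] exI[of _ y]) (auto simp: ip_self_eq_0_iff)
  next
    case False
    then have lam: "lam > 0" using \<open>lam \<ge> 0\<close> by simp
    let ?a = "app m (tr Y) (app n Y x)"
    \<comment> \<open>Up to a factor, the gradient of the Rayleigh quotient at
      \<open>x\<close>.\<close>
    define w where "w = (\<lambda>j. ?a j - lam * x j)"
    have a: "ip n ?a z = ip m (app n Y x) (app n Y z)" for z by (rule app_adjoint')
    have wv: "ip n w (v l) = 0" if "l < k" for l
      using that by (simp add: w_def ip_linear a ipYv Yxu xv)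
    have wx: "ip n w x = 0" by (simp add: w_def ip_linear a x1 lam_def)
    have b: "ip m (app n Y x) (app n Y w) = ip n w w"
    proof -
      have "ip n ?a w = ip n (\<lambda>j. w j + lam * x j) w" by (simp add: w_def)
      also have "\<dots> = ip n w w" using wx by (simp add: ip_linear ip_commute)
      finally show ?thesis by (simp add: a)
    qed
    \<comment> \<open>First-order optimality of \<open>x\<close> in the admissible direction \<open>w\<close>.\<close>
    have "2 * s * ip n w w \<le> s\<^sup>2 * (lam * ip n w w)" for s
    proof -
      have "ip m (app n Y (\<lambda>j. x j + s * w j)) (app n Y (\<lambda>j. x j + s * w j))
          \<le> lam * ip n (\<lambda>j. x j + s * w j) (\<lambda>j. x j + s * w j)"
        unfolding lam_def by (rule max) (simp add: ip_linear xv wv)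
      also have "ip n (\<lambda>j. x j + s * w j) (\<lambda>j. x j + s * w j) = 1 + s\<^sup>2 * ip n w w"
        using wx by (simp add: ip_linear x1 ip_commute[of n x w] power2_eq_square)
      also have "ip m (app n Y (\<lambda>j. x j + s * w j)) (app n Y (\<lambda>j. x j + s * w j))
          = lam + 2 * s * ip n w w + s\<^sup>2 * ip m (app n Y w) (app n Y w)"
        by (simp add: app_add app_scale ip_linear b ip_commute[of m "app n Y w" "app n Y x"] lam_def
            power2_eq_square algebra_simps)
      finally have "2 * s * ip n w w + s\<^sup>2 * ip m (app n Y w) (app n Y w) \<le> s\<^sup>2 * (lam * ip n w w)"
        by (simp add: algebra_simps)
      moreover have "0 \<le> s\<^sup>2 * ip m (app n Y w) (app n Y w)" by simp
      ultimately show ?thesis by linarith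
    qed
    then have "ip n w w = 0" by (rule linear_le_quadratic_imp_0)
    then have w0: "\<forall>j<n. ?a j = lam * x j" by (simp add: ip_self_eq_0_iff w_def)
    define s where "s = sqrt lam"
    have s: "s > 0" "s * s = lam" using lam by (auto simp: s_def)
    define y where "y = (\<lambda>i. (1 / s) * app n Y x i)"
    have "ip m y y = 1"
      unfolding y_def ip_linear using lam s by (simp add: lam_def[symmetric] field_simps)
    moreover have "ip m y (u l) = 0" if "l < k" for l
      unfolding y_def ip_linear using Yxu[OF that] by simp
    moreover have "app m (tr Y) y j = s * x j" if "j < n" for j
      unfolding y_def app_scale using w0 that s by (simp add: field_simps)
    ultimately show ?thesis using s
      by (intro exI[of _ s] exI[of _ y]) (auto simp: y_def)
  qed
  then obtain s y where s: "0 \<le> s" and y: "ip m y y = 1" "\<And>l. l < k \<Longrightarrow> ip m y (u l) = 0"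
    and xy: "\<And>i. i < m \<Longrightarrow> app n Y x i = s * y i" "\<And>j. j < n \<Longrightarrow> app m (tr Y) y j = s * x j"
    by blast
  have "orthonormal m {..<Suc k} (u(k := y))" "orthonormal n {..<Suc k} (v(k := x))"
    using u v y x1 xv
    by (auto simp: orthonormal_def less_Suc_eq) (simp_all add: ip_commute)
  then have "singular_system m n Y (Suc k) (\<sigma>(k := s)) (u(k := y)) (v(k := x))"
    unfolding singular_system_def using s \<sigma> Yv Yu xy by (auto simp: less_Suc_eq)
  then show ?thesis by blast
qed

lemma singular_system_exists: "k \<le> m \<Longrightarrow> k \<le> n \<Longrightarrow> \<exists>\<sigma> u v. singular_system m n Y k \<sigma> u v"
proof (induction k)
  case 0
  show ?case by (simp add: singular_system_def orthonormal_def)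
next
  case (Suc k)
  then obtain \<sigma> u v where "singular_system m n Y k \<sigma> u v" by auto
  from singular_system_extend[OF this] Suc.prems show ?case by auto
qed

text \<open>On the shorter side the singular vectors form a complete orthonormal basis, and Parseval
  resolves the identity there. Which side that is depends on the shape, hence the two cases.\<close>

lemma singular_value_expansion:
  assumes sys: "singular_system m n Y (min m n) \<sigma> u v" and ij: "i < m" "j < n"
  shows "Y i j = (\<Sum>l<min m n. \<sigma> l * u l i * v l j)"
proof (cases "n \<le> m")
  case True
  then have r: "min m n = n" by simp
  have "(\<Sum>l<n. \<sigma> l * u l i * v l j) = (\<Sum>l<n. app n Y (v l) i * v l j)"
    using sys ij r by (intro sum.cong) (auto simp: singular_system_def)
  also have "\<dots> = (\<Sum>l<n. \<Sum>j'<n. Y i j' * (v l j' * v l j))"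
    by (simp add: app_def sum_distrib_right mult.assoc)
  also have "\<dots> = (\<Sum>j'<n. Y i j' * (\<Sum>l<n. v l j' * v l j))"
    unfolding sum_distrib_left by (rule sum.swap)
  also have "\<dots> = (\<Sum>j'<n. Y i j' * of_bool (j' = j))"
    using sys ij r by (intro sum.cong) (auto simp: singular_system_def Parseval_coord)
  also have "\<dots> = Y i j" using ij by (simp add: of_bool_def if_distrib[of "\<lambda>z. _ * z"] cong: if_cong)
  finally show ?thesis by (simp add: r)
next
  case False
  then have r: "min m n = m" by simp
  have "(\<Sum>l<m. \<sigma> l * u l i * v l j) = (\<Sum>l<m. app m (tr Y) (u l) j * u l i)"
    using sys ij r by (intro sum.cong) (auto simp: singular_system_def mult_ac)
  also have "\<dots> = (\<Sum>l<m. \<Sum>i'<m. Y i' j * (u l i' * u l i))"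
    by (simp add: app_def tr_def sum_distrib_right mult.assoc)
  also have "\<dots> = (\<Sum>i'<m. Y i' j * (\<Sum>l<m. u l i' * u l i))"
    unfolding sum_distrib_left by (rule sum.swap)
  also have "\<dots> = (\<Sum>i'<m. Y i' j * of_bool (i' = i))"
    using sys ij r by (intro sum.cong) (auto simp: singular_system_def Parseval_coord)
  also have "\<dots> = Y i j" using ij by (simp add: of_bool_def if_distrib[of "\<lambda>z. _ * z"] cong: if_cong)
  finally show ?thesis by (simp add: r)
qed

lemma is_svd_svd: "is_svd Y (svd Y)"
proof -
  define m n r where "m = dim_row Y" "n = dim_col Y" "r = min m n"
  obtain \<sigma> u v where sys: "singular_system m n (\<lambda>i j. Y $$ (i, j)) r \<sigma> u v"
    using singular_system_exists[of r m n] unfolding m_n_r_def by (metis min.cobounded1 min.cobounded2)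
  from sys have u: "orthonormal m {..<r} u" and v: "orthonormal n {..<r} v" and pos: "\<forall>l<r. 0 \<le> \<sigma> l"
    by (auto simp: singular_system_def)
  have exp: "\<forall>i<m. \<forall>j<n. Y $$ (i, j) = (\<Sum>l<r. \<sigma> l * u l i * v l j)"
    using singular_value_expansion[of m n "\<lambda>i j. Y $$ (i, j)" \<sigma> u v] sys by (simp add: m_n_r_def)
  have ip_vec: "scalar_prod (Matrix.vec d x) (Matrix.vec d y) = ip d x y" for d x y
    by (simp add: scalar_prod_def ip_def atLeast0LessThan)
  have "is_svd Y (\<sigma>, \<lambda>l. Matrix.vec m (u l), \<lambda>l. Matrix.vec n (v l))"
    unfolding is_svd_def case_prod_conv Let_def m_n_r_def[symmetric] ip_vec
    using pos exp orthonormalD[OF u] orthonormalD[OF v] by simp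
  then show ?thesis unfolding svd_def by (rule someI)
qed

text \<open>The decomposition precedes the threshold: one \<open>\<sigma>\<close>, \<open>u\<close>,
  \<open>v\<close> serves every \<open>t\<close>, because \<open>svd Y\<close> is a fixed
  choice.\<close>

lemma svd_expansion:
  fixes Y :: "real mat"
  assumes Y: "Y \<in> carrier_mat m n"
  obtains \<sigma> u v where "orthonormal m {..<min m n} u" "orthonormal n {..<min m n} v"
    "\<And>l. l < min m n \<Longrightarrow> 0 \<le> \<sigma> l"
    "\<And>i j. i < m \<Longrightarrow> j < n \<Longrightarrow> Y $$ (i, j) = (\<Sum>l<min m n. \<sigma> l * u l i * v l j)"
    "\<And>t i j. i < m \<Longrightarrow> j < n \<Longrightarrow>
       sv_threshold t Y $$ (i, j) = (\<Sum>l | l < min m n \<and> t \<le> \<sigma> l. \<sigma> l * u l i * v l j)"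
proof -
  obtain \<sigma> u v where s: "svd Y = (\<sigma>, u, v)" by (metis prod_cases3)
  have d: "dim_row Y = m" "dim_col Y = n" using Y by auto
  have *: "is_svd Y (\<sigma>, u, v)" using is_svd_svd[of Y] s by simp
  note ** = *[unfolded is_svd_def case_prod_conv Let_def d]
  have c: "0 \<le> \<sigma> l" "u l \<in> carrier_vec m" "v l \<in> carrier_vec n" if "l < min m n" for l
    using conjunct1[OF **, rule_format, OF that] by simp_all
  note uu = conjunct1[OF conjunct2[OF **], rule_format]
    and vv = conjunct1[OF conjunct2[OF conjunct2[OF **]], rule_format]
    and exp = conjunct2[OF conjunct2[OF conjunct2[OF **]], rule_format]
  have ip_vec: "ip e (vec_index x) (vec_index y) = scalar_prod x y" if "y \<in> carrier_vec e" for e and x y :: "real Matrix.vec"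
    using that by (simp add: scalar_prod_def ip_def atLeast0LessThan)
  show thesis
  proof (rule that[of "\<lambda>l. vec_index (u l)" "\<lambda>l. vec_index (v l)" \<sigma>])
    show "orthonormal m {..<min m n} (\<lambda>l. vec_index (u l))"
      unfolding orthonormal_def by (auto simp only: ip_vec[OF c(2)] uu lessThan_iff of_bool_def)
    show "orthonormal n {..<min m n} (\<lambda>l. vec_index (v l))"
      unfolding orthonormal_def by (auto simp only: ip_vec[OF c(3)] vv lessThan_iff of_bool_def)
  next
    fix l assume "l < min m n" then show "0 \<le> \<sigma> l" by (rule c(1))
  next
    fix i j assume "i < m" "j < n"
    then show "Y $$ (i, j) = (\<Sum>l<min m n. \<sigma> l * vec_index (u l) i * vec_index (v l) j)"
      by (rule exp)
  next
    fix t i j assume "i < m" "j < n"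
    then show "sv_threshold t Y $$ (i, j) =
      (\<Sum>l | l < min m n \<and> t \<le> \<sigma> l. \<sigma> l * vec_index (u l) i * vec_index (v l) j)"
      by (simp only: sv_threshold_def s case_prod_conv d index_mat)
  qed
qed

section \<open>Counting closed walks\<close>

text \<open>Walks run in the complete bipartite graph between columns and rows: even times carry a
  column index, odd times a row index.\<close>

definition side :: "nat \<Rightarrow> nat \<Rightarrow> nat \<Rightarrow> nat" where
  "side m n t = (if even t then n else m)"

text \<open>The parity tag keeps row \<open>i\<close> apart from column \<open>i\<close>.\<close>

definition vert :: "(nat \<Rightarrow> nat) \<Rightarrow> nat \<Rightarrow> bool \<times> nat" where
  "vert w t = (even t, w t)"

text \<open>A matrix position with the row first: the direction of travel is forgotten, so both
  traversals pick the same entry of \<open>Z\<close>.\<close>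

definition edge :: "(nat \<Rightarrow> nat) \<Rightarrow> nat \<Rightarrow> nat \<times> nat" where
  "edge w t = (if even t then (w (Suc t), w t) else (w t, w (Suc t)))"

definition news :: "nat \<Rightarrow> (nat \<Rightarrow> nat) \<Rightarrow> nat set" where
  "news k w = {t. t \<le> 2 * k \<and> (\<forall>s<t. vert w s \<noteq> vert w t)}"

abbreviation edge_class :: "nat \<Rightarrow> (nat \<Rightarrow> nat) \<Rightarrow> nat \<times> nat \<Rightarrow> nat set" where
  "edge_class k w e \<equiv> {t\<in>{..<2 * k}. edge w t = e}"

definition paired :: "nat \<Rightarrow> (nat \<Rightarrow> nat) \<Rightarrow> bool" where
  "paired k w \<longleftrightarrow> (\<forall>t<2 * k. \<exists>s<2 * k. s \<noteq> t \<and> edge w s = edge w t)"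

text \<open>Time \<open>2 * k\<close> repeats time 0 instead of being identified with it, so the
  last edge is defined like all others; for positive \<open>k\<close> this last time is never
  new.\<close>

definition closed_walks :: "nat \<Rightarrow> nat \<Rightarrow> nat \<Rightarrow> (nat \<Rightarrow> nat) set" where
  "closed_walks m n k = {w \<in> PiE {..2 * k} (\<lambda>t. {..<side m n t}). w (2 * k) = w 0}"

lemma vert_eq_iff: "vert w s = vert w' t \<longleftrightarrow> even s = even t \<and> w s = w' t"
  by (auto simp: vert_def)

lemma edge_eqD:
  "edge w s = edge w t \<Longrightarrow>
    (vert w s = vert w t \<and> vert w (Suc s) = vert w (Suc t)) \<or>
    (vert w s = vert w (Suc t) \<and> vert w (Suc s) = vert w t)"
  by (cases "even s"; cases "even t") (auto simp: edge_def vert_eq_iff)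

lemma edge_eqI:
  "vert w s = vert w (Suc t) \<Longrightarrow> vert w (Suc s) = vert w t \<Longrightarrow> edge w s = edge w t"
  by (cases "even s"; cases "even t") (auto simp: edge_def vert_eq_iff)

lemma news_notD: "t \<in> news k w \<Longrightarrow> s < t \<Longrightarrow> vert w s \<noteq> vert w t"
  by (auto simp: news_def)

lemma finite_news [simp]: "finite (news k w)"
  by (rule finite_subset[of _ "{..2 * k}"]) (auto simp: news_def)

lemma news_0: "0 \<in> news k w"
  by (simp add: news_def)

lemma news_1: "1 \<le> k \<Longrightarrow> Suc 0 \<in> news k w"
  by (auto simp: news_def vert_def)

text \<open>If the edges leading to two new vertices agreed, the later of these vertices would be an
  endpoint of an edge walked before, hence not new.\<close>

lemma inj_on_entering_edge: "inj_on (\<lambda>t. edge w (t - 1)) (news k w - {0})"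
proof -
  have "edge w (s - 1) \<noteq> edge w (t - 1)"
    if s: "s \<in> news k w - {0}" and t: "t \<in> news k w - {0}" and "s < t" for s t
  proof
    assume "edge w (s - 1) = edge w (t - 1)"
    from edge_eqD[OF this] have "vert w t = vert w s \<or> vert w t = vert w (s - 1)"
      using s t by auto
    then show False using news_notD[of t k w s] news_notD[of t k w "s - 1"] t \<open>s < t\<close>
      less_imp_diff_less[OF \<open>s < t\<close>, of 1] by auto
  qed
  note ne = this
  show ?thesis
  proof (rule inj_onI)
    fix s t assume "s \<in> news k w - {0}" "t \<in> news k w - {0}" "edge w (s - 1) = edge w (t - 1)"
    then show "s = t" using ne[of s t] ne[of t s] by (cases s t rule: linorder_cases) auto
  qed
qed

lemma sum_card_edge_classes:
  "(\<Sum>e\<in>edge w ` {..<2 * k}. card (edge_class k w e)) = 2 * k"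
  using sum.image_gen[of "{..<2 * k}" "\<lambda>_. 1::nat" "edge w"] by simp

lemma card_edge_class_ge_2:
  assumes "paired k w" "e \<in> edge w ` {..<2 * k}"
  shows "2 \<le> card (edge_class k w e)"
proof -
  obtain t where t: "t < 2 * k" "e = edge w t" using assms(2) by auto
  then obtain s where s: "s < 2 * k" "s \<noteq> t" "edge w s = edge w t"
    using assms(1) by (auto simp: paired_def)
  have "card {s, t} \<le> card (edge_class k w e)"
    using s t by (intro card_mono) auto
  then show ?thesis using s by simp
qed

lemma card_edges_le:
  assumes "paired k w"
  shows "card (edge w ` {..<2 * k}) \<le> k"
proof -
  have "(\<Sum>e\<in>edge w ` {..<2 * k}. 2) \<le> (\<Sum>e\<in>edge w ` {..<2 * k}. card (edge_class k w e))"
    by (rule sum_mono) (rule card_edge_class_ge_2[OF assms])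
  then show ?thesis unfolding sum_card_edge_classes by simp
qed

lemma entering_edges_subset: "(\<lambda>t. edge w (t - 1)) ` (news k w - {0}) \<subseteq> edge w ` {..<2 * k}"
  by (auto simp: news_def intro!: imageI)

text \<open>The entering edges are distinct, and at most \<open>k\<close> edges exist when each is
  used at least twice in \<open>2 * k\<close> steps; the start adds one vertex.\<close>

lemma card_news_le:
  assumes "paired k w"
  shows "card (news k w) \<le> k + 1"
proof -
  have "card (news k w - {0}) = card ((\<lambda>t. edge w (t - 1)) ` (news k w - {0}))"
    by (rule card_image[symmetric, OF inj_on_entering_edge])
  also have "\<dots> \<le> card (edge w ` {..<2 * k})"
    by (intro card_mono entering_edges_subset) auto
  also have "\<dots> \<le> k" by (rule card_edges_le[OF assms])
  finally show ?thesis using news_0[of k w] by (simp add: card_Diff_singleton)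
qed

text \<open>A walk with the maximal number \<open>k + 1\<close> of vertices traverses a tree, each edge exactly twice.\<close>

context
  fixes k w
  assumes paired: "paired k w" and max_news: "card (news k w) = k + 1"
begin

lemma card_entering_edges: "card ((\<lambda>t. edge w (t - 1)) ` (news k w - {0})) = k"
  using card_image[OF inj_on_entering_edge, of w k] max_news news_0[of k w]
  by (simp add: card_Diff_singleton)

lemma edges_eq_entering: "edge w ` {..<2 * k} = (\<lambda>t. edge w (t - 1)) ` (news k w - {0})"
  by (rule card_subset_eq[symmetric]) 
    (use entering_edges_subset[of w k] card_entering_edges card_edges_le[OF paired]
        card_mono[OF _ entering_edges_subset[of w k]] in auto)

lemma card_edge_class:
  assumes "e \<in> edge w ` {..<2 * k}"
  shows "card (edge_class k w e) = 2"
proof (rule ccontr)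
  let ?c = "\<lambda>e. card (edge_class k w e)"
  assume "?c e \<noteq> 2"
  then have "2 < ?c e" using card_edge_class_ge_2[OF paired assms] by simp
  then have "(\<Sum>e\<in>edge w ` {..<2 * k}. 2) < (\<Sum>e\<in>edge w ` {..<2 * k}. ?c e)"
    using card_edge_class_ge_2[OF paired] assms by (intro sum_strict_mono_ex1) auto
  then show False
    unfolding sum_card_edge_classes using card_entering_edges edges_eq_entering by simp
qed

lemma edge_not_thrice:
  assumes "a < b" "b < c" "c < 2 * k" "edge w a = edge w c" "edge w b = edge w c"
  shows False
proof -
  have "card {a, b, c} \<le> card (edge_class k w (edge w c))"
    using assms by (intro card_mono) auto
  then show False using card_edge_class[of "edge w c"] assms by simp
qed

text \<open>Every edge is the entering edge of some new vertex and is used just twice. A step to an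
  old vertex therefore reuses the entering edge of some time \<open>s\<close>; what has to be shown
  is that it does so backwards, from that vertex to its parent.\<close>

lemma backtrack:
  "t < 2 * k \<Longrightarrow> Suc t \<notin> news k w \<Longrightarrow>
    \<exists>s. s \<in> news k w \<and> 0 < s \<and> s \<le> t \<and> vert w s = vert w t \<and> vert w (Suc t) = vert w (s - 1)"
proof (induction t rule: less_induct)
  case (less t)
  have "edge w t \<in> (\<lambda>t. edge w (t - 1)) ` (news k w - {0})"
    using less.prems edges_eq_entering by auto
  then obtain s where "s \<in> news k w - {0}" and e: "edge w (s - 1) = edge w t" by force
  then have s: "s \<in> news k w" "0 < s" by auto
  from edge_eqD[OF e] s
  have cases: "(vert w (s - 1) = vert w t \<and> vert w s = vert w (Suc t)) \<or>
      (vert w (s - 1) = vert w (Suc t) \<and> vert w s = vert w t)" by auto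
  have st: "s \<le> t"
  proof (rule ccontr)
    assume "\<not> s \<le> t"
    moreover have "Suc t \<noteq> s" using s less.prems by auto
    ultimately have "Suc t < s" by simp
    then show False using cases news_notD[OF s(1), of t] news_notD[OF s(1), of "Suc t"] by auto
  qed
  show ?case
  proof (cases "vert w (s - 1) = vert w (Suc t) \<and> vert w s = vert w t")
    case True
    then show ?thesis using s st by (intro exI[of _ s]) simp
  next
    case False
    then have bad: "vert w (s - 1) = vert w t" using cases by blast
    \<comment> \<open>The case to be excluded is a second traversal in the same direction, from the
      parent. Between \<open>s\<close> and \<open>t\<close> the walk cannot reach a vertex seen
      before \<open>s\<close>: by induction its steps to old vertices lead to parents, and the only
      such step out of the subtree crosses the entering edge of \<open>s\<close>, which would then
      be used three times.\<close>
    have claim: "s \<le> u \<Longrightarrow> u \<le> t \<Longrightarrow> r < s \<Longrightarrow> vert w r \<noteq> vert w u" for u r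
    proof (induction u arbitrary: r rule: less_induct)
      case (less u)
      show ?case
      proof (cases "u = s \<or> u \<in> news k w")
        case True
        then show ?thesis
          using news_notD[OF s(1)] news_notD[of u k w r] less.prems by auto
      next
        case False
        define x where "x = u - 1"
        have ux: "u = Suc x" "s \<le> x" "x < t" using False less.prems by (auto simp: x_def)
        then obtain y where y: "y \<in> news k w" "0 < y" "y \<le> x" "vert w y = vert w x"
            "vert w u = vert w (y - 1)"
          using \<open>\<And>x. x < t \<Longrightarrow> x < 2 * k \<Longrightarrow> Suc x \<notin> news k w \<Longrightarrow> _ x\<close>[of x] False \<open>t < 2 * k\<close> by auto
        have "s \<le> y" using less.IH[of x y] ux y by fastforce
        moreover have "s \<noteq> y"
        proof
          assume "s = y"
          then have "edge w (s - 1) = edge w x"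
            using y ux by (intro edge_eqI) auto
          then show False
            using edge_not_thrice[of "s - 1" x t] e ux s \<open>t < 2 * k\<close> by (simp add: less_eq_Suc_le)
        qed
        ultimately show ?thesis
          using less.IH[of "y - 1" r] y ux less.prems by simp
      qed
    qed
    from this[of t "s - 1"] show ?thesis using bad st s by simp
  qed
qed

end

text \<open>At a time outside \<open>news\<close> there is no choice: the walk moves to the parent
  of its current vertex, and that parent belongs to the history on which the two walks already
  agree.\<close>

lemma walk_determined:
  assumes w: "paired k w" "card (news k w) = k + 1"
    and w': "paired k w'" "card (news k w') = k + 1"
    and eq: "news k w = news k w'" "\<And>t. t \<in> news k w \<Longrightarrow> w t = w' t"
  shows "t \<le> 2 * k \<Longrightarrow> w t = w' t"
proof (induction t rule: less_induct)
  case (less t)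
  show ?case
  proof (cases "t \<in> news k w")
    case False
    then obtain u where u: "t = Suc u" using news_0[of k w] by (cases t) auto
    have u2: "u < 2 * k" "Suc u \<notin> news k w" "Suc u \<notin> news k w'" using False u less.prems eq by auto
    obtain s where s: "s \<in> news k w" "0 < s" "s \<le> u" "vert w s = vert w u" "vert w (Suc u) = vert w (s - 1)"
      using backtrack[OF w u2(1,2)] by blast
    obtain s' where s': "s' \<in> news k w'" "0 < s'" "s' \<le> u" "vert w' s' = vert w' u"
        "vert w' (Suc u) = vert w' (s' - 1)"
      using backtrack[OF w' u2(1,3)] by blast
    have IH: "vert w r = vert w' r" if "r \<le> u" for r
      using less.IH[of r] that u less.prems by (simp add: vert_def)
    have "vert w s = vert w s'" using s s' IH[of s'] IH[of u] by simp
    then have "s = s'"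
      using news_notD[OF s(1), of s'] news_notD[of s' k w s] s'(1) eq(1)
      by (cases s s' rule: linorder_cases) auto
    then have "vert w (Suc u) = vert w' (Suc u)"
      using s(5) s'(5) IH[of "s - 1"] s(3) by simp
    then show ?thesis by (simp add: u vert_eq_iff)
  qed (use eq in auto)
qed


section \<open>Encoding walks by the times of new vertices\<close>

lemma sets_of_times:
  assumes "A \<subseteq> Pow {..2 * k}"
  shows "finite A" "card A \<le> 2 ^ (2 * k + 1)" "S \<in> A \<Longrightarrow> finite S"
proof -
  have "finite (Pow {..2 * k})" "card (Pow {..2 * k}) = 2 ^ (2 * k + 1)"
    by (simp_all add: card_Pow)
  with assms show "finite A" "card A \<le> 2 ^ (2 * k + 1)"
    using card_mono finite_subset by metis+
  show "finite S" if "S \<in> A"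
    using assms that by (intro finite_subset[of S "{..2 * k}"]) auto
qed

lemma card_Sigma_PiE_le:
  assumes A: "finite A" "\<And>S. S \<in> A \<Longrightarrow> finite S" and B: "\<And>S. S \<in> A \<Longrightarrow> (\<Prod>t\<in>S. c t) \<le> B"
  shows "card (SIGMA S:A. PiE S (\<lambda>t. {..<c t::nat})) \<le> card A * B"
proof -
  have "card (SIGMA S:A. PiE S (\<lambda>t. {..<c t})) = (\<Sum>S\<in>A. card (PiE S (\<lambda>t. {..<c t})))"
    using A by (intro card_SigmaI) (auto intro: finite_PiE)
  also have "\<dots> = (\<Sum>S\<in>A. \<Prod>t\<in>S. c t)"
    using A by (intro sum.cong) (auto simp: card_PiE)
  also have "\<dots> \<le> card A * B"
    using B by (intro sum_bounded_above[where K = B, simplified]) auto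
  finally show ?thesis .
qed

text \<open>Times 0 and 1 contribute exactly \<open>n\<close> and \<open>m\<close>; only the at most
  \<open>c\<close> remaining factors are rounded up to \<open>N\<close>.\<close>

lemma prod_side_le:
  assumes S: "finite S" "0 \<in> S" "Suc 0 \<in> S" "card S \<le> c + 2" and N: "m \<le> N" "n \<le> N" "1 \<le> N"
  shows "(\<Prod>t\<in>S. side m n t) \<le> m * n * N ^ c"
proof -
  have "(\<Prod>t\<in>S. side m n t) = side m n 0 * (side m n (Suc 0) * (\<Prod>t\<in>S - {0} - {Suc 0}. side m n t))"
    using S by (subst prod.remove[of S 0]; simp; subst prod.remove[of "S - {0}" "Suc 0"]; simp)
  also have "(\<Prod>t\<in>S - {0} - {Suc 0}. side m n t) \<le> (\<Prod>t\<in>S - {0} - {Suc 0}. N)"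
    using N by (intro prod_mono) (auto simp: side_def)
  also have "(\<Prod>t\<in>S - {0} - {Suc 0}. N) \<le> N ^ c"
    using S N by (simp add: card_Diff_singleton) (intro power_increasing, auto)
  finally show ?thesis by (simp add: side_def mult_ac)
qed

definition tree_walks :: "nat \<Rightarrow> nat \<Rightarrow> nat \<Rightarrow> (nat \<Rightarrow> nat) set" where
  "tree_walks m n k = {w \<in> closed_walks m n k. paired k w \<and> card (news k w) = k + 1}"

definition thin_walks :: "nat \<Rightarrow> nat \<Rightarrow> nat \<Rightarrow> (nat \<Rightarrow> nat) set" where
  "thin_walks m n k = {w \<in> closed_walks m n k. paired k w \<and> card (news k w) \<le> k}"

lemma finite_closed_walks [simp]: "finite (closed_walks m n k)"
  by (rule finite_subset[of _ "PiE {..2 * k} (\<lambda>t. {..<side m n t})"])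
    (auto simp: closed_walks_def intro!: finite_PiE)

lemma restrict_news_mem:
  assumes "w \<in> closed_walks m n k"
  shows "restrict w (news k w) \<in> PiE (news k w) (\<lambda>t. {..<side m n t})"
  using assms by (auto simp: closed_walks_def news_def PiE_iff)

lemma closed_walks_eqI:
  assumes "w \<in> closed_walks m n k" "w' \<in> closed_walks m n k" "\<And>t. t \<le> 2 * k \<Longrightarrow> w t = w' t"
  shows "w = w'"
  using assms unfolding closed_walks_def by (intro PiE_ext[of w "{..2 * k}" _ w']) auto

text \<open>Not every set of \<open>k + 1\<close> times arises from a tree walk. Counting all
  subsets of the \<open>2 * k + 1\<close> times instead of a Catalan number loses only a factor
  polynomial in \<open>k\<close> and keeps the growth rate \<open>4 ^ k\<close>.\<close>

lemma card_tree_walks_le: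
  assumes k: "1 \<le> k" and N: "m \<le> N" "n \<le> N" "1 \<le> N"
  shows "card (tree_walks m n k) \<le> 2 ^ (2 * k + 1) * (m * n * N ^ (k - 1))"
proof -
  define A where "A = {S. S \<subseteq> {..2 * k} \<and> 0 \<in> S \<and> Suc 0 \<in> S \<and> card S = k + 1}"
  let ?P = "SIGMA S:A. PiE S (\<lambda>t. {..<side m n t})"
  have "A \<subseteq> Pow {..2 * k}" by (auto simp: A_def)
  note A = sets_of_times[OF this]
  have "card (tree_walks m n k) \<le> card ?P"
  proof (rule card_inj_on_le)
    show "inj_on (\<lambda>w. (news k w, restrict w (news k w))) (tree_walks m n k)"
    proof (rule inj_onI)
      fix w w' assume *: "w \<in> tree_walks m n k" "w' \<in> tree_walks m n k"
        "(news k w, restrict w (news k w)) = (news k w', restrict w' (news k w'))"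
      then have S: "news k w = news k w'" "restrict w (news k w) = restrict w' (news k w)" by auto
      have "w t = w' t" if "t \<in> news k w" for t
        using fun_cong[OF S(2), of t] that by simp
      moreover have w: "w \<in> closed_walks m n k" "paired k w" "card (news k w) = k + 1"
        and w': "w' \<in> closed_walks m n k" "paired k w'" "card (news k w') = k + 1"
        using * by (simp_all add: tree_walks_def)
      ultimately have "w t = w' t" if "t \<le> 2 * k" for t
        using walk_determined[OF w(2,3) w'(2,3) S(1) _ that] by blast
      then show "w = w'" by (rule closed_walks_eqI[OF w(1) w'(1)])
    qed
    show "(\<lambda>w. (news k w, restrict w (news k w))) ` tree_walks m n k \<subseteq> ?P"
    proof (rule image_subsetI)
      fix w assume w: "w \<in> tree_walks m n k"
      have "news k w \<subseteq> {..2 * k}" by (auto simp: news_def)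
      then have "news k w \<in> A" using w news_0 news_1[OF k] by (simp add: tree_walks_def A_def)
      moreover have "restrict w (news k w) \<in> PiE (news k w) (\<lambda>t. {..<side m n t})"
        using w by (intro restrict_news_mem) (simp add: tree_walks_def)
      ultimately show "(news k w, restrict w (news k w)) \<in> ?P" by blast
    qed
    show "finite ?P" using A by (intro finite_SigmaI finite_PiE) auto
  qed
  also have "\<dots> \<le> card A * (m * n * N ^ (k - 1))"
  proof (rule card_Sigma_PiE_le[OF A(1,3)])
    fix S assume "S \<in> A"
    then show "(\<Prod>t\<in>S. side m n t) \<le> m * n * N ^ (k - 1)"
      using N k A(3)[of S] by (intro prod_side_le) (auto simp: A_def)
  qed
  also have "\<dots> \<le> 2 ^ (2 * k + 1) * (m * n * N ^ (k - 1))" using A(2) by (rule mult_right_mono) simp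
  finally show ?thesis .
qed

definition first_visit :: "(nat \<Rightarrow> nat) \<Rightarrow> nat \<Rightarrow> nat" where
  "first_visit w t = (LEAST s. vert w s = vert w t)"

lemma first_visit: "vert w (first_visit w t) = vert w t" "first_visit w t \<le> t"
  unfolding first_visit_def by (rule LeastI[of _ t], simp) (rule Least_le, simp)

lemma first_visit_news: "t \<le> 2 * k \<Longrightarrow> first_visit w t \<in> news k w"
proof -
  assume "t \<le> 2 * k"
  moreover have "vert w s \<noteq> vert w (first_visit w t)" if "s < first_visit w t" for s
    using not_less_Least[OF that[unfolded first_visit_def]] first_visit(1)[of w t] by simp
  ultimately show ?thesis using first_visit(2)[of w t] by (simp add: news_def)
qed

text \<open>One vertex fewer saves a factor \<open>N\<close>, so any encoding with boundedly many
  patterns is good enough. Beside the new times and their vertices, the whole map from times to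
  first visits is recorded; it has at most \<open>(2 * k + 1) ^ (2 * k + 1)\<close> values, a
  constant for fixed \<open>k\<close>.\<close>

lemma card_thin_walks_le:
  assumes k: "2 \<le> k" and N: "m \<le> N" "n \<le> N" "1 \<le> N"
  shows "card (thin_walks m n k) \<le> 2 ^ (2 * k + 1) * (2 * k + 1) ^ (2 * k + 1) * (m * n * N ^ (k - 2))"
proof -
  define A where "A = {S. S \<subseteq> {..2 * k} \<and> 0 \<in> S \<and> Suc 0 \<in> S \<and> card S \<le> k}"
  let ?P = "SIGMA S:A. PiE S (\<lambda>t. {..<side m n t})"
  let ?F = "PiE {..2 * k} (\<lambda>_. {..2 * k})"
  let ?f = "\<lambda>w. ((news k w, restrict w (news k w)), restrict (first_visit w) {..2 * k})"
  have "A \<subseteq> Pow {..2 * k}" by (auto simp: A_def)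
  note A = sets_of_times[OF this]
  have finP: "finite ?P" using A by (intro finite_SigmaI finite_PiE) auto
  have "card (thin_walks m n k) \<le> card (?P \<times> ?F)"
  proof (rule card_inj_on_le)
    show "inj_on ?f (thin_walks m n k)"
    proof (rule inj_onI)
      fix w w' assume w: "w \<in> thin_walks m n k" "w' \<in> thin_walks m n k" and eq: "?f w = ?f w'"
      then have S: "restrict w (news k w) = restrict w' (news k w)" 
        and F: "restrict (first_visit w) {..2 * k} = restrict (first_visit w') {..2 * k}" by auto
      have "w t = w' t" if t: "t \<le> 2 * k" for t
      proof -
        have "first_visit w t = first_visit w' t" using fun_cong[OF F, of t] t by simp
        moreover have "w (first_visit w t) = w' (first_visit w t)"
          using fun_cong[OF S, of "first_visit w t"] first_visit_news[OF t, of w] by simp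
        ultimately have "w (first_visit w t) = w' (first_visit w' t)" by simp
        then show ?thesis using first_visit(1)[of w t] first_visit(1)[of w' t] by (simp add: vert_eq_iff)
      qed
      with w show "w = w'" unfolding thin_walks_def by (intro closed_walks_eqI[of w m n k w']) auto
    qed
    show "?f ` thin_walks m n k \<subseteq> ?P \<times> ?F"
    proof (rule image_subsetI)
      fix w assume w: "w \<in> thin_walks m n k"
      have "news k w \<subseteq> {..2 * k}" by (auto simp: news_def)
      then have "news k w \<in> A" using w news_0[of k w] news_1[of k w] k by (simp add: thin_walks_def A_def)
      moreover have "restrict w (news k w) \<in> PiE (news k w) (\<lambda>t. {..<side m n t})"
        using w by (intro restrict_news_mem) (auto simp: thin_walks_def)
      moreover have "restrict (first_visit w) {..2 * k} \<in> ?F"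
        using first_visit(2)[of w] by (auto simp: PiE_iff intro: order_trans)
      ultimately show "?f w \<in> ?P \<times> ?F" by blast
    qed
    show "finite (?P \<times> ?F)" using finP by (intro finite_cartesian_product finite_PiE) auto
  qed
  also have "\<dots> = card ?P * (2 * k + 1) ^ (2 * k + 1)"
    by (simp add: card_cartesian_product card_PiE)
  also have "card ?P \<le> card A * (m * n * N ^ (k - 2))"
  proof (rule card_Sigma_PiE_le[OF A(1,3)])
    fix S assume "S \<in> A"
    then show "(\<Prod>t\<in>S. side m n t) \<le> m * n * N ^ (k - 2)"
      using N k A(3)[of S] by (intro prod_side_le) (auto simp: A_def)
  qed
  also have "\<dots> \<le> 2 ^ (2 * k + 1) * (m * n * N ^ (k - 2))" using A(2) by (rule mult_right_mono) simp
  finally show ?thesis by (simp add: mult_ac)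
qed

section \<open>Trace moments of the noise\<close>

definition gram :: "nat \<Rightarrow> nat \<Rightarrow> (nat \<Rightarrow> nat \<Rightarrow> real) \<Rightarrow> (nat \<Rightarrow> real) \<Rightarrow> nat \<Rightarrow> real" where
  "gram m n Z x = app m (tr Z) (app n Z x)"

text \<open>The trace of the \<open>k\<close>-th power of the Gram matrix, written with the iterated
  map so that no matrix product has to be formed.\<close>

definition gram_trace :: "nat \<Rightarrow> nat \<Rightarrow> (nat \<Rightarrow> nat \<Rightarrow> real) \<Rightarrow> nat \<Rightarrow> real" where
  "gram_trace m n Z k = (\<Sum>a<n. (gram m n Z ^^ k) (unit_fun a) a)"

lemma sum_PiE_insert:
  fixes f :: "('i \<Rightarrow> 'b) \<Rightarrow> real"
  assumes "T \<notin> A"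
  shows "(\<Sum>w\<in>PiE (insert T A) B. f w) = (\<Sum>c\<in>B T. \<Sum>w\<in>PiE A B. f (w(T := c)))"
proof -
  have "(\<Sum>w\<in>PiE (insert T A) B. f w) = (\<Sum>(c, w)\<in>B T \<times> PiE A B. f (w(T := c)))"
    unfolding PiE_insert_eq using inj_combinator[OF assms, of B]
    by (subst sum.reindex) (auto simp: case_prod_unfold comp_def)
  then show ?thesis by (simp add: sum.cartesian_product)
qed

text \<open>The entry of \<open>Z\<close> met on the way from \<open>c\<close> at time
  \<open>t\<close> to \<open>y\<close>: an even step leaves a column, so there \<open>c\<close> is
  the column index.\<close>

definition step :: "(nat \<Rightarrow> nat \<Rightarrow> real) \<Rightarrow> nat \<Rightarrow> nat \<Rightarrow> nat \<Rightarrow> real" where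
  "step Z t c y = (if even t then Z y c else Z c y)"

fun walk_vec :: "nat \<Rightarrow> nat \<Rightarrow> (nat \<Rightarrow> nat \<Rightarrow> real) \<Rightarrow> (nat \<Rightarrow> real) \<Rightarrow> nat \<Rightarrow> nat \<Rightarrow> real" where
  "walk_vec m n Z x 0 = x"
| "walk_vec m n Z x (Suc t) = (\<lambda>y. \<Sum>c<side m n t. walk_vec m n Z x t c * step Z t c y)"

lemma gram_pow_eq_walk_vec: "(gram m n Z ^^ k) x = walk_vec m n Z x (2 * k)"
  by (induction k) (simp_all add: gram_def app_def tr_def side_def step_def mult.commute)

text \<open>The sum ranges over the times before \<open>T\<close>; the update
  \<open>w(T := y)\<close> pins the end point.\<close>

lemma walk_vec_expand:
  "walk_vec m n Z x T y = (\<Sum>w\<in>PiE {..<T} (\<lambda>t. {..<side m n t}).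
     x ((w(T := y)) 0) * (\<Prod>t<T. step Z t ((w(T := y)) t) ((w(T := y)) (Suc t))))"
proof (induction T arbitrary: y)
  case (Suc T)
  have "walk_vec m n Z x (Suc T) y = (\<Sum>c<side m n T. \<Sum>w\<in>PiE {..<T} (\<lambda>t. {..<side m n t}).
     x ((w(T := c)) 0) * (\<Prod>t<T. step Z t ((w(T := c)) t) ((w(T := c)) (Suc t))) * step Z T c y)"
    by (simp add: Suc.IH sum_distrib_right)
  also have "\<dots> = (\<Sum>c<side m n T. \<Sum>w\<in>PiE {..<T} (\<lambda>t. {..<side m n t}).
     x ((w(T := c, Suc T := y)) 0) *
     (\<Prod>t<Suc T. step Z t ((w(T := c, Suc T := y)) t) ((w(T := c, Suc T := y)) (Suc t))))"
  proof (intro sum.cong refl)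
    fix c w
    have "(\<Prod>t<T. step Z t ((w(T := c, Suc T := y)) t) ((w(T := c, Suc T := y)) (Suc t)))
        = (\<Prod>t<T. step Z t ((w(T := c)) t) ((w(T := c)) (Suc t)))"
      by (rule prod.cong) auto
    then show "x ((w(T := c)) 0) * (\<Prod>t<T. step Z t ((w(T := c)) t) ((w(T := c)) (Suc t))) * step Z T c y
      = x ((w(T := c, Suc T := y)) 0) *
        (\<Prod>t<Suc T. step Z t ((w(T := c, Suc T := y)) t) ((w(T := c, Suc T := y)) (Suc t)))"
      by (simp add: mult.assoc)
  qed
  also have "\<dots> = (\<Sum>w\<in>PiE (insert T {..<T}) (\<lambda>t. {..<side m n t}).
     x ((w(Suc T := y)) 0) * (\<Prod>t<Suc T. step Z t ((w(Suc T := y)) t) ((w(Suc T := y)) (Suc t))))"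
    by (subst sum_PiE_insert) auto
  finally show ?case by (simp add: lessThan_Suc)
qed simp

lemma gram_trace_expand:
  "gram_trace m n Z k = (\<Sum>w\<in>closed_walks m n k. \<Prod>t<2 * k. Z (fst (edge w t)) (snd (edge w t)))"
proof -
  let ?B = "\<lambda>t. {..<side m n t}"
  let ?P = "\<lambda>w. \<Prod>t<2 * k. step Z t (w t) (w (Suc t))"
  have "gram_trace m n Z k = (\<Sum>a<side m n (2 * k). \<Sum>w\<in>PiE {..<2 * k} ?B.
      unit_fun ((w(2 * k := a)) (2 * k)) ((w(2 * k := a)) 0) * ?P (w(2 * k := a)))"
    unfolding gram_trace_def gram_pow_eq_walk_vec walk_vec_expand by (simp add: side_def)
  also have "\<dots> = (\<Sum>w\<in>PiE (insert (2 * k) {..<2 * k}) ?B. unit_fun (w (2 * k)) (w 0) * ?P w)"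
    by (subst sum_PiE_insert) auto
  also have "insert (2 * k) {..<2 * k} = {..2 * k}"
    by (simp add: lessThan_Suc_atMost[symmetric] lessThan_Suc)
  \<comment> \<open>The factor \<open>unit_fun (w (2 * k)) (w 0)\<close> is the indicator of
    closedness.\<close>
  also have "(\<Sum>w\<in>PiE {..2 * k} ?B. unit_fun (w (2 * k)) (w 0) * ?P w) = (\<Sum>w\<in>closed_walks m n k. ?P w)"
    unfolding closed_walks_def
    by (rule sum.mono_neutral_cong_right) (auto intro!: finite_PiE simp: unit_fun_def)
  also have "\<dots> = (\<Sum>w\<in>closed_walks m n k. \<Prod>t<2 * k. Z (fst (edge w t)) (snd (edge w t)))"
    by (intro sum.cong prod.cong) (auto simp: step_def edge_def)
  finally show ?thesis .
qed

lemma edge_mem: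
  assumes w: "w \<in> closed_walks m n k" and t: "t < 2 * k"
  shows "edge w t \<in> {..<m} \<times> {..<n}"
proof -
  have "w t < side m n t" "w (Suc t) < side m n (Suc t)"
    using w t by (auto simp: closed_walks_def PiE_iff)
  then show ?thesis by (auto simp: edge_def side_def split: if_splits)
qed

text \<open>Modelled on an entry in \<open>{-1..1}\<close> minus its mean. The bound 2 affects the
  moment only in terms of lower order; the leading term is governed by the variance bound 1.\<close>

locale noise = prob_space +
  fixes m n :: nat and Z :: "nat \<Rightarrow> nat \<Rightarrow> 'a \<Rightarrow> real"
  assumes indep: "indep_vars (\<lambda>_. borel) (\<lambda>e. Z (fst e) (snd e)) ({..<m} \<times> {..<n})"
    and bounded: "i < m \<Longrightarrow> j < n \<Longrightarrow> \<omega> \<in> space M \<Longrightarrow> \<bar>Z i j \<omega>\<bar> \<le> 2"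
    and centered: "i < m \<Longrightarrow> j < n \<Longrightarrow> expectation (Z i j) = 0"
    and variance_le: "i < m \<Longrightarrow> j < n \<Longrightarrow> expectation (\<lambda>\<omega>. (Z i j \<omega>)\<^sup>2) \<le> 1"
begin

abbreviation walk_prod :: "nat \<Rightarrow> (nat \<Rightarrow> nat) \<Rightarrow> 'a \<Rightarrow> real" where
  "walk_prod k w \<equiv> \<lambda>\<omega>. \<Prod>t<2 * k. Z (fst (edge w t)) (snd (edge w t)) \<omega>"

lemma measurable_Z: "i < m \<Longrightarrow> j < n \<Longrightarrow> Z i j \<in> borel_measurable M"
  using indep by (auto simp: indep_vars_def)

lemma integrable_Z_power:
  assumes "i < m" "j < n"
  shows "integrable M (\<lambda>\<omega>. Z i j \<omega> ^ c)"
proof (rule integrable_const_bound[where B = "2 ^ c"])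
  show "AE \<omega> in M. norm (Z i j \<omega> ^ c) \<le> 2 ^ c"
    using bounded[OF assms] by (intro AE_I2) (simp add: power_abs power_mono)
qed (use measurable_Z[OF assms] in simp)

text \<open>Independence concerns distinct entries, so repeated traversals are first collected into
  powers.\<close>

lemma walk_product_eq:
  "walk_prod k w \<omega> =
    (\<Prod>e\<in>edge w ` {..<2 * k}. Z (fst e) (snd e) \<omega> ^ card (edge_class k w e))"
proof -
  have "walk_prod k w \<omega> =
    (\<Prod>e\<in>edge w ` {..<2 * k}. \<Prod>t\<in>edge_class k w e. Z (fst (edge w t)) (snd (edge w t)) \<omega>)"
    by (rule prod.image_gen) simp
  also have "\<dots> = (\<Prod>e\<in>edge w ` {..<2 * k}. \<Prod>t\<in>edge_class k w e. Z (fst e) (snd e) \<omega>)"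
    by (intro prod.cong) auto
  finally show ?thesis by simp
qed

lemma integrable_walk_product:
  assumes w: "w \<in> closed_walks m n k"
  shows "integrable M (walk_prod k w)"
    and "\<omega> \<in> space M \<Longrightarrow> \<bar>walk_prod k w \<omega>\<bar> \<le> 2 ^ (2 * k)"
proof -
  have e: "fst (edge w t) < m" "snd (edge w t) < n" if "t < 2 * k" for t
    using edge_mem[OF w that] by (auto simp: mem_Times_iff)
  have b: "\<bar>walk_prod k w \<omega>\<bar> \<le> 2 ^ (2 * k)" if "\<omega> \<in> space M" for \<omega>
  proof -
    have "(\<Prod>t<2 * k. \<bar>Z (fst (edge w t)) (snd (edge w t)) \<omega>\<bar>) \<le> (\<Prod>t<2 * k. 2)"
      using that e bounded by (intro prod_mono) auto
    then show ?thesis by (simp add: abs_prod)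
  qed
  show "integrable M (walk_prod k w)"
  proof (rule integrable_const_bound[where B = "2 ^ (2 * k)"])
    show "AE \<omega> in M. norm (walk_prod k w \<omega>) \<le> 2 ^ (2 * k)"
      using b by (intro AE_I2) simp
    show "(walk_prod k w) \<in> borel_measurable M"
      using e measurable_Z by (intro borel_measurable_prod) auto
  qed
  show "\<omega> \<in> space M \<Longrightarrow> \<bar>walk_prod k w \<omega>\<bar> \<le> 2 ^ (2 * k)" by (rule b)
qed

lemma expectation_walk_product:
  assumes w: "w \<in> closed_walks m n k"
  shows "expectation (walk_prod k w) =
    (\<Prod>e\<in>edge w ` {..<2 * k}. expectation (\<lambda>\<omega>. Z (fst e) (snd e) \<omega> ^ card (edge_class k w e)))"
  unfolding walk_product_eq
proof (rule indep_vars_lebesgue_integral)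
  have sub: "edge w ` {..<2 * k} \<subseteq> {..<m} \<times> {..<n}"
    using edge_mem[OF w] by (intro image_subsetI) simp
  show "indep_vars (\<lambda>_. borel) (\<lambda>e \<omega>. Z (fst e) (snd e) \<omega> ^ card (edge_class k w e)) (edge w ` {..<2 * k})"
    by (rule indep_vars_compose2[where X = "\<lambda>e. Z (fst e) (snd e)", OF indep_vars_subset[OF indep sub]]) simp
  fix e assume "e \<in> edge w ` {..<2 * k}"
  then have "e \<in> {..<m} \<times> {..<n}" using sub by blast
  then show "integrable M (\<lambda>\<omega>. Z (fst e) (snd e) \<omega> ^ card (edge_class k w e))"
    by (intro integrable_Z_power) (simp_all add: mem_Times_iff)
qed simp

text \<open>An edge used only once contributes a factor of mean 0.\<close>

lemma expectation_unpaired_walk: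
  assumes w: "w \<in> closed_walks m n k" and "\<not> paired k w"
  shows "expectation (walk_prod k w) = 0"
proof -
  obtain t where t: "t < 2 * k" "\<And>s. s < 2 * k \<Longrightarrow> s \<noteq> t \<Longrightarrow> edge w s \<noteq> edge w t"
    using assms(2) by (auto simp: paired_def)
  then have "edge_class k w (edge w t) = {t}" by auto
  then have "expectation (\<lambda>\<omega>. Z (fst (edge w t)) (snd (edge w t)) \<omega> ^ card (edge_class k w (edge w t))) = 0"
    using edge_mem[OF w t(1)] by (simp add: centered mem_Times_iff)
  then show ?thesis
    unfolding expectation_walk_product[OF w] using t(1) by (intro prod_zero) auto
qed

lemma expectation_tree_walk:
  assumes w: "w \<in> tree_walks m n k"
  shows "expectation (walk_prod k w) \<le> 1"
proof -
  have w': "w \<in> closed_walks m n k" "paired k w" "card (news k w) = k + 1"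
    using w by (auto simp: tree_walks_def)
  show ?thesis
    unfolding expectation_walk_product[OF w'(1)]
  proof (rule prod_le_1)
    fix e assume e: "e \<in> edge w ` {..<2 * k}"
    then have "e \<in> {..<m} \<times> {..<n}" using edge_mem[OF w'(1)] by auto
    then show "0 \<le> expectation (\<lambda>\<omega>. Z (fst e) (snd e) \<omega> ^ card (edge_class k w e)) \<and>
      expectation (\<lambda>\<omega>. Z (fst e) (snd e) \<omega> ^ card (edge_class k w e)) \<le> 1"
      unfolding card_edge_class[OF w'(2,3) e] by (auto simp: mem_Times_iff intro: variance_le)
  qed
qed

lemma integrable_gram_trace: "integrable M (\<lambda>\<omega>. gram_trace m n (\<lambda>i j. Z i j \<omega>) k)"
  unfolding gram_trace_expand by (intro Bochner_Integration.integrable_sum integrable_walk_product)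

text \<open>Tree walks weigh at most 1 each and give the leading term. Thin walks weigh at most
  \<open>2 ^ (2 * k)\<close>; with the \<open>2 ^ (2 * k + 1)\<close> of their count this makes
  \<open>2 ^ (4 * k + 1)\<close>.\<close>

lemma expectation_gram_trace_le:
  assumes k: "2 \<le> k" and N: "m \<le> N" "n \<le> N" "1 \<le> N"
  shows "expectation (\<lambda>\<omega>. gram_trace m n (\<lambda>i j. Z i j \<omega>) k) \<le>
    2 ^ (2 * k + 1) * (real m * real n * real N ^ (k - 1)) +
    real (2 ^ (4 * k + 1) * (2 * k + 1) ^ (2 * k + 1)) * (real m * real n * real N ^ (k - 2))"
proof -
  let ?E = "\<lambda>w. expectation (walk_prod k w)"
  have fin: "finite (tree_walks m n k)" "finite (thin_walks m n k)"
    by (rule finite_subset[OF _ finite_closed_walks[of m n k]], auto simp: tree_walks_def thin_walks_def)+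
  have disj: "tree_walks m n k \<inter> thin_walks m n k = {}"
    by (auto simp: tree_walks_def thin_walks_def)
  have "expectation (\<lambda>\<omega>. gram_trace m n (\<lambda>i j. Z i j \<omega>) k) = (\<Sum>w\<in>closed_walks m n k. ?E w)"
    unfolding gram_trace_expand by (rule Bochner_Integration.integral_sum) (rule integrable_walk_product)
  also have "\<dots> = (\<Sum>w\<in>tree_walks m n k \<union> thin_walks m n k. ?E w)"
  proof (rule sum.mono_neutral_right)
    show "\<forall>w\<in>closed_walks m n k - (tree_walks m n k \<union> thin_walks m n k). ?E w = 0"
    proof
      fix w assume w: "w \<in> closed_walks m n k - (tree_walks m n k \<union> thin_walks m n k)"
      then have "\<not> paired k w" using card_news_le[of k w] by (auto simp: tree_walks_def thin_walks_def)
      then show "?E w = 0" using w by (intro expectation_unpaired_walk) auto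
    qed
  qed (auto simp: tree_walks_def thin_walks_def)
  also have "\<dots> = (\<Sum>w\<in>tree_walks m n k. ?E w) + (\<Sum>w\<in>thin_walks m n k. ?E w)"
    using fin disj by (rule sum.union_disjoint)
  also have "\<dots> \<le> (\<Sum>w\<in>tree_walks m n k. 1) + (\<Sum>w\<in>thin_walks m n k. 2 ^ (2 * k))"
  proof (intro add_mono sum_mono)
    fix w assume "w \<in> thin_walks m n k"
    then have w: "w \<in> closed_walks m n k" by (simp add: thin_walks_def)
    show "?E w \<le> 2 ^ (2 * k)"
      using integrable_walk_product(2)[OF w]
      by (intro integral_le_const integrable_walk_product(1)[OF w] AE_I2) (simp add: abs_le_iff)
  qed (rule expectation_tree_walk)
  also have "\<dots> = real (card (tree_walks m n k)) + 2 ^ (2 * k) * real (card (thin_walks m n k))"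
    by simp
  also have "\<dots> \<le> real (2 ^ (2 * k + 1) * (m * n * N ^ (k - 1))) +
      2 ^ (2 * k) * real (2 ^ (2 * k + 1) * (2 * k + 1) ^ (2 * k + 1) * (m * n * N ^ (k - 2)))"
    using card_tree_walks_le[of k m N n] card_thin_walks_le[of k m N n] k N
    by (intro add_mono mult_left_mono of_nat_mono) auto
  also have "\<dots> = 2 ^ (2 * k + 1) * (real m * real n * real N ^ (k - 1)) +
    real (2 ^ (4 * k + 1) * (2 * k + 1) ^ (2 * k + 1)) * (real m * real n * real N ^ (k - 2))"
    by (simp add: power_add[symmetric] mult.assoc[symmetric])
  finally show ?thesis .
qed

end

section \<open>Deterministic error of singular value thresholding\<close>

lemma ip_gram: "ip n x (gram m n Z y) = ip m (app n Z x) (app n Z y)"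
  unfolding gram_def by (rule app_adjoint[symmetric])

lemma gram_sym: "ip n (gram m n Z x) y = ip n x (gram m n Z y)"
  unfolding ip_gram by (subst ip_commute) (simp add: ip_gram ip_commute)

lemma gram_pow_sym: "ip n ((gram m n Z ^^ k) x) y = ip n x ((gram m n Z ^^ k) y)"
proof (induction k arbitrary: x y)
  case (Suc k)
  have "ip n ((gram m n Z ^^ Suc k) x) y = ip n (gram m n Z ((gram m n Z ^^ k) x)) y" by simp
  also have "\<dots> = ip n x ((gram m n Z ^^ k) (gram m n Z y))" by (simp only: gram_sym Suc.IH)
  finally show ?case by (simp only: funpow_Suc_right comp_apply)
qed simp

lemma ip_gram_pow_double:
  "ip n ((gram m n Z ^^ k) x) ((gram m n Z ^^ k) x) = ip n x ((gram m n Z ^^ (2 * k)) x)"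
  unfolding gram_pow_sym by (simp add: mult_2 funpow_add)

text \<open>Jensen's inequality for the spectral measure of \<open>x\<close>, obtained without a
  spectral theorem: each use of Cauchy-Schwarz doubles the exponent. This is why the exponents are
  powers of two.\<close>

lemma norm2_app_pow_le:
  assumes x: "ip n x x = 1"
  shows "ip m (app n Z x) (app n Z x) ^ (2 ^ p) \<le> ip n x ((gram m n Z ^^ (2 ^ p)) x)"
proof (induction p)
  case (Suc p)
  let ?a = "\<lambda>k. ip n x ((gram m n Z ^^ k) x)"
  have "ip m (app n Z x) (app n Z x) ^ (2 ^ Suc p) = (ip m (app n Z x) (app n Z x) ^ (2 ^ p))\<^sup>2"
    by (simp add: power_mult[symmetric] mult.commute)
  also have "\<dots> \<le> (?a (2 ^ p))\<^sup>2" by (intro power_mono Suc.IH) simp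
  also have "\<dots> \<le> ip n x x * ?a (2 * 2 ^ p)"
    using ip_Cauchy_Schwarz[of n x "(gram m n Z ^^ (2 ^ p)) x"] by (simp only: ip_gram_pow_double)
  finally show ?case by (simp add: x)
qed (simp add: ip_gram)

text \<open>An even exponent makes every summand a squared norm, so Bessel's inequality replaces a
  change of basis in the trace.\<close>

lemma sum_ip_gram_pow_le:
  assumes v: "orthonormal n K v" "finite K"
  shows "(\<Sum>l\<in>K. ip n (v l) ((gram m n Z ^^ (2 * k)) (v l))) \<le> gram_trace m n Z (2 * k)"
proof -
  let ?H = "gram m n Z ^^ k"
  have "(\<Sum>l\<in>K. ip n (v l) ((gram m n Z ^^ (2 * k)) (v l))) = (\<Sum>l\<in>K. \<Sum>a<n. (?H (v l) a)\<^sup>2)"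
    by (simp only: ip_gram_pow_double[symmetric] ip_self)
  also have "\<dots> = (\<Sum>l\<in>K. \<Sum>a<n. (ip n (?H (unit_fun a)) (v l))\<^sup>2)"
    by (intro sum.cong) (auto simp: gram_pow_sym ip_unit_fun)
  also have "\<dots> = (\<Sum>a<n. \<Sum>l\<in>K. (ip n (?H (unit_fun a)) (v l))\<^sup>2)" by (rule sum.swap)
  also have "\<dots> \<le> (\<Sum>a<n. ip n (?H (unit_fun a)) (?H (unit_fun a)))"
    by (rule sum_mono) (rule Bessel[OF v])
  also have "\<dots> = gram_trace m n Z (2 * k)"
    unfolding gram_trace_def by (intro sum.cong) (auto simp: ip_gram_pow_double ip_unit_fun)
  finally show ?thesis .
qed

lemma sum_norm2_app_pow_le_trace:
  assumes v: "orthonormal n K v" "finite K" and p: "1 \<le> p"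
  shows "(\<Sum>l\<in>K. ip m (app n Z (v l)) (app n Z (v l)) ^ (2 ^ p)) \<le> gram_trace m n Z (2 ^ p)"
proof -
  have p2: "(2::nat) ^ p = 2 * 2 ^ (p - 1)" using p by (simp add: power_Suc[symmetric])
  have "(\<Sum>l\<in>K. ip m (app n Z (v l)) (app n Z (v l)) ^ (2 ^ p))
      \<le> (\<Sum>l\<in>K. ip n (v l) ((gram m n Z ^^ (2 ^ p)) (v l)))"
    using v by (intro sum_mono norm2_app_pow_le) (simp add: orthonormalD)
  also have "\<dots> \<le> gram_trace m n Z (2 ^ p)"
    unfolding p2 by (rule sum_ip_gram_pow_le[OF v])
  finally show ?thesis .
qed

lemma card_ge_le_sum_div:
  fixes f :: "'b \<Rightarrow> real"
  assumes "finite L" "\<And>l. l \<in> L \<Longrightarrow> 0 \<le> f l" "0 < c"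
  shows "real (card {l\<in>L. c \<le> f l}) \<le> (\<Sum>l\<in>L. f l) / c"
proof -
  have "real (card {l\<in>L. c \<le> f l}) * c = (\<Sum>l\<in>{l\<in>L. c \<le> f l}. c)" by simp
  also have "\<dots> \<le> (\<Sum>l\<in>{l\<in>L. c \<le> f l}. f l)" by (rule sum_mono) simp
  also have "\<dots> \<le> (\<Sum>l\<in>L. f l)" using assms by (intro sum_mono2) auto
  finally show ?thesis using assms by (simp add: pos_le_divide_eq)
qed

text \<open>Above \<open>q\<close> the ratio \<open>z / q\<close> is at most its \<open>k\<close>-th
  power. This turns a bound on a sum of \<open>k\<close>-th powers into one on the sum
  itself.\<close>

lemma le_add_power_div:
  fixes z q :: real
  assumes "0 \<le> z" "0 < q" "1 \<le> k"
  shows "z \<le> q + q * (z ^ k / q ^ k)"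
proof (cases "z \<le> q")
  case True
  then show ?thesis using assms by (intro order_trans[OF True]) simp
next
  case False
  then have "z / q \<le> (z / q) ^ k"
    using assms power_increasing[of 1 k "z / q"] by simp
  then have "q * (z / q) \<le> q * (z / q) ^ k" using assms by (intro mult_left_mono) auto
  then show ?thesis using assms by (simp add: power_divide)
qed

lemma sum3_sq_le: "(a + b + c)\<^sup>2 \<le> 3 * (a\<^sup>2 + b\<^sup>2 + (c::real)\<^sup>2)"
proof -
  have "0 \<le> (a - b)\<^sup>2 + (b - c)\<^sup>2 + (a - c)\<^sup>2" by simp
  then show ?thesis by (simp add: power2_eq_square algebra_simps)
qed

lemma sum_bounded_orthonormal_coeff:
  assumes "orthonormal m K u" "finite K" "orthonormal m {..<D} y"
  shows "(\<Sum>l\<in>K. \<Sum>b<D. (ip m (u l) (y b))\<^sup>2) \<le> real D"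
proof -
  have "(\<Sum>l\<in>K. \<Sum>b<D. (ip m (u l) (y b))\<^sup>2) = (\<Sum>b<D. \<Sum>l\<in>K. (ip m (y b) (u l))\<^sup>2)"
    by (subst sum.swap) (simp add: ip_commute)
  also have "\<dots> \<le> (\<Sum>b<D. ip m (y b) (y b))" by (rule sum_mono) (rule Bessel[OF assms(1,2)])
  also have "\<dots> = real D" using assms(3) by (simp add: orthonormalD)
  finally show ?thesis .
qed

text \<open>
  Let \<open>Q\<close> be the projection onto the orthogonal complement of the \<open>y b\<close>.  It annihilates the
  low-rank part, so \<open>\<sigma> l * Q (u l) = Q ((E + Z) (v l))\<close>.  A retained singular value
  therefore forces \<open>u l\<close> to lie close to the span of the \<open>y b\<close>, or \<open>E (v l)\<close> to be large, or
  \<open>Z (v l)\<close> to be large; each alternative occurs for few \<open>l\<close> only.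
\<close>

context
  fixes m n r D k :: nat and \<sigma> :: "nat \<Rightarrow> real" and u v y c :: "nat \<Rightarrow> nat \<Rightarrow> real"
    and E Z :: "nat \<Rightarrow> nat \<Rightarrow> real" and t \<delta> q T :: real and L :: "nat set"
  assumes u: "orthonormal m {..<r} u" and v: "orthonormal n {..<r} v"
    and sv_nonneg: "\<And>l. l < r \<Longrightarrow> 0 \<le> \<sigma> l" and y: "orthonormal m {..<D} y"
    and decomp: "\<And>i j. i < m \<Longrightarrow> j < n \<Longrightarrow>
      (\<Sum>l<r. \<sigma> l * u l i * v l j) = (\<Sum>b<D. y b i * c b j) + E i j + Z i j"
    and t: "0 < t" and \<delta>: "0 < \<delta>" "\<delta> < 1 / 2" and q: "q = ((1 - 2 * \<delta>) * t)\<^sup>2" and k: "1 \<le> k"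
    and L: "L = {l. l < r \<and> t \<le> \<sigma> l}"
    and T: "(\<Sum>l\<in>L. ip m (app n Z (v l)) (app n Z (v l)) ^ k) \<le> T"
begin

private abbreviation "Q \<equiv> resid m {..<D} y"
private abbreviation "e2 \<equiv> \<Sum>i<m. \<Sum>j<n. (E i j)\<^sup>2"
private abbreviation "err j i \<equiv> (\<Sum>l\<in>L. \<sigma> l * u l i * v l j) - (\<Sum>b<D. y b i * c b j)"
private abbreviation "proj_noise \<equiv> \<Sum>b<D. ip n (app m (tr Z) (y b)) (app m (tr Z) (y b))"
private definition "g l = (\<lambda>i. app n E (v l) i + app n Z (v l) i)"

lemma L_facts: "finite L" "L \<subseteq> {..<r}" "orthonormal m L u" "orthonormal n L v"
proof -
  show "finite L" and sub: "L \<subseteq> {..<r}" by (auto simp: L)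
  show "orthonormal m L u" "orthonormal n L v"
    by (rule orthonormal_subset[OF u sub], rule orthonormal_subset[OF v sub])
qed

lemma scaled_resid:
  assumes l: "l < r" and i: "i < m"
  shows "\<sigma> l * Q (u l) i = Q (g l) i"
proof -
  have "\<sigma> l * u l i' = (\<Sum>b<D. ip n (c b) (v l) * y b i') + g l i'" if i': "i' < m" for i'
  proof -
    have "\<sigma> l * u l i' = ip n (\<lambda>j. \<Sum>l<r. (\<sigma> l * u l i') * v l j) (v l)"
      using ip_lincomb_orthonormal[OF v, of l] l by simp
    also have "\<dots> = ip n (\<lambda>j. (\<Sum>b<D. y b i' * c b j) + E i' j + Z i' j) (v l)"
      by (rule ip_cong) (simp_all add: decomp[OF i', symmetric])
    also have "\<dots> = (\<Sum>b<D. y b i' * ip n (c b) (v l)) + ip n (E i') (v l) + ip n (Z i') (v l)"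
      by (simp add: ip_add_left ip_sum_left)
    finally show ?thesis by (simp add: g_def app_def ip_def mult.commute)
  qed
  then have "Q (\<lambda>i. \<sigma> l * u l i) i = Q (\<lambda>i. (\<Sum>b<D. ip n (c b) (v l) * y b i) + g l i) i"
    using i by (rule resid_cong)
  then show ?thesis by (simp add: resid_scale resid_add resid_in_span[OF y])
qed

lemma norm2_scaled_resid:
  assumes l: "l < r"
  shows "(\<sigma> l)\<^sup>2 * ip m (Q (u l)) (Q (u l)) = ip m (Q (g l)) (Q (g l))"
proof -
  have "ip m (Q (g l)) (Q (g l)) = ip m (\<lambda>i. \<sigma> l * Q (u l) i) (\<lambda>i. \<sigma> l * Q (u l) i)"
    by (rule ip_cong) (simp_all add: scaled_resid[OF l])
  then show ?thesis by (simp add: ip_linear power2_eq_square)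
qed

text \<open>The three levels are tuned to each other. If all alternatives fail, the image of
  \<open>v l\<close> under \<open>E + Z\<close> is shorter than
  \<open>\<delta> * t + (1 - 2 * \<delta>) * t = (1 - \<delta>) * t\<close>, whereas a residual of
  \<open>u l\<close> of squared norm above \<open>1 - \<delta>\<close>, scaled by
  \<open>\<sigma> l\<close>, forces squared length at least
  \<open>(1 - \<delta>)\<^sup>2 * t\<^sup>2\<close>.\<close>

lemma retained_cases:
  assumes l: "l \<in> L"
  shows "\<delta> \<le> (\<Sum>b<D. (ip m (u l) (y b))\<^sup>2) \<or> (\<delta> * t)\<^sup>2 \<le> ip m (app n E (v l)) (app n E (v l)) \<or>
    q \<le> ip m (app n Z (v l)) (app n Z (v l))"
proof (rule ccontr)
  let ?e = "ip m (app n E (v l)) (app n E (v l))" and ?z = "ip m (app n Z (v l)) (app n Z (v l))"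
  assume "\<not> ?thesis"
  then have 1: "(\<Sum>b<D. (ip m (u l) (y b))\<^sup>2) < \<delta>" and 2: "?e < (\<delta> * t)\<^sup>2" and 3: "?z < q" by auto
  have lr: "l < r" "t \<le> \<sigma> l" using l by (auto simp: L)
  have "sqrt ?e < \<delta> * t" using 2 t \<delta> real_sqrt_less_mono[OF 2] by simp
  moreover have "sqrt ?z < (1 - 2 * \<delta>) * t" using real_sqrt_less_mono[OF 3] t \<delta> by (simp add: q)
  ultimately have "sqrt (ip m (g l) (g l)) < (1 - \<delta>) * t"
    using norm_add_le[of m "app n E (v l)" "app n Z (v l)"] unfolding g_def by (simp add: algebra_simps)
  then have "(sqrt (ip m (g l) (g l)))\<^sup>2 < ((1 - \<delta>) * t)\<^sup>2"
    using t \<delta> by (intro power_strict_mono) auto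
  then have "ip m (g l) (g l) < (1 - \<delta>)\<^sup>2 * t\<^sup>2" by (simp add: power_mult_distrib)
  also have "\<dots> \<le> (1 - \<delta>) * (\<sigma> l)\<^sup>2"
    using \<delta> t lr by (intro mult_mono power_mono) (auto simp: power2_eq_square mult_left_le)
  also have "\<dots> \<le> ip m (Q (u l)) (Q (u l)) * (\<sigma> l)\<^sup>2"
    using norm2_resid[OF y, of "u l"] 1 orthonormalD[OF u, of l l] lr by (intro mult_right_mono) auto
  also have "\<dots> \<le> ip m (g l) (g l)"
    using norm2_scaled_resid[OF lr(1)] norm2_resid_le[OF y, of "g l"] by (simp add: mult.commute)
  finally show False by simp
qed

lemma q_pos: "0 < q"
  using t \<delta> by (simp add: q)

text \<open>Markov's inequality for each of the three alternatives; the corresponding sums over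
  \<open>L\<close> are bounded by \<open>D\<close>, by the energy of \<open>E\<close> and by
  \<open>T\<close>.\<close>

lemma card_retained_le:
  "real (card L) \<le> D / \<delta> + e2 / (\<delta> * t)\<^sup>2 + T / q ^ k"
proof -
  let ?f = "\<lambda>l. \<Sum>b<D. (ip m (u l) (y b))\<^sup>2" and ?e = "\<lambda>l. ip m (app n E (v l)) (app n E (v l))"
    and ?z = "\<lambda>l. ip m (app n Z (v l)) (app n Z (v l)) ^ k"
  have "L \<subseteq> {l\<in>L. \<delta> \<le> ?f l} \<union> {l\<in>L. (\<delta> * t)\<^sup>2 \<le> ?e l} \<union> {l\<in>L. q ^ k \<le> ?z l}"
  proof
    fix l assume l: "l \<in> L"
    have "q ^ k \<le> ?z l" if "q \<le> ip m (app n Z (v l)) (app n Z (v l))"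
      using that q_pos by (intro power_mono) auto
    then show "l \<in> {l\<in>L. \<delta> \<le> ?f l} \<union> {l\<in>L. (\<delta> * t)\<^sup>2 \<le> ?e l} \<union> {l\<in>L. q ^ k \<le> ?z l}"
      using retained_cases[OF l] l by blast
  qed
  then have "card L \<le> card ({l\<in>L. \<delta> \<le> ?f l} \<union> {l\<in>L. (\<delta> * t)\<^sup>2 \<le> ?e l} \<union> {l\<in>L. q ^ k \<le> ?z l})"
    using L_facts(1) by (intro card_mono) auto
  also have "\<dots> \<le> card {l\<in>L. \<delta> \<le> ?f l} + card {l\<in>L. (\<delta> * t)\<^sup>2 \<le> ?e l} + card {l\<in>L. q ^ k \<le> ?z l}"
    by (intro order_trans[OF card_Un_le] add_mono card_Un_le order_refl)
  finally have "real (card L) \<le> real (card {l\<in>L. \<delta> \<le> ?f l}) + real (card {l\<in>L. (\<delta> * t)\<^sup>2 \<le> ?e l})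
      + real (card {l\<in>L. q ^ k \<le> ?z l})" by linarith
  also have "\<dots> \<le> (\<Sum>l\<in>L. ?f l) / \<delta> + (\<Sum>l\<in>L. ?e l) / (\<delta> * t)\<^sup>2 + (\<Sum>l\<in>L. ?z l) / q ^ k"
    using L_facts(1) \<delta> t q_pos by (intro add_mono card_ge_le_sum_div) (auto intro: sum_nonneg)
  also have "\<dots> \<le> D / \<delta> + e2 / (\<delta> * t)\<^sup>2 + T / q ^ k"
    using sum_bounded_orthonormal_coeff[OF L_facts(3,1) y] sum_norm2_app_le[OF L_facts(4,1), of m E] T \<delta> t q_pos
    by (intro add_mono divide_right_mono) auto
  finally show ?thesis .
qed

lemma retained_columns:
  assumes i: "i < m"
  shows "Q (err j) i = (\<Sum>l\<in>L. Q (g l) i * v l j)"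
proof -
  have "(err j)
      = (\<lambda>i. (\<Sum>l\<in>L. (\<sigma> l * v l j) * u l i) + (\<Sum>b<D. (- c b j) * y b i))"
    by (simp add: fun_eq_iff sum_negf mult_ac)
  then have "Q (err j) i
      = (\<Sum>l\<in>L. (\<sigma> l * v l j) * Q (u l) i)"
    using resid_in_span[OF y, of "\<lambda>b. - c b j" i] by (simp add: resid_add resid_lincomb)
  also have "\<dots> = (\<Sum>l\<in>L. Q (g l) i * v l j)"
    using L_facts(2) i by (intro sum.cong) (auto simp: scaled_resid[symmetric] mult_ac)
  finally show ?thesis .
qed

text \<open>After projection the singular values disappear, since
  \<open>\<sigma> l * Q (u l) = Q (g l)\<close>, and orthonormality of the \<open>v l\<close> makes
  the energies add up. The noise then costs \<open>q\<close> per retained index plus the excess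
  controlled by \<open>T\<close>.\<close>

lemma complement_error_le:
  "(\<Sum>j<n. \<Sum>i<m. (Q (err j) i)\<^sup>2)
    \<le> 2 * e2 + 2 * q * (real (card L) + T / q ^ k)"
proof -
  let ?e = "\<lambda>l. ip m (app n E (v l)) (app n E (v l))" and ?z = "\<lambda>l. ip m (app n Z (v l)) (app n Z (v l))"
  have "(\<Sum>j<n. \<Sum>i<m. (Q (err j) i)\<^sup>2)
      = (\<Sum>j<n. \<Sum>i<m. (\<Sum>l\<in>L. Q (g l) i * v l j)\<^sup>2)"
    by (intro sum.cong) (auto simp: retained_columns)
  also have "\<dots> = (\<Sum>i<m. ip n (\<lambda>j. \<Sum>l\<in>L. Q (g l) i * v l j) (\<lambda>j. \<Sum>l\<in>L. Q (g l) i * v l j))"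
    unfolding ip_self by (rule sum.swap)
  also have "\<dots> = (\<Sum>i<m. \<Sum>l\<in>L. (Q (g l) i)\<^sup>2)"
    by (simp only: norm2_lincomb_orthonormal[OF L_facts(4,1)])
  also have "\<dots> = (\<Sum>l\<in>L. ip m (Q (g l)) (Q (g l)))"
    unfolding ip_self by (rule sum.swap)
  also have "\<dots> \<le> (\<Sum>l\<in>L. 2 * ?e l + 2 * ?z l)"
  proof (rule sum_mono)
    fix l
    have "ip m (Q (g l)) (Q (g l)) \<le> ip m (g l) (g l)" by (rule norm2_resid_le[OF y]) simp
    also have "\<dots> \<le> 2 * ?e l + 2 * ?z l" unfolding g_def by (rule norm2_add_le)
    finally show "ip m (Q (g l)) (Q (g l)) \<le> 2 * ?e l + 2 * ?z l" .
  qed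
  also have "\<dots> = 2 * (\<Sum>l\<in>L. ?e l) + 2 * (\<Sum>l\<in>L. ?z l)"
    by (simp add: sum.distrib sum_distrib_left)
  also have "\<dots> \<le> 2 * e2 + 2 * (q * (real (card L) + T / q ^ k))"
  proof (intro add_mono mult_left_mono)
    show "(\<Sum>l\<in>L. ?e l) \<le> e2" by (rule sum_norm2_app_le[OF L_facts(4,1)])
    have "(\<Sum>l\<in>L. ?z l) \<le> (\<Sum>l\<in>L. q + q * (?z l ^ k / q ^ k))"
      using q_pos k by (intro sum_mono le_add_power_div) auto
    also have "\<dots> = q * (real (card L) + (\<Sum>l\<in>L. ?z l ^ k) / q ^ k)"
      by (simp add: sum.distrib sum_distrib_left[symmetric] sum_divide_distrib[symmetric] algebra_simps)
    also have "\<dots> \<le> q * (real (card L) + T / q ^ k)"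
      using T q_pos by (intro mult_left_mono add_left_mono divide_right_mono) auto
    finally show "(\<Sum>l\<in>L. ?z l) \<le> q * (real (card L) + T / q ^ k)" .
  qed auto
  finally show ?thesis by (simp add: mult.assoc)
qed

text \<open>Rejected singular values are below \<open>t\<close>, and Bessel over the rejected
  \<open>u l\<close> bounds the coefficients of the single unit vector \<open>y b\<close>.\<close>

lemma rejected_part_le:
  assumes b: "b < D"
  shows "(\<Sum>j<n. (ip m (\<lambda>i. \<Sum>l\<in>{..<r} - L. \<sigma> l * u l i * v l j) (y b))\<^sup>2) \<le> t\<^sup>2"
proof -
  let ?K = "{..<r} - L"
  have vK: "orthonormal n ?K v" and uK: "orthonormal m ?K u"
    using orthonormal_subset[OF v, of ?K] orthonormal_subset[OF u, of ?K] by auto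
  have "ip m (\<lambda>i. \<Sum>l\<in>?K. \<sigma> l * u l i * v l j) (y b) = (\<Sum>l\<in>?K. (\<sigma> l * ip m (u l) (y b)) * v l j)" for j
    using ip_sum_left[where K = ?K and c = "\<lambda>l. \<sigma> l * v l j" and v = u] by (simp add: mult_ac)
  then have "(\<Sum>j<n. (ip m (\<lambda>i. \<Sum>l\<in>?K. \<sigma> l * u l i * v l j) (y b))\<^sup>2) = (\<Sum>l\<in>?K. (\<sigma> l * ip m (u l) (y b))\<^sup>2)"
    using norm2_lincomb_orthonormal[OF vK] by (simp add: ip_self)
  also have "\<dots> \<le> (\<Sum>l\<in>?K. t\<^sup>2 * (ip m (y b) (u l))\<^sup>2)"
    using sv_nonneg t by (intro sum_mono) (auto simp: L power_mult_distrib ip_commute intro!: mult_right_mono power_mono)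
  also have "\<dots> \<le> t\<^sup>2 * ip m (y b) (y b)"
    unfolding sum_distrib_left[symmetric] by (intro mult_left_mono Bessel[OF uK]) auto
  also have "\<dots> = t\<^sup>2" using orthonormalD[OF y, of b b] b by simp
  finally show ?thesis .
qed

text \<open>The error is rewritten as \<open>E + Z\<close> minus the rejected part. Against only
  \<open>D\<close> fixed directions each of these three pieces is cheap.\<close>

lemma projected_error_le:
  "(\<Sum>j<n. \<Sum>b<D. (ip m (err j) (y b))\<^sup>2)
    \<le> 3 * (D * t\<^sup>2 + e2 +
        proj_noise)"
proof -
  let ?B = "\<lambda>j i. \<Sum>l\<in>{..<r} - L. \<sigma> l * u l i * v l j"
  have C: "ip m (err j) x = - ip m (?B j) x + ip m (tr E j) x + ip m (tr Z j) x" if j: "j < n" for j x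
  proof -
    have "ip m (err j) x = ip m (\<lambda>i. (tr E j i + tr Z j i) - ?B j i) x"
    proof (rule ip_cong)
      fix i assume i: "i < m"
      have "(\<Sum>l<r. \<sigma> l * u l i * v l j) = ?B j i + (\<Sum>l\<in>L. \<sigma> l * u l i * v l j)"
        using L_facts by (intro sum.subset_diff) auto
      then show "err j i = (tr E j i + tr Z j i) - ?B j i" using decomp[OF i j] by (simp add: tr_def)
    qed simp
    then show ?thesis by (simp add: ip_linear)
  qed
  have "(\<Sum>j<n. \<Sum>b<D. (ip m (err j) (y b))\<^sup>2)
      \<le> (\<Sum>j<n. \<Sum>b<D. 3 * ((ip m (?B j) (y b))\<^sup>2 + (ip m (tr E j) (y b))\<^sup>2 + (ip m (tr Z j) (y b))\<^sup>2))"
    by (intro sum_mono, simp only: C lessThan_iff) (use sum3_sq_le[of "- _"] in simp)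
  also have "\<dots> = 3 * ((\<Sum>j<n. \<Sum>b<D. (ip m (?B j) (y b))\<^sup>2) + (\<Sum>j<n. \<Sum>b<D. (ip m (tr E j) (y b))\<^sup>2)
      + (\<Sum>j<n. \<Sum>b<D. (ip m (tr Z j) (y b))\<^sup>2))"
    by (simp only: sum_distrib_left[symmetric] sum.distrib)
  also have "\<dots> \<le> 3 * (D * t\<^sup>2 + e2 +
        proj_noise)"
  proof (intro mult_left_mono add_mono)
    have "(\<Sum>j<n. \<Sum>b<D. (ip m (?B j) (y b))\<^sup>2) = (\<Sum>b<D. \<Sum>j<n. (ip m (?B j) (y b))\<^sup>2)"
      by (rule sum.swap)
    also have "\<dots> \<le> (\<Sum>b<D. t\<^sup>2)" by (rule sum_mono) (rule rejected_part_le, simp)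
    finally show "(\<Sum>j<n. \<Sum>b<D. (ip m (?B j) (y b))\<^sup>2) \<le> D * t\<^sup>2" by simp
    have "(\<Sum>j<n. \<Sum>b<D. (ip m (tr E j) (y b))\<^sup>2) \<le> (\<Sum>j<n. ip m (tr E j) (tr E j))"
      by (rule sum_mono) (rule Bessel[OF y], simp)
    also have "\<dots> = e2"
      unfolding ip_self tr_def by (rule sum.swap)
    finally show "(\<Sum>j<n. \<Sum>b<D. (ip m (tr E j) (y b))\<^sup>2) \<le> e2" .
    have "(\<Sum>j<n. \<Sum>b<D. (ip m (tr Z j) (y b))\<^sup>2) = (\<Sum>b<D. \<Sum>j<n. (ip m (tr Z j) (y b))\<^sup>2)"
      by (rule sum.swap)
    then show "(\<Sum>j<n. \<Sum>b<D. (ip m (tr Z j) (y b))\<^sup>2)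
        \<le> proj_noise"
      by (simp add: ip_self[of n] app_def ip_def[of m])
  qed simp
  finally show ?thesis .
qed

text \<open>Pythagoras in every column, for the span of the \<open>y b\<close> and its complement.
  The count of retained indices and the power sum each contribute one \<open>T / q ^ k\<close>,
  hence the inner factor 2.\<close>

lemma threshold_error_le:
  "(\<Sum>i<m. \<Sum>j<n. ((\<Sum>l\<in>L. \<sigma> l * u l i * v l j) - (\<Sum>b<D. y b i * c b j))\<^sup>2)
    \<le> 3 * (D * t\<^sup>2 + e2 +
          proj_noise)
      + 2 * e2
      + 2 * q * (D / \<delta> + e2 / (\<delta> * t)\<^sup>2 + 2 * (T / q ^ k))"
proof -
  have "(\<Sum>i<m. \<Sum>j<n. (err j i)\<^sup>2) = (\<Sum>j<n. ip m (err j) (err j))"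
    unfolding ip_self by (rule sum.swap)
  also have "\<dots> = (\<Sum>j<n. \<Sum>b<D. (ip m (err j) (y b))\<^sup>2) + (\<Sum>j<n. \<Sum>i<m. (Q (err j) i)\<^sup>2)"
    unfolding sum.distrib[symmetric] ip_self[of m, symmetric]
    by (rule sum.cong) (simp_all add: norm2_resid[OF y])
  also have "\<dots> \<le> 3 * (D * t\<^sup>2 + e2 +
          proj_noise)
      + (2 * e2 + 2 * q * (real (card L) + T / q ^ k))"
    by (intro add_mono projected_error_le complement_error_le)
  also have "2 * q * (real (card L) + T / q ^ k)
      \<le> 2 * q * (D / \<delta> + e2 / (\<delta> * t)\<^sup>2 + 2 * (T / q ^ k))"
    using card_retained_le q_pos by (intro mult_left_mono) auto
  finally show ?thesis by simp
qed

end

section \<open>Measurability of singular value thresholding\<close>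

text \<open>This is \<open>A A\<^sup>T / B\<close>: passing the transpose to \<open>gram\<close>
  makes it act on the row side, where it multiplies \<open>u l\<close> by
  \<open>(\<sigma> l)\<^sup>2 / B\<close>.\<close>

definition scaled_gram :: "real \<Rightarrow> nat \<Rightarrow> nat \<Rightarrow> (nat \<Rightarrow> nat \<Rightarrow> real) \<Rightarrow> (nat \<Rightarrow> real) \<Rightarrow> nat \<Rightarrow> real" where
  "scaled_gram B m n A x = (\<lambda>i. (1 / B) * gram n m (tr A) x i)"

definition damp :: "real \<Rightarrow> nat \<Rightarrow> nat \<Rightarrow> (nat \<Rightarrow> nat \<Rightarrow> real) \<Rightarrow> nat \<Rightarrow> (nat \<Rightarrow> real) \<Rightarrow> nat \<Rightarrow> real" where
  "damp B m n A p x = (\<lambda>i. x i - (scaled_gram B m n A ^^ p) x i)"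

text \<open>
  With \<open>A = \<Sum>l. \<sigma> l * u l * v l\<^sup>T\<close> this is \<open>\<Sum>l. (1 - (1 - (\<sigma> l\<^sup>2 / B) ^ p) ^ N) * \<sigma> l * u l * v l\<^sup>T\<close>,
  a polynomial in the entries of \<open>A\<close> that does not mention the decomposition.
\<close>

definition soft_threshold ::
  "real \<Rightarrow> nat \<Rightarrow> nat \<Rightarrow> (nat \<Rightarrow> nat \<Rightarrow> real) \<Rightarrow> nat \<Rightarrow> nat \<Rightarrow> nat \<Rightarrow> nat \<Rightarrow> real" where
  "soft_threshold B m n A p N i j = A i j - (damp B m n A p ^^ N) (\<lambda>i. A i j) i"

context
  fixes m n r :: nat and A :: "nat \<Rightarrow> nat \<Rightarrow> real" and \<sigma> :: "nat \<Rightarrow> real"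
    and u v :: "nat \<Rightarrow> nat \<Rightarrow> real"
  assumes u: "orthonormal m {..<r} u" and v: "orthonormal n {..<r} v"
    and A: "\<And>i j. i < m \<Longrightarrow> j < n \<Longrightarrow> A i j = (\<Sum>l<r. \<sigma> l * u l i * v l j)"
begin

lemma app_right_singular: "l < r \<Longrightarrow> i < m \<Longrightarrow> app n A (v l) i = \<sigma> l * u l i"
proof -
  assume l: "l < r" and i: "i < m"
  have "app n A (v l) i = ip n (\<lambda>j. \<Sum>l<r. (\<sigma> l * u l i) * v l j) (v l)"
    unfolding app_def ip_def[of n, symmetric] by (rule ip_cong) (simp_all add: A[OF i])
  then show ?thesis using ip_lincomb_orthonormal[OF v, of l] l by simp
qed

lemma app_left_singular: "l < r \<Longrightarrow> j < n \<Longrightarrow> app m (tr A) (u l) j = \<sigma> l * v l j"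
proof -
  assume l: "l < r" and j: "j < n"
  have "app m (tr A) (u l) j = ip m (\<lambda>i. \<Sum>l<r. (\<sigma> l * v l j) * u l i) (u l)"
    unfolding app_def tr_def ip_def[of m, symmetric] by (rule ip_cong) (simp_all add: A[OF _ j] mult_ac)
  then show ?thesis using ip_lincomb_orthonormal[OF u, of l] l by simp
qed

lemma sum_sq_singular_le: "(\<Sum>l<r. (\<sigma> l)\<^sup>2) \<le> (\<Sum>i<m. \<Sum>j<n. (A i j)\<^sup>2)"
proof -
  have "(\<sigma> l)\<^sup>2 = ip m (app n A (v l)) (app n A (v l))" if "l < r" for l
  proof -
    have "ip m (app n A (v l)) (app n A (v l)) = ip m (\<lambda>i. \<sigma> l * u l i) (\<lambda>i. \<sigma> l * u l i)"
      using that by (intro ip_cong) (simp_all add: app_right_singular)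
    then show ?thesis using orthonormalD[OF u, of l l] that by (simp add: ip_linear power2_eq_square)
  qed
  then have "(\<Sum>l<r. (\<sigma> l)\<^sup>2) = (\<Sum>l<r. ip m (app n A (v l)) (app n A (v l)))" by simp
  also have "\<dots> \<le> (\<Sum>i<m. \<Sum>j<n. (A i j)\<^sup>2)" by (rule sum_norm2_app_le[OF v]) simp
  finally show ?thesis .
qed

lemma scaled_gram_lincomb:
  assumes x: "\<And>i. i < m \<Longrightarrow> x i = (\<Sum>l<r. c l * u l i)" and i: "i < m"
  shows "scaled_gram B m n A x i = (\<Sum>l<r. ((\<sigma> l)\<^sup>2 / B * c l) * u l i)"
proof -
  have "app m (tr A) x j = (\<Sum>l<r. (c l * \<sigma> l) * v l j)" if j: "j < n" for j
  proof -
    have "app m (tr A) x j = app m (tr A) (\<lambda>i. \<Sum>l<r. c l * u l i) j"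
      by (rule fun_cong[OF app_cong]) (rule x)
    then show ?thesis using j by (simp add: app_lincomb app_left_singular mult.assoc)
  qed
  then have "app n A (app m (tr A) x) i = app n A (\<lambda>j. \<Sum>l<r. (c l * \<sigma> l) * v l j) i"
    by (intro fun_cong[OF app_cong])
  also have "\<dots> = (\<Sum>l<r. (c l * \<sigma> l) * app n A (v l) i)" by (rule app_lincomb)
  also have "\<dots> = (\<Sum>l<r. (c l * \<sigma> l) * (\<sigma> l * u l i))"
    using i by (simp add: app_right_singular)
  finally show ?thesis
    by (simp add: scaled_gram_def gram_def sum_divide_distrib power2_eq_square mult_ac)
qed

lemma scaled_gram_pow_lincomb:
  assumes x: "\<And>i. i < m \<Longrightarrow> x i = (\<Sum>l<r. c l * u l i)"
  shows "i < m \<Longrightarrow> (scaled_gram B m n A ^^ p) x i = (\<Sum>l<r. (((\<sigma> l)\<^sup>2 / B) ^ p * c l) * u l i)"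
proof (induction p arbitrary: i)
  case (Suc p)
  then show ?case
    using scaled_gram_lincomb[of "(scaled_gram B m n A ^^ p) x" "\<lambda>l. ((\<sigma> l)\<^sup>2 / B) ^ p * c l" i B]
    by (simp add: mult.assoc)
qed (simp add: x)

lemma damp_lincomb:
  assumes x: "\<And>i. i < m \<Longrightarrow> x i = (\<Sum>l<r. c l * u l i)"
  shows "i < m \<Longrightarrow> damp B m n A p x i = (\<Sum>l<r. ((1 - ((\<sigma> l)\<^sup>2 / B) ^ p) * c l) * u l i)"
  unfolding damp_def using scaled_gram_pow_lincomb[OF x, where i = i and B = B and p = p]
  by (simp add: x left_diff_distrib sum_subtractf)

lemma damp_pow_lincomb:
  assumes x: "\<And>i. i < m \<Longrightarrow> x i = (\<Sum>l<r. c l * u l i)"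
  shows "i < m \<Longrightarrow> (damp B m n A p ^^ N) x i = (\<Sum>l<r. ((1 - ((\<sigma> l)\<^sup>2 / B) ^ p) ^ N * c l) * u l i)"
proof (induction N arbitrary: i)
  case (Suc N)
  then show ?case
    using damp_lincomb[of "(damp B m n A p ^^ N) x" "\<lambda>l. (1 - ((\<sigma> l)\<^sup>2 / B) ^ p) ^ N * c l" i B p]
    by (simp add: mult.assoc)
qed (simp add: x)

lemma soft_threshold_eq:
  assumes ij: "i < m" "j < n"
  shows "soft_threshold B m n A p N i j =
    (\<Sum>l<r. (1 - (1 - ((\<sigma> l)\<^sup>2 / B) ^ p) ^ N) * (\<sigma> l * u l i * v l j))"
proof -
  have "(damp B m n A p ^^ N) (\<lambda>i. A i j) i =
      (\<Sum>l<r. ((1 - ((\<sigma> l)\<^sup>2 / B) ^ p) ^ N * (\<sigma> l * v l j)) * u l i)"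
    using ij by (intro damp_pow_lincomb) (simp_all add: A mult_ac)
  then show ?thesis
    unfolding soft_threshold_def A[OF ij]
    by (simp add: sum_subtractf[symmetric]) (rule sum.cong, simp_all add: algebra_simps)
qed

end

text \<open>With this exponent a power of \<open>1 - x ^ p\<close> behaves like
  \<open>exp (- p * (x / s) ^ p)\<close>. The extra factor \<open>p\<close> settles the boundary
  case \<open>x = s\<close>, where the power must tend to 0 because singular values equal to the
  threshold are retained.\<close>

definition cutoff_power :: "real \<Rightarrow> nat \<Rightarrow> nat" where
  "cutoff_power s p = nat \<lceil>real p / s ^ p\<rceil>"

text \<open>The estimate \<open>1 - y \<le> exp (- y)\<close> handles \<open>s \<le> x\<close>,
  Bernoulli's inequality handles \<open>x < s\<close>.\<close>

lemma tendsto_cutoff: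
  fixes x s :: real
  assumes x: "0 \<le> x" "x < 1" and s: "0 < s" "s < 1"
  shows "(\<lambda>p. 1 - (1 - x ^ p) ^ cutoff_power s p) \<longlonglongrightarrow> of_bool (s \<le> x)"
proof (cases "s \<le> x")
  case True
  have b: "(1 - x ^ p) ^ cutoff_power s p \<le> exp (- real p)" for p
  proof -
    have x1: "x ^ p \<le> 1" using x by (simp add: power_le_one)
    have "s ^ p \<le> x ^ p" using True s by (intro power_mono) auto
    then have "real p \<le> real p / s ^ p * x ^ p"
      using s by (simp add: field_simps mult_left_mono)
    also have "\<dots> \<le> real (cutoff_power s p) * x ^ p"
      using x unfolding cutoff_power_def by (intro mult_right_mono real_nat_ceiling_ge) auto
    finally have p: "real p \<le> real (cutoff_power s p) * x ^ p" .
    have "(1 - x ^ p) ^ cutoff_power s p \<le> exp (- (x ^ p)) ^ cutoff_power s p"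
      using x1 exp_ge_add_one_self[of "- (x ^ p)"] by (intro power_mono) auto
    also have "\<dots> = exp (- (real (cutoff_power s p) * x ^ p))" by (simp add: exp_of_nat_mult[symmetric])
    also have "\<dots> \<le> exp (- real p)" using p by simp
    finally show ?thesis .
  qed
  have e: "(\<lambda>p. exp (- real p)) \<longlonglongrightarrow> 0"
    by real_asymp
  have "(\<lambda>p. (1 - x ^ p) ^ cutoff_power s p) \<longlonglongrightarrow> 0"
    by (rule tendsto_sandwich[OF _ _ tendsto_const e])
      (use b x in \<open>auto simp: power_le_one\<close>)
  then have "(\<lambda>p. 1 - (1 - x ^ p) ^ cutoff_power s p) \<longlonglongrightarrow> 1 - 0"
    by (intro tendsto_diff tendsto_const)
  then show ?thesis using True by simp
next
  case False
  have b: "1 - (1 - x ^ p) ^ cutoff_power s p \<le> real p * (x / s) ^ p + x ^ p" for p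
  proof -
    have x1: "x ^ p \<le> 1" using x by (simp add: power_le_one)
    have "1 - real (cutoff_power s p) * x ^ p \<le> (1 - x ^ p) ^ cutoff_power s p"
      using Bernoulli_inequality[of "- (x ^ p)" "cutoff_power s p"] x1 by simp
    moreover have "real (cutoff_power s p) * x ^ p \<le> (real p / s ^ p + 1) * x ^ p"
    proof (rule mult_right_mono)
      have "0 \<le> real p / s ^ p" using s by simp
      then show "real (cutoff_power s p) \<le> real p / s ^ p + 1"
        unfolding cutoff_power_def by linarith
    qed (use x in simp)
    ultimately show ?thesis by (simp add: power_divide algebra_simps)
  qed
  have "(\<lambda>p. real p * (x / s) ^ p) \<longlonglongrightarrow> 0"
    using False x s by (intro powser_times_n_limit_0) auto
  moreover have "(\<lambda>p. x ^ p) \<longlonglongrightarrow> 0"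
    using x by (intro LIMSEQ_realpow_zero) auto
  ultimately have "(\<lambda>p. real p * (x / s) ^ p + x ^ p) \<longlonglongrightarrow> 0 + 0"
    by (rule tendsto_add)
  then have lim: "(\<lambda>p. real p * (x / s) ^ p + x ^ p) \<longlonglongrightarrow> 0" by simp
  have "(\<lambda>p. 1 - (1 - x ^ p) ^ cutoff_power s p) \<longlonglongrightarrow> 0"
    by (rule tendsto_sandwich[OF _ _ tendsto_const lim])
      (use b x in \<open>auto simp: power_le_one\<close>)
  then show ?thesis using False by simp
qed

section \<open>Measurability of the polynomial approximants\<close>

lemma measurable_scaled_gram:
  assumes A: "\<And>i j. i < m \<Longrightarrow> j < n \<Longrightarrow> (\<lambda>\<omega>. A \<omega> i j) \<in> borel_measurable M"
    and x: "\<And>i. i < m \<Longrightarrow> (\<lambda>\<omega>. x \<omega> i) \<in> borel_measurable M" and i: "i < m"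
  shows "(\<lambda>\<omega>. scaled_gram B m n (A \<omega>) (x \<omega>) i) \<in> borel_measurable M"
  unfolding scaled_gram_def gram_def app_def tr_def using A x i
  by (intro borel_measurable_times borel_measurable_const borel_measurable_sum) auto

lemma measurable_scaled_gram_pow:
  assumes A: "\<And>i j. i < m \<Longrightarrow> j < n \<Longrightarrow> (\<lambda>\<omega>. A \<omega> i j) \<in> borel_measurable M"
    and x: "\<And>i. i < m \<Longrightarrow> (\<lambda>\<omega>. x \<omega> i) \<in> borel_measurable M"
  shows "i < m \<Longrightarrow> (\<lambda>\<omega>. (scaled_gram B m n (A \<omega>) ^^ p) (x \<omega>) i) \<in> borel_measurable M"
proof (induction p arbitrary: i)
  case (Suc p)
  then show ?case
    using measurable_scaled_gram[OF A, where x = "\<lambda>\<omega>. (scaled_gram B m n (A \<omega>) ^^ p) (x \<omega>)"] by simp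
qed (simp add: x)

lemma damp_apply: "damp B m n A p x i = x i - (scaled_gram B m n A ^^ p) x i"
  by (simp add: damp_def)

lemma measurable_damp_pow:
  assumes A: "\<And>i j. i < m \<Longrightarrow> j < n \<Longrightarrow> (\<lambda>\<omega>. A \<omega> i j) \<in> borel_measurable M"
    and x: "\<And>i. i < m \<Longrightarrow> (\<lambda>\<omega>. x \<omega> i) \<in> borel_measurable M"
  shows "i < m \<Longrightarrow> (\<lambda>\<omega>. (damp B m n (A \<omega>) p ^^ N) (x \<omega>) i) \<in> borel_measurable M"
proof (induction N arbitrary: i)
  case (Suc N)
  let ?y = "\<lambda>\<omega>. (damp B m n (A \<omega>) p ^^ N) (x \<omega>)"
  have "(\<lambda>\<omega>. ?y \<omega> i - (scaled_gram B m n (A \<omega>) ^^ p) (?y \<omega>) i) \<in> borel_measurable M"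
    using Suc by (intro borel_measurable_diff measurable_scaled_gram_pow[OF A]) auto
  moreover have "(damp B m n (A \<omega>) p ^^ Suc N) (x \<omega>) i = ?y \<omega> i - (scaled_gram B m n (A \<omega>) ^^ p) (?y \<omega>) i" for \<omega>
    unfolding funpow.simps comp_apply by (rule damp_apply)
  ultimately show ?case by (simp only:)
qed (simp add: x)

lemma measurable_sv_threshold:
  fixes Y :: "'a \<Rightarrow> real mat"
  assumes dim: "\<And>\<omega>. \<omega> \<in> space M \<Longrightarrow> Y \<omega> \<in> carrier_mat m n"
    and meas: "\<And>i j. i < m \<Longrightarrow> j < n \<Longrightarrow> (\<lambda>\<omega>. Y \<omega> $$ (i, j)) \<in> borel_measurable M"
    and bounded: "\<And>\<omega> i j. \<omega> \<in> space M \<Longrightarrow> i < m \<Longrightarrow> j < n \<Longrightarrow> \<bar>Y \<omega> $$ (i, j)\<bar> \<le> 1"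
    and t: "0 < t" and ij: "i < m" "j < n"
  shows "(\<lambda>\<omega>. sv_threshold t (Y \<omega>) $$ (i, j)) \<in> borel_measurable M"
proof -
  \<comment> \<open>Larger than \<open>t\<^sup>2\<close> and than the squared Frobenius norm, which
    is at most \<open>m * n\<close>: all \<open>(\<sigma> l)\<^sup>2 / B\<close> and the cutoff
    \<open>t\<^sup>2 / B\<close> lie below 1, with one \<open>B\<close> for every
    \<open>\<omega>\<close>.\<close>
  define B where "B = real m * real n + t\<^sup>2 + 1"
  let ?A = "\<lambda>\<omega> i j. Y \<omega> $$ (i, j)"
  let ?g = "\<lambda>p \<omega>. soft_threshold B m n (?A \<omega>) p (cutoff_power (t\<^sup>2 / B) p) i j"
  have B: "0 < B" "real m * real n < B" "t\<^sup>2 < B"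
    using t by (auto simp: B_def intro: add_nonneg_pos add_pos_nonneg add_nonneg_nonneg)
  show ?thesis
  proof (rule borel_measurable_LIMSEQ_real)
    show "?g p \<in> borel_measurable M" for p
      unfolding soft_threshold_def using ij
      by (intro borel_measurable_diff measurable_damp_pow) (auto intro: meas)
  next
    fix \<omega> assume \<omega>: "\<omega> \<in> space M"
    obtain \<sigma> u v where u: "orthonormal m {..<min m n} u" and v: "orthonormal n {..<min m n} v"
      and \<sigma>: "\<And>l. l < min m n \<Longrightarrow> 0 \<le> \<sigma> l"
      and A: "\<And>i j. i < m \<Longrightarrow> j < n \<Longrightarrow> Y \<omega> $$ (i, j) = (\<Sum>l<min m n. \<sigma> l * u l i * v l j)"
      and S: "\<And>t i j. i < m \<Longrightarrow> j < n \<Longrightarrow>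
        sv_threshold t (Y \<omega>) $$ (i, j) = (\<Sum>l | l < min m n \<and> t \<le> \<sigma> l. \<sigma> l * u l i * v l j)"
      by (rule svd_expansion[OF dim[OF \<omega>]]) (rule that)
    have x1: "(\<sigma> l)\<^sup>2 / B < 1" if l: "l < min m n" for l
    proof -
      have "(\<sigma> l)\<^sup>2 \<le> (\<Sum>l<min m n. (\<sigma> l)\<^sup>2)" using l by (intro member_le_sum) auto
      also have "\<dots> \<le> (\<Sum>i<m. \<Sum>j<n. (?A \<omega> i j)\<^sup>2)" by (rule sum_sq_singular_le[OF u v A])
      also have "\<dots> \<le> (\<Sum>i<m. \<Sum>j<n. 1)"
        using bounded[OF \<omega>] by (intro sum_mono) (auto simp: abs_square_le_1)
      also have "\<dots> < B" using B by simp
      finally show ?thesis using B by simp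
    qed
    have g: "?g p \<omega> = (\<Sum>l<min m n. (1 - (1 - ((\<sigma> l)\<^sup>2 / B) ^ p) ^ cutoff_power (t\<^sup>2 / B) p) * (\<sigma> l * u l i * v l j))" for p
      by (rule soft_threshold_eq[OF u v A ij])
    have "(\<lambda>p. ?g p \<omega>) \<longlonglongrightarrow> (\<Sum>l<min m n. of_bool (t\<^sup>2 / B \<le> (\<sigma> l)\<^sup>2 / B) * (\<sigma> l * u l i * v l j))"
      unfolding g using x1 B t by (intro tendsto_sum tendsto_mult tendsto_const tendsto_cutoff) auto
    also have "(\<Sum>l<min m n. of_bool (t\<^sup>2 / B \<le> (\<sigma> l)\<^sup>2 / B) * (\<sigma> l * u l i * v l j))
        = (\<Sum>l<min m n. if t \<le> \<sigma> l then \<sigma> l * u l i * v l j else 0)"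
    proof (rule sum.cong)
      fix l assume "l \<in> {..<min m n}"
      then have "t\<^sup>2 / B \<le> (\<sigma> l)\<^sup>2 / B \<longleftrightarrow> t \<le> \<sigma> l"
        using \<sigma>[of l] t B(1) by (simp add: divide_le_cancel)
      then show "of_bool (t\<^sup>2 / B \<le> (\<sigma> l)\<^sup>2 / B) * (\<sigma> l * u l i * v l j)
          = (if t \<le> \<sigma> l then \<sigma> l * u l i * v l j else 0)" by simp
    qed simp
    also have "\<dots> = sv_threshold t (Y \<omega>) $$ (i, j)"
    proof -
      have "{l. l < min m n \<and> t \<le> \<sigma> l} = {l \<in> {..<min m n}. t \<le> \<sigma> l}" by auto
      then show ?thesis unfolding S[OF ij] by (simp only: sum.inter_filter finite_lessThan)
    qed
    finally show "(\<lambda>p. ?g p \<omega>) \<longlonglongrightarrow> sv_threshold t (Y \<omega>) $$ (i, j)" .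
  qed
qed

section \<open>Expected error of the USVT estimator\<close>

lemma integral_double_sum:
  fixes f :: "'i \<Rightarrow> 'j \<Rightarrow> 'b \<Rightarrow> real"
  assumes "\<And>i j. i \<in> I \<Longrightarrow> j \<in> J \<Longrightarrow> integrable M (f i j)"
  shows "integral\<^sup>L M (\<lambda>\<omega>. \<Sum>i\<in>I. \<Sum>j\<in>J. f i j \<omega>) = (\<Sum>i\<in>I. \<Sum>j\<in>J. integral\<^sup>L M (f i j))"
proof -
  have "integral\<^sup>L M (\<lambda>\<omega>. \<Sum>i\<in>I. \<Sum>j\<in>J. f i j \<omega>) = (\<Sum>i\<in>I. integral\<^sup>L M (\<lambda>\<omega>. \<Sum>j\<in>J. f i j \<omega>))"
    by (rule Bochner_Integration.integral_sum) (rule Bochner_Integration.integrable_sum, rule assms)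
  also have "\<dots> = (\<Sum>i\<in>I. \<Sum>j\<in>J. integral\<^sup>L M (f i j))"
    by (rule sum.cong, rule refl, rule Bochner_Integration.integral_sum) (rule assms)
  finally show ?thesis .
qed

context noise
begin

abbreviation projected_noise :: "nat \<Rightarrow> (nat \<Rightarrow> nat \<Rightarrow> real) \<Rightarrow> 'a \<Rightarrow> real" where
  "projected_noise D y \<equiv>
    \<lambda>\<omega>. \<Sum>b<D. ip n (app m (tr (\<lambda>i j. Z i j \<omega>)) (y b)) (app m (tr (\<lambda>i j. Z i j \<omega>)) (y b))"

lemma expectation_Z_product:
  assumes "i < m" "i' < m" "j < n" "i \<noteq> i'"
  shows "expectation (\<lambda>\<omega>. Z i j \<omega> * Z i' j \<omega>) = 0"
proof -
  have sub: "{(i, j), (i', j)} \<subseteq> {..<m} \<times> {..<n}" using assms by auto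
  have "expectation (\<lambda>\<omega>. \<Prod>e\<in>{(i, j), (i', j)}. Z (fst e) (snd e) \<omega>)
      = (\<Prod>e\<in>{(i, j), (i', j)}. expectation (Z (fst e) (snd e)))"
    using assms integrable_Z_power[of _ j 1]
    by (intro indep_vars_lebesgue_integral indep_vars_subset[OF indep sub]) auto
  then show ?thesis using assms by (simp add: centered)
qed

lemma integrable_Z_product:
  assumes "i < m" "i' < m" "j < n"
  shows "integrable M (\<lambda>\<omega>. Z i j \<omega> * Z i' j \<omega>)"
proof (rule integrable_const_bound[where B = "2 * 2"])
  show "AE \<omega> in M. norm (Z i j \<omega> * Z i' j \<omega>) \<le> 2 * 2"
    unfolding real_norm_def abs_mult using assms by (intro AE_I2 mult_mono bounded) auto
qed (use measurable_Z assms in simp)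

text \<open>Distinct entries of a column are uncorrelated, so only the diagonal of the double sum
  survives.\<close>

lemma expectation_row_le:
  assumes j: "j < n"
  shows "integrable M (\<lambda>\<omega>. (\<Sum>i<m. Z i j \<omega> * x i)\<^sup>2)"
    and "expectation (\<lambda>\<omega>. (\<Sum>i<m. Z i j \<omega> * x i)\<^sup>2) \<le> ip m x x"
proof -
  have sq: "(\<lambda>\<omega>. (\<Sum>i<m. Z i j \<omega> * x i)\<^sup>2) = (\<lambda>\<omega>. \<Sum>i<m. \<Sum>i'<m. (x i * x i') * (Z i j \<omega> * Z i' j \<omega>))"
    by (simp add: power2_eq_square sum_product mult_ac)
  have int: "integrable M (\<lambda>\<omega>. (x i * x i') * (Z i j \<omega> * Z i' j \<omega>))" if "i < m" "i' < m" for i i'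
    using that j by (intro integrable_mult_right integrable_Z_product)
  then show "integrable M (\<lambda>\<omega>. (\<Sum>i<m. Z i j \<omega> * x i)\<^sup>2)"
    unfolding sq by (intro Bochner_Integration.integrable_sum) auto
  have "expectation (\<lambda>\<omega>. (\<Sum>i<m. Z i j \<omega> * x i)\<^sup>2)
      = (\<Sum>i<m. \<Sum>i'<m. (x i * x i') * expectation (\<lambda>\<omega>. Z i j \<omega> * Z i' j \<omega>))"
  proof -
    have "expectation (\<lambda>\<omega>. \<Sum>i<m. \<Sum>i'<m. (x i * x i') * (Z i j \<omega> * Z i' j \<omega>))
        = (\<Sum>i<m. \<Sum>i'<m. expectation (\<lambda>\<omega>. (x i * x i') * (Z i j \<omega> * Z i' j \<omega>)))"
      by (rule integral_double_sum) (rule int; simp)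
    then show ?thesis unfolding sq by simp
  qed
  also have "\<dots> = (\<Sum>i<m. \<Sum>i'<m. if i' = i then (x i)\<^sup>2 * expectation (\<lambda>\<omega>. (Z i j \<omega>)\<^sup>2) else 0)"
    using j expectation_Z_product by (intro sum.cong) (auto simp: power2_eq_square)
  also have "\<dots> = (\<Sum>i<m. (x i)\<^sup>2 * expectation (\<lambda>\<omega>. (Z i j \<omega>)\<^sup>2))" by simp
  also have "\<dots> \<le> (\<Sum>i<m. (x i)\<^sup>2 * 1)"
    using variance_le j by (intro sum_mono mult_left_mono) auto
  finally show "expectation (\<lambda>\<omega>. (\<Sum>i<m. Z i j \<omega> * x i)\<^sup>2) \<le> ip m x x" by (simp add: ip_self)
qed

text \<open>The directions \<open>y b\<close> are deterministic, so each of the \<open>n\<close>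
  columns contributes at most 1 per direction.\<close>

lemma expectation_projected_noise_le:
  assumes y: "orthonormal m {..<D} y"
  shows "integrable M (projected_noise D y)"
    and "expectation (projected_noise D y) \<le> D * n"
proof -
  have eq: "ip n (app m (tr (\<lambda>i j. Z i j \<omega>)) x) (app m (tr (\<lambda>i j. Z i j \<omega>)) x) = (\<Sum>j<n. (\<Sum>i<m. Z i j \<omega> * x i)\<^sup>2)" for \<omega> x
    by (simp add: ip_self app_def tr_def)
  show "integrable M (projected_noise D y)"
    unfolding eq by (intro Bochner_Integration.integrable_sum expectation_row_le) auto
  have "expectation (\<lambda>\<omega>. \<Sum>b<D. \<Sum>j<n. (\<Sum>i<m. Z i j \<omega> * y b i)\<^sup>2)
      = (\<Sum>b<D. \<Sum>j<n. expectation (\<lambda>\<omega>. (\<Sum>i<m. Z i j \<omega> * y b i)\<^sup>2))"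
    by (rule integral_double_sum) (auto intro: expectation_row_le)
  also have "\<dots> \<le> (\<Sum>b<D. \<Sum>j<n. ip m (y b) (y b))"
    by (intro sum_mono expectation_row_le) auto
  also have "\<dots> = D * n" using orthonormalD[OF y] by simp
  finally show "expectation (projected_noise D y) \<le> D * n"
    unfolding eq .
qed

end

lemma (in prob_space) abs_expectation_le_1:
  fixes X :: "'a \<Rightarrow> real"
  assumes "integrable M X" "\<And>\<omega>. \<omega> \<in> space M \<Longrightarrow> \<bar>X \<omega>\<bar> \<le> 1"
  shows "\<bar>expectation X\<bar> \<le> 1"
proof -
  have "expectation X \<le> 1" "- 1 \<le> expectation X"
    using assms by (auto intro!: integral_le_const integral_ge_const AE_I2 simp: abs_le_iff minus_le_iff)
  then show ?thesis by (simp add: abs_le_iff)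
qed

text \<open>Common to both inputs of the estimator, the data with hidden entries set to 0 and the
  reveal mask.\<close>

locale random_matrix = prob_space +
  fixes m n :: nat and Y :: "'a \<Rightarrow> real mat" and S :: "nat \<Rightarrow> nat \<Rightarrow> real"
  assumes pos: "0 < m" "0 < n"
    and dim: "\<omega> \<in> space M \<Longrightarrow> Y \<omega> \<in> carrier_mat m n"
    and indep_entries: "indep_vars (\<lambda>_. borel) (\<lambda>e \<omega>. Y \<omega> $$ e) ({..<m} \<times> {..<n})"
    and bounded_entries: "\<omega> \<in> space M \<Longrightarrow> i < m \<Longrightarrow> j < n \<Longrightarrow> \<bar>Y \<omega> $$ (i, j)\<bar> \<le> 1"
    and mean: "i < m \<Longrightarrow> j < n \<Longrightarrow> expectation (\<lambda>\<omega>. Y \<omega> $$ (i, j)) = S i j"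
begin

lemma measurable_entry: "i < m \<Longrightarrow> j < n \<Longrightarrow> (\<lambda>\<omega>. Y \<omega> $$ (i, j)) \<in> borel_measurable M"
  using indep_entries by (auto simp: indep_vars_def)

lemma integrable_entry:
  assumes "i < m" "j < n"
  shows "integrable M (\<lambda>\<omega>. Y \<omega> $$ (i, j))" "integrable M (\<lambda>\<omega>. (Y \<omega> $$ (i, j))\<^sup>2)"
  using measurable_entry[OF assms] bounded_entries[OF _ assms]
  by (auto intro!: integrable_const_bound[where B = 1] AE_I2 simp: abs_square_le_1)

lemma mean_le_1: "i < m \<Longrightarrow> j < n \<Longrightarrow> \<bar>S i j\<bar> \<le> 1"
  using abs_expectation_le_1[OF integrable_entry(1) bounded_entries] mean by metis

sublocale noise M m n "\<lambda>i j \<omega>. Y \<omega> $$ (i, j) - S i j"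
proof
  have "indep_vars (\<lambda>_. borel) (\<lambda>e \<omega>. (\<lambda>x. x - S (fst e) (snd e)) (Y \<omega> $$ e)) ({..<m} \<times> {..<n})"
    by (rule indep_vars_compose2[OF indep_entries]) simp
  then show "indep_vars (\<lambda>_. borel) (\<lambda>e \<omega>. Y \<omega> $$ (fst e, snd e) - S (fst e) (snd e)) ({..<m} \<times> {..<n})"
    by simp
next
  fix i j assume ij: "i < m" "j < n"
  show "\<bar>Y \<omega> $$ (i, j) - S i j\<bar> \<le> 2" if "\<omega> \<in> space M" for \<omega>
    using bounded_entries[OF that ij] mean_le_1[OF ij] by linarith
  show "expectation (\<lambda>\<omega>. Y \<omega> $$ (i, j) - S i j) = 0"
    using integrable_entry(1)[OF ij] mean[OF ij] by (simp add: prob_space)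
  have "expectation (\<lambda>\<omega>. (Y \<omega> $$ (i, j) - S i j)\<^sup>2)
      = expectation (\<lambda>\<omega>. (Y \<omega> $$ (i, j))\<^sup>2 - 2 * S i j * Y \<omega> $$ (i, j) + (S i j)\<^sup>2)"
    by (simp add: power2_diff algebra_simps)
  also have "\<dots> = expectation (\<lambda>\<omega>. (Y \<omega> $$ (i, j))\<^sup>2) - (S i j)\<^sup>2"
    using integrable_entry[OF ij] mean[OF ij] by (simp add: prob_space power2_eq_square)
  also have "\<dots> \<le> 1 - 0"
    using bounded_entries[OF _ ij] integrable_entry(2)[OF ij]
    by (intro diff_mono integral_le_const AE_I2) (auto simp: abs_square_le_1)
  finally show "expectation (\<lambda>\<omega>. (Y \<omega> $$ (i, j) - S i j)\<^sup>2) \<le> 1" by simp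
qed

end

lemma truncate_entry_bounded: "\<bar>truncate_entry x\<bar> \<le> 1"
  by (auto simp: truncate_entry_def)

lemma truncate_entry_contract: "\<bar>z\<bar> \<le> 1 \<Longrightarrow> \<bar>truncate_entry x - z\<bar> \<le> \<bar>x - z\<bar>"
  by (auto simp: truncate_entry_def)

lemma measurable_truncate_entry [measurable]: "truncate_entry \<in> borel_measurable borel"
  unfolding truncate_entry_def by measurable

lemma dim_sv_threshold [simp]:
  "dim_row (sv_threshold t Y) = dim_row Y" "dim_col (sv_threshold t Y) = dim_col Y"
  by (auto simp: sv_threshold_def split: prod.split)

lemma usvt_entry:
  assumes "Y \<in> carrier_mat m n" "i < m" "j < n"
  shows "usvt \<eta> Y $$ (i, j) =
    truncate_entry (sv_threshold ((2 + \<eta>) * max (sqrt (real m)) (sqrt (real n))) Y $$ (i, j))"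
  using assms by (simp add: usvt_def)

lemma max_sqrt: "max (sqrt (real m)) (sqrt (real n)) = sqrt (real (max m n))"
  by (auto simp: max_def)

text \<open>\<open>16 * \<rho> * (4 / \<rho>) ^ k\<close> is where the exact constant 2 in the threshold enters:
  the trace moment grows like \<open>4 ^ k\<close>, and \<open>\<rho> > 4\<close>.\<close>

definition error_bound :: "real \<Rightarrow> real \<Rightarrow> nat \<Rightarrow> nat \<Rightarrow> nat \<Rightarrow> nat \<Rightarrow> real" where
  "error_bound \<eta> \<epsilon> D k m n =
    (let \<rho> = (2 + \<eta> / 2)\<^sup>2; N = max m n in
      (12 + 64 * \<rho> / \<eta>\<^sup>2) * (\<epsilon>\<^sup>2 * (real m * real n)) +
      (60 + 16 * \<rho> * (2 + \<eta>) / \<eta>) * (real D * real N) +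
      16 * \<rho> * (4 / \<rho>) ^ k * (real m * real n) +
      8 * \<rho> * real (2 ^ (4 * k + 1) * (2 * k + 1) ^ (2 * k + 1)) / \<rho> ^ k * ((real m * real n) / real N))"

context random_matrix
begin

lemma measurable_usvt:
  assumes \<eta>: "0 < \<eta>" and ij: "i < m" "j < n"
  shows "(\<lambda>\<omega>. usvt \<eta> (Y \<omega>) $$ (i, j)) \<in> borel_measurable M"
proof -
  let ?t = "(2 + \<eta>) * max (sqrt (real m)) (sqrt (real n))"
  have "0 < ?t" using \<eta> pos by (intro mult_pos_pos) (auto simp: less_max_iff_disj)
  then have "(\<lambda>\<omega>. sv_threshold ?t (Y \<omega>) $$ (i, j)) \<in> borel_measurable M"
    using ij by (intro measurable_sv_threshold[OF dim measurable_entry bounded_entries]) auto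
  then have "(\<lambda>\<omega>. truncate_entry (sv_threshold ?t (Y \<omega>) $$ (i, j))) \<in> borel_measurable M"
    by (rule measurable_compose) (rule measurable_truncate_entry)
  then show ?thesis
    by (rule measurable_cong[THEN iffD1, rotated]) (simp add: usvt_entry[OF dim ij])
qed

lemma usvt_bounded:
  assumes "\<omega> \<in> space M" "i < m" "j < n"
  shows "\<bar>usvt \<eta> (Y \<omega>) $$ (i, j)\<bar> \<le> 1"
  using usvt_entry[OF dim[OF assms(1)] assms(2,3)] truncate_entry_bounded by simp

lemma integrable_usvt_error:
  assumes \<eta>: "0 < \<eta>"
  shows "integrable M (\<lambda>\<omega>. \<Sum>i<m. \<Sum>j<n. (usvt \<eta> (Y \<omega>) $$ (i, j) - S i j)\<^sup>2)"
proof (intro Bochner_Integration.integrable_sum)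
  fix i j assume "i \<in> {..<m}" "j \<in> {..<n}"
  then have ij: "i < m" "j < n" by auto
  have "(usvt \<eta> (Y \<omega>) $$ (i, j) - S i j)\<^sup>2 \<le> 2\<^sup>2" if "\<omega> \<in> space M" for \<omega>
    using usvt_bounded[OF that ij, of \<eta>] mean_le_1[OF ij]
    by (intro power2_le_iff_abs_le[THEN iffD2]) auto
  then show "integrable M (\<lambda>\<omega>. (usvt \<eta> (Y \<omega>) $$ (i, j) - S i j)\<^sup>2)"
    using measurable_usvt[OF \<eta> ij]
    by (intro integrable_const_bound[where B = "2\<^sup>2"] AE_I2) auto
qed

lemma usvt_pointwise_le:
  fixes y c :: "nat \<Rightarrow> nat \<Rightarrow> real"
  assumes \<eta>: "0 < \<eta>" and y: "orthonormal m {..<D} y"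
    and close: "\<And>i j. i < m \<Longrightarrow> j < n \<Longrightarrow> \<bar>S i j - (\<Sum>b<D. y b i * c b j)\<bar> \<le> \<epsilon>"
    and p: "1 \<le> p" and \<omega>: "\<omega> \<in> space M"
  defines "k \<equiv> 2 ^ p" and "N \<equiv> real (max m n)" and "\<rho> \<equiv> (2 + \<eta> / 2)\<^sup>2"
    and "Z \<equiv> \<lambda>i j. Y \<omega> $$ (i, j) - S i j"
  shows "(\<Sum>i<m. \<Sum>j<n. (usvt \<eta> (Y \<omega>) $$ (i, j) - S i j)\<^sup>2) \<le>
    (12 + 64 * \<rho> / \<eta>\<^sup>2) * (\<epsilon>\<^sup>2 * (real m * real n)) +
    (6 * (2 + \<eta>)\<^sup>2 + 16 * \<rho> * (2 + \<eta>) / \<eta>) * (D * N) +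
    6 * (\<Sum>b<D. ip n (app m (tr Z) (y b)) (app m (tr Z) (y b))) +
    8 * \<rho> * N * (gram_trace m n Z k / (\<rho> * N) ^ k)"
proof -
  define t where "t = (2 + \<eta>) * sqrt N"
  \<comment> \<open>The solution of
    \<open>(1 - 2 * \<delta>) * (2 + \<eta>) = 2 + \<eta> / 2\<close>: half of the slack
    \<open>\<eta>\<close> is spent, and the noise level \<open>q\<close> becomes
    \<open>\<rho> * N\<close>.\<close>
  define \<delta> where "\<delta> = \<eta> / (4 * (2 + \<eta>))"
  define e where "e = (\<Sum>i<m. \<Sum>j<n. (S i j - (\<Sum>b<D. y b i * c b j))\<^sup>2)"
  define G where "G = (\<Sum>b<D. ip n (app m (tr Z) (y b)) (app m (tr Z) (y b)))"
  define T where "T = gram_trace m n Z k"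
  let ?S' = "\<lambda>i j. \<Sum>b<D. y b i * c b j"
  have N: "0 < N" using pos by (simp add: N_def)
  have t0: "0 < t" using \<eta> N by (simp add: t_def)
  have \<delta>0: "0 < \<delta>" "\<delta> < 1 / 2" using \<eta> by (auto simp: \<delta>_def field_simps)
  have q: "\<rho> * N = ((1 - 2 * \<delta>) * t)\<^sup>2"
  proof -
    have "(1 - 2 * \<delta>) * (2 + \<eta>) = 2 + \<eta> / 2" using \<eta> by (simp add: \<delta>_def field_simps)
    then have "(1 - 2 * \<delta>) * t = (2 + \<eta> / 2) * sqrt N" by (simp add: t_def mult.assoc[symmetric])
    then show ?thesis using N by (simp add: \<rho>_def power_mult_distrib)
  qed
  have dt: "(\<delta> * t)\<^sup>2 = \<eta>\<^sup>2 * N / 16"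
  proof -
    have "\<delta> * t = \<eta> / 4 * sqrt N" using \<eta> by (simp add: \<delta>_def t_def field_simps)
    then have "(\<delta> * t)\<^sup>2 = (\<eta> / 4 * sqrt N)\<^sup>2" by (simp only:)
    then show ?thesis using N by (simp only: power_mult_distrib power_divide real_sqrt_pow2 less_imp_le) simp
  qed
  have \<rho>0: "0 < \<rho>" using \<eta> by (simp add: \<rho>_def)
  obtain \<sigma> u v where u: "orthonormal m {..<min m n} u" and v: "orthonormal n {..<min m n} v"
    and \<sigma>: "\<And>l. l < min m n \<Longrightarrow> 0 \<le> \<sigma> l"
    and A: "\<And>i j. i < m \<Longrightarrow> j < n \<Longrightarrow> Y \<omega> $$ (i, j) = (\<Sum>l<min m n. \<sigma> l * u l i * v l j)"
    and sv: "\<And>t i j. i < m \<Longrightarrow> j < n \<Longrightarrow>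
      sv_threshold t (Y \<omega>) $$ (i, j) = (\<Sum>l | l < min m n \<and> t \<le> \<sigma> l. \<sigma> l * u l i * v l j)"
    by (rule svd_expansion[OF dim[OF \<omega>]]) (rule that)
  define L where "L = {l. l < min m n \<and> t \<le> \<sigma> l}"
  let ?A = "\<lambda>i j. \<Sum>l\<in>L. \<sigma> l * u l i * v l j"
  have vL: "orthonormal n L v" by (rule orthonormal_subset[OF v]) (auto simp: L_def)
  have TL: "(\<Sum>l\<in>L. ip m (app n Z (v l)) (app n Z (v l)) ^ k) \<le> T"
    unfolding T_def k_def by (rule sum_norm2_app_pow_le_trace[OF vL _ p]) (simp add: L_def)
  have decomp: "(\<Sum>l<min m n. \<sigma> l * u l i * v l j) = ?S' i j + (S i j - ?S' i j) + Z i j"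
    if "i < m" "j < n" for i j
    using A[OF that] by (simp add: Z_def)
  have main: "(\<Sum>i<m. \<Sum>j<n. (?A i j - ?S' i j)\<^sup>2) \<le> 3 * (D * t\<^sup>2 + e + G) + 2 * e +
      2 * (\<rho> * N) * (D / \<delta> + e / (\<delta> * t)\<^sup>2 + 2 * (T / (\<rho> * N) ^ k))"
    unfolding e_def G_def
    by (rule threshold_error_le[OF u v \<sigma> y decomp t0 \<delta>0 q _ L_def TL]) (simp_all add: k_def)
  have e_le: "e \<le> \<epsilon>\<^sup>2 * (real m * real n)"
  proof -
    have "e \<le> (\<Sum>i<m. \<Sum>j<n. \<epsilon>\<^sup>2)"
      unfolding e_def
      by (intro sum_mono abs_le_square_iff[THEN iffD1] order_trans[OF close abs_ge_self]) auto
    then show ?thesis by (simp add: mult_ac)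
  qed
  have "(\<Sum>i<m. \<Sum>j<n. (usvt \<eta> (Y \<omega>) $$ (i, j) - S i j)\<^sup>2)
      \<le> (\<Sum>i<m. \<Sum>j<n. 2 * (?A i j - ?S' i j)\<^sup>2 + 2 * (S i j - ?S' i j)\<^sup>2)"
  proof (intro sum_mono)
    fix i j assume "i \<in> {..<m}" "j \<in> {..<n}"
    then have ij: "i < m" "j < n" by auto
    have "usvt \<eta> (Y \<omega>) $$ (i, j) = truncate_entry (?A i j)"
      by (simp add: usvt_entry[OF dim[OF \<omega>] ij] sv[OF ij] max_sqrt L_def t_def N_def)
    \<comment> \<open>The mean lies in \<open>{-1..1}\<close>, so truncation can only bring the
      estimate closer to it.\<close>
    then have "(usvt \<eta> (Y \<omega>) $$ (i, j) - S i j)\<^sup>2 \<le> (?A i j - S i j)\<^sup>2"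
      using truncate_entry_contract[OF mean_le_1[OF ij], of "?A i j"] by (simp add: abs_le_square_iff)
    also have "\<dots> \<le> 2 * (?A i j - ?S' i j)\<^sup>2 + 2 * (S i j - ?S' i j)\<^sup>2"
      using zero_le_power2[of "(?A i j - ?S' i j) + (S i j - ?S' i j)"]
      unfolding power2_eq_square by (simp only: algebra_simps)
    finally show "(usvt \<eta> (Y \<omega>) $$ (i, j) - S i j)\<^sup>2 \<le> 2 * (?A i j - ?S' i j)\<^sup>2 + 2 * (S i j - ?S' i j)\<^sup>2" .
  qed
  also have "\<dots> = 2 * (\<Sum>i<m. \<Sum>j<n. (?A i j - ?S' i j)\<^sup>2) + 2 * e"
    by (simp only: sum.distrib sum_distrib_left[symmetric] e_def)
  also have "\<dots> \<le> 2 * (3 * (D * t\<^sup>2 + e + G) + 2 * e +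
      2 * (\<rho> * N) * (D / \<delta> + e / (\<delta> * t)\<^sup>2 + 2 * (T / (\<rho> * N) ^ k))) + 2 * e"
    using main by simp
  also have "\<dots> = (12 + 64 * \<rho> / \<eta>\<^sup>2) * e + (6 * (2 + \<eta>)\<^sup>2 + 16 * \<rho> * (2 + \<eta>) / \<eta>) * (D * N) + 6 * G
      + 8 * \<rho> * N * (T / (\<rho> * N) ^ k)"
  proof -
    have t2: "t\<^sup>2 = (2 + \<eta>)\<^sup>2 * N" using N by (simp add: t_def power_mult_distrib)
    have 1: "D / \<delta> = D * (4 * (2 + \<eta>) / \<eta>)" by (simp add: \<delta>_def)
    have 2: "\<rho> * N * (e / (\<delta> * t)\<^sup>2) = 16 * \<rho> / \<eta>\<^sup>2 * e" using N \<eta> by (simp add: dt)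
    have "2 * (\<rho> * N) * (D / \<delta> + e / (\<delta> * t)\<^sup>2 + 2 * (T / (\<rho> * N) ^ k)) =
        2 * (\<rho> * N) * (D * (4 * (2 + \<eta>) / \<eta>)) + 2 * (16 * \<rho> / \<eta>\<^sup>2 * e) + 4 * \<rho> * N * (T / (\<rho> * N) ^ k)"
      unfolding 1 2[symmetric] by (simp add: algebra_simps)
    then show ?thesis by (simp only: t2) (simp add: algebra_simps)
  qed
  also have "\<dots> \<le> (12 + 64 * \<rho> / \<eta>\<^sup>2) * (\<epsilon>\<^sup>2 * (real m * real n)) +
      (6 * (2 + \<eta>)\<^sup>2 + 16 * \<rho> * (2 + \<eta>) / \<eta>) * (D * N) + 6 * G + 8 * \<rho> * N * (T / (\<rho> * N) ^ k)"
    using mult_left_mono[OF e_le, of "12 + 64 * \<rho> / \<eta>\<^sup>2"] \<rho>0 by simp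
  finally show ?thesis unfolding G_def T_def .
qed

lemma usvt_expected_error_le:
  fixes y c :: "nat \<Rightarrow> nat \<Rightarrow> real"
  assumes \<eta>: "0 < \<eta>" "\<eta> < 1" and y: "orthonormal m {..<D} y"
    and close: "\<And>i j. i < m \<Longrightarrow> j < n \<Longrightarrow> \<bar>S i j - (\<Sum>b<D. y b i * c b j)\<bar> \<le> \<epsilon>"
    and p: "1 \<le> p"
  shows "expectation (\<lambda>\<omega>. \<Sum>i<m. \<Sum>j<n. (usvt \<eta> (Y \<omega>) $$ (i, j) - S i j)\<^sup>2) \<le> error_bound \<eta> \<epsilon> D (2 ^ p) m n"
proof -
  define k :: nat where "k = 2 ^ p"
  define N where "N = max m n"
  define \<rho> where "\<rho> = (2 + \<eta> / 2)\<^sup>2"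
  define C where "C = real (2 ^ (4 * k + 1) * (2 * k + 1) ^ (2 * k + 1))"
  let ?Z = "\<lambda>\<omega> i j. Y \<omega> $$ (i, j) - S i j"
  let ?G = "\<lambda>\<omega>. \<Sum>b<D. ip n (app m (tr (?Z \<omega>)) (y b)) (app m (tr (?Z \<omega>)) (y b))"
  let ?a = "(12 + 64 * \<rho> / \<eta>\<^sup>2) * (\<epsilon>\<^sup>2 * (real m * real n))"
  let ?b = "(6 * (2 + \<eta>)\<^sup>2 + 16 * \<rho> * (2 + \<eta>) / \<eta>) * (real D * real N)"
  have N: "0 < N" "m \<le> N" "n \<le> N" using pos by (auto simp: N_def)
  have \<rho>: "1 \<le> \<rho>" using \<eta> power_mono[of 1 "2 + \<eta> / 2" 2] by (simp add: \<rho>_def)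
  have k: "2 \<le> k" using p power_increasing[of 1 p "2::nat"] by (simp add: k_def)
  have "expectation (\<lambda>\<omega>. \<Sum>i<m. \<Sum>j<n. (usvt \<eta> (Y \<omega>) $$ (i, j) - S i j)\<^sup>2)
      \<le> expectation (\<lambda>\<omega>. ?a + ?b + 6 * ?G \<omega> + 8 * \<rho> * N * (gram_trace m n (?Z \<omega>) k / (\<rho> * N) ^ k))"
  proof (rule integral_mono)
    show "integrable M (\<lambda>\<omega>. \<Sum>i<m. \<Sum>j<n. (usvt \<eta> (Y \<omega>) $$ (i, j) - S i j)\<^sup>2)"
      by (rule integrable_usvt_error[OF \<eta>(1)])
    show "integrable M (\<lambda>\<omega>. ?a + ?b + 6 * ?G \<omega> + 8 * \<rho> * N * (gram_trace m n (?Z \<omega>) k / (\<rho> * N) ^ k))"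
      using expectation_projected_noise_le(1)[OF y] integrable_gram_trace
      by (intro Bochner_Integration.integrable_add integrable_const integrable_mult_right integrable_divide)
    show "(\<Sum>i<m. \<Sum>j<n. (usvt \<eta> (Y \<omega>) $$ (i, j) - S i j)\<^sup>2) \<le>
        ?a + ?b + 6 * ?G \<omega> + 8 * \<rho> * N * (gram_trace m n (?Z \<omega>) k / (\<rho> * N) ^ k)" if "\<omega> \<in> space M" for \<omega>
      using usvt_pointwise_le[OF \<eta>(1) y close p that] unfolding k_def N_def \<rho>_def by simp
  qed
  also have "\<dots> = ?a + ?b + 6 * expectation ?G
      + 8 * \<rho> * N * (expectation (\<lambda>\<omega>. gram_trace m n (?Z \<omega>) k) / (\<rho> * N) ^ k)"
    using expectation_projected_noise_le(1)[OF y] integrable_gram_trace by (simp add: prob_space)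
  also have "\<dots> \<le> ?a + (54 + 16 * \<rho> * (2 + \<eta>) / \<eta>) * (real D * real N) + 6 * (real D * real N)
      + (16 * \<rho> * (4 / \<rho>) ^ k * (real m * real n) + 8 * \<rho> * C / \<rho> ^ k * ((real m * real n) / real N))"
  proof (intro add_mono order_refl)
    \<comment> \<open>Here \<open>\<eta> < 1\<close> gives
      \<open>6 * (2 + \<eta>)\<^sup>2 \<le> 54\<close>; the projected noise adds 6, which explains
      the 60 in \<open>error_bound\<close>.\<close>
    have "(2 + \<eta>)\<^sup>2 \<le> 3\<^sup>2" using \<eta> by (intro power_mono) auto
    then show "?b \<le> (54 + 16 * \<rho> * (2 + \<eta>) / \<eta>) * (real D * real N)"
      by (intro mult_right_mono) auto
    have "expectation ?G \<le> real D * real n" using expectation_projected_noise_le(2)[OF y] by simp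
    also have "\<dots> \<le> real D * real N" using N by (intro mult_left_mono) auto
    finally show "6 * expectation ?G \<le> 6 * (real D * real N)" by simp
    have "expectation (\<lambda>\<omega>. gram_trace m n (?Z \<omega>) k) \<le>
        2 ^ (2 * k + 1) * (real m * real n * real N ^ (k - 1)) + C * (real m * real n * real N ^ (k - 2))"
      unfolding C_def using expectation_gram_trace_le[OF k N(2,3)] N by simp
    then have "8 * \<rho> * N * (expectation (\<lambda>\<omega>. gram_trace m n (?Z \<omega>) k) / (\<rho> * N) ^ k) \<le>
        8 * \<rho> * N * ((2 ^ (2 * k + 1) * (real m * real n * real N ^ (k - 1)) + C * (real m * real n * real N ^ (k - 2))) / (\<rho> * N) ^ k)"
      using \<rho> N by (intro mult_left_mono divide_right_mono) auto
    \<comment> \<open>The prefactor \<open>N\<close> supplies the power missing in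
      \<open>N ^ (k - 1)\<close>, so the tree term keeps only the constant
      \<open>2 * 4 ^ k / \<rho> ^ k\<close>, while the thin term stays short by one power.\<close>
    also have "\<dots> = 16 * \<rho> * (4 / \<rho>) ^ k * (real m * real n) + 8 * \<rho> * C / \<rho> ^ k * ((real m * real n) / real N)"
    proof -
      obtain k' where k': "k = Suc (Suc k')" using k by (metis add_2_eq_Suc le_Suc_ex)
      have "2 ^ (2 * k + 1) = 2 * (4::real) ^ k" by (simp add: power_mult)
      moreover have "real N * real N ^ (k - 1) = real N ^ k" "real N ^ (k - 2) * real N * real N = real N ^ k"
        by (simp_all add: k' mult_ac)
      ultimately show ?thesis
        using N \<rho> by (simp add: k' power_mult_distrib power_divide field_simps)
    qed
    finally show "8 * \<rho> * N * (expectation (\<lambda>\<omega>. gram_trace m n (?Z \<omega>) k) / (\<rho> * N) ^ k) \<le>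
        16 * \<rho> * (4 / \<rho>) ^ k * (real m * real n) + 8 * \<rho> * C / \<rho> ^ k * ((real m * real n) / real N)" .
  qed
  also have "\<dots> = error_bound \<eta> \<epsilon> D (2 ^ p) m n"
    unfolding error_bound_def Let_def k_def[symmetric] N_def[symmetric] \<rho>_def[symmetric] C_def[symmetric]
    by (simp add: algebra_simps)
  finally show ?thesis .
qed

end

section \<open>Consistency of the USVT estimator\<close>

lemma error_bound_mono:
  assumes "0 < \<eta>" "D \<le> D'"
  shows "error_bound \<eta> \<epsilon> D k m n \<le> error_bound \<eta> \<epsilon> D' k m n"
  unfolding error_bound_def Let_def using assms
  by (intro add_mono order_refl mult_left_mono mult_right_mono) auto

text \<open>The order of choices matters: \<open>\<epsilon>\<close> settles the first term and
  \<open>p\<close> the third, both before \<open>D\<close> is known; the second and the fourth are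
  then beaten by large dimensions. Each term receives \<open>\<kappa> / 4\<close>.\<close>

lemma error_bound_small:
  assumes \<eta>: "0 < \<eta>" and \<kappa>: "0 < \<kappa>"
  shows "\<exists>\<epsilon>>0. \<exists>p\<ge>1. \<forall>D. \<exists>N0. \<forall>m\<ge>N0. \<forall>n\<ge>N0. 0 < m \<longrightarrow> 0 < n \<longrightarrow>
    error_bound \<eta> \<epsilon> D (2 ^ p) m n \<le> \<kappa> * (real m * real n)"
proof -
  define \<rho> where "\<rho> = (2 + \<eta> / 2)\<^sup>2"
  have \<rho>: "4 < \<rho>" using \<eta> power_strict_mono[of 2 "2 + \<eta> / 2" 2] by (simp add: \<rho>_def)
  define K1 where "K1 = 12 + 64 * \<rho> / \<eta>\<^sup>2"
  define K2 where "K2 = 60 + 16 * \<rho> * (2 + \<eta>) / \<eta>"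
  have K: "0 < K1" "0 < K2" using \<rho> \<eta> by (auto simp: K1_def K2_def intro!: add_pos_nonneg)
  define \<epsilon> where "\<epsilon> = sqrt (\<kappa> / 4 / K1)"
  have \<epsilon>: "0 < \<epsilon>" "K1 * \<epsilon>\<^sup>2 = \<kappa> / 4" using \<kappa> K by (auto simp: \<epsilon>_def)
  have "(\<lambda>p. (4 / \<rho>) ^ p) \<longlonglongrightarrow> 0" using \<rho> by (intro LIMSEQ_realpow_zero) auto
  then have "\<forall>\<^sub>F p in sequentially. (4 / \<rho>) ^ p < \<kappa> / (64 * \<rho>)"
    using \<kappa> \<rho> by (intro order_tendstoD) auto
  then obtain p0 where p0: "\<And>p. p \<ge> p0 \<Longrightarrow> (4 / \<rho>) ^ p < \<kappa> / (64 * \<rho>)"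
    by (auto simp: eventually_sequentially)
  define p where "p = max p0 1"
  have p: "1 \<le> p" "16 * \<rho> * (4 / \<rho>) ^ (2 ^ p) \<le> \<kappa> / 4"
  proof -
    have "p0 \<le> p" by (simp add: p_def)
    then have "p0 \<le> 2 ^ p" using less_exp[of p] by linarith
    then show "16 * \<rho> * (4 / \<rho>) ^ (2 ^ p) \<le> \<kappa> / 4"
      using p0[of "2 ^ p"] \<rho> by (simp add: field_simps)
  qed (simp add: p_def)
  define K4 where "K4 = 8 * \<rho> * real (2 ^ (4 * 2 ^ p + 1) * (2 * 2 ^ p + 1) ^ (2 * 2 ^ p + 1)) / \<rho> ^ (2 ^ p)"
  have K4: "0 \<le> K4" using \<rho> by (simp add: K4_def)
  have "\<exists>N0. \<forall>m\<ge>N0. \<forall>n\<ge>N0. 0 < m \<longrightarrow> 0 < n \<longrightarrow> error_bound \<eta> \<epsilon> D (2 ^ p) m n \<le> \<kappa> * (real m * real n)" for D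
  proof -
    define N0 where "N0 = nat \<lceil>max (4 * K2 * D / \<kappa>) (4 * K4 / \<kappa>)\<rceil>"
    have N0: "4 * K2 * D / \<kappa> \<le> real N0" "4 * K4 / \<kappa> \<le> real N0"
      unfolding N0_def by linarith+
    have "error_bound \<eta> \<epsilon> D (2 ^ p) m n \<le> \<kappa> * (real m * real n)"
      if mn: "N0 \<le> m" "N0 \<le> n" "0 < m" "0 < n" for m n
    proof -
      define N where "N = max m n"
      \<comment> \<open>Since \<open>m * n = N' * N\<close>, a term linear in \<open>N\<close> is
        negligible only if the smaller dimension is large; this is where both dimensions have to
        grow.\<close>
      define N' where "N' = min m n"
      have NN: "real m * real n = real N' * real N" by (simp add: N_def N'_def max_def min_def)
      have N: "0 < N" "0 < N'" "N0 \<le> N" "N0 \<le> N'" using mn by (auto simp: N_def N'_def)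
      have "error_bound \<eta> \<epsilon> D (2 ^ p) m n = K1 * \<epsilon>\<^sup>2 * (real m * real n) + K2 * D * real N +
          16 * \<rho> * (4 / \<rho>) ^ (2 ^ p) * (real m * real n) + K4 * ((real m * real n) / real N)"
        unfolding error_bound_def Let_def K1_def K2_def K4_def \<rho>_def N_def by simp
      also have "\<dots> \<le> \<kappa> / 4 * (real m * real n) + \<kappa> / 4 * (real m * real n) +
          \<kappa> / 4 * (real m * real n) + \<kappa> / 4 * (real m * real n)"
      proof (intro add_mono)
        show "K1 * \<epsilon>\<^sup>2 * (real m * real n) \<le> \<kappa> / 4 * (real m * real n)" by (simp add: \<epsilon>)
        have "4 * K2 * D / \<kappa> \<le> real N'" using N0(1) N by linarith
        then have "K2 * D \<le> \<kappa> / 4 * real N'" using \<kappa> by (simp add: field_simps)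
        then have "K2 * D * real N \<le> (\<kappa> / 4 * real N') * real N" by (rule mult_right_mono) simp
        then show "K2 * D * real N \<le> \<kappa> / 4 * (real m * real n)" unfolding NN by (simp add: mult.assoc)
        show "16 * \<rho> * (4 / \<rho>) ^ (2 ^ p) * (real m * real n) \<le> \<kappa> / 4 * (real m * real n)"
          using p(2) by (rule mult_right_mono) simp
        have "4 * K4 / \<kappa> \<le> real N" using N0(2) N by linarith
        then have "K4 \<le> \<kappa> / 4 * real N" using \<kappa> by (simp add: field_simps)
        then have "K4 * ((real m * real n) / real N) \<le> (\<kappa> / 4 * real N) * ((real m * real n) / real N)"
          by (rule mult_right_mono) simp
        then show "K4 * ((real m * real n) / real N) \<le> \<kappa> / 4 * (real m * real n)" using N by simp
      qed
      finally show ?thesis by simp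
    qed
    then show ?thesis by blast
  qed
  then show ?thesis using \<epsilon>(1) p(1) by blast
qed

section \<open>Low-rank functions and entrywise polynomials\<close>

definition low_rank :: "nat \<Rightarrow> nat \<Rightarrow> nat \<Rightarrow> (nat \<Rightarrow> nat \<Rightarrow> real) \<Rightarrow> bool" where
  "low_rank r m n F \<longleftrightarrow> (\<exists>a b. \<forall>i<m. \<forall>j<n. F i j = (\<Sum>d<r. a d i * b d j))"

lemma low_rank_add:
  assumes "low_rank r m n F" "low_rank s m n G"
  shows "low_rank (r + s) m n (\<lambda>i j. F i j + G i j)"
proof -
  obtain a b a' b' where F: "\<forall>i<m. \<forall>j<n. F i j = (\<Sum>d<r. a d i * b d j)"
    and G: "\<forall>i<m. \<forall>j<n. G i j = (\<Sum>d<s. a' d i * b' d j)"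
    using assms by (auto simp: low_rank_def)
  have "(\<Sum>d<r. a d i * b d j) + (\<Sum>d<s. a' d i * b' d j)
      = (\<Sum>d<r + s. (if d < r then a d i else a' (d - r) i) * (if d < r then b d j else b' (d - r) j))" for i j
  proof (induction s)
    case (Suc s)
    then show ?case by (simp add: add.assoc[symmetric])
  qed simp
  then show ?thesis unfolding low_rank_def using F G
    by (intro exI[of _ "\<lambda>d i. if d < r then a d i else a' (d - r) i"]
        exI[of _ "\<lambda>d j. if d < r then b d j else b' (d - r) j"]) simp
qed

lemma low_rank_zero: "low_rank r m n (\<lambda>i j. 0)"
  unfolding low_rank_def by (intro exI[of _ "\<lambda>_ _. 0"]) simp

lemma low_rank_mono:
  assumes "low_rank r m n F" "r \<le> s"
  shows "low_rank s m n F"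
  using low_rank_add[OF assms(1) low_rank_zero[of "s - r"]] assms(2) by simp

lemma low_rank_rank1_mult:
  assumes "low_rank r m n F"
  shows "low_rank r m n (\<lambda>i j. F i j * (x i * z j))"
proof -
  obtain a b where F: "\<forall>i<m. \<forall>j<n. F i j = (\<Sum>d<r. a d i * b d j)"
    using assms by (auto simp: low_rank_def)
  then show ?thesis unfolding low_rank_def
    by (intro exI[of _ "\<lambda>d i. a d i * x i"] exI[of _ "\<lambda>d j. b d j * z j"])
      (simp add: sum_distrib_left sum_distrib_right mult_ac)
qed

lemma low_rank_cong:
  "low_rank r m n F \<Longrightarrow> (\<And>i j. i < m \<Longrightarrow> j < n \<Longrightarrow> F i j = G i j) \<Longrightarrow> low_rank r m n G"
proof -
  assume "low_rank r m n F" and eq: "\<And>i j. i < m \<Longrightarrow> j < n \<Longrightarrow> F i j = G i j"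
  then obtain a b where "\<forall>i<m. \<forall>j<n. F i j = (\<Sum>d<r. a d i * b d j)"
    by (auto simp: low_rank_def)
  then have "\<forall>i<m. \<forall>j<n. G i j = (\<Sum>d<r. a d i * b d j)" by (simp add: eq)
  then show ?thesis unfolding low_rank_def by blast
qed

text \<open>The second factor is split into rank-one terms, and each of these merely rescales rows
  and columns of the first.\<close>

lemma low_rank_mult:
  assumes F: "low_rank r m n F" and G: "low_rank s m n G"
  shows "low_rank (s * r) m n (\<lambda>i j. F i j * G i j)"
proof -
  obtain a b where G: "\<forall>i<m. \<forall>j<n. G i j = (\<Sum>d<s. a d i * b d j)"
    using assms by (auto simp: low_rank_def)
  have "low_rank (s * r) m n (\<lambda>i j. F i j * (\<Sum>d<s. a d i * b d j))"
  proof (induction s)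
    case (Suc s)
    from low_rank_add[OF low_rank_rank1_mult[OF F, of "a s" "b s"] this]
    show ?case by (simp add: algebra_simps)
  qed (simp add: low_rank_zero)
  then show ?thesis by (rule low_rank_cong) (simp add: G)
qed

lemma low_rank_const: "low_rank 1 m n (\<lambda>i j. c)"
  unfolding low_rank_def by (intro exI[of _ "\<lambda>_ _. c"] exI[of _ "\<lambda>_ _. 1"]) simp

lemma low_rank_power: "low_rank r m n F \<Longrightarrow> low_rank (r ^ e) m n (\<lambda>i j. F i j ^ e)"
proof (induction e)
  case 0
  show ?case using low_rank_const[of m n 1] by simp
next
  case (Suc e)
  from low_rank_mult[OF Suc.IH[OF Suc.prems] Suc.prems] show ?case by (simp add: mult.commute)
qed

text \<open>The rank bound depends on \<open>r\<close> and the degree only, not on the dimensions;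
  the exponent 0 accounts for a constant matrix of rank one.\<close>

lemma low_rank_polynomial:
  assumes "low_rank r m n F"
  shows "low_rank (\<Sum>e<d. r ^ e) m n (\<lambda>i j. \<Sum>e<d. c e * F i j ^ e)"
proof (induction d)
  case (Suc d)
  have "low_rank (r ^ d) m n (\<lambda>i j. F i j ^ d * (c d * 1))"
    by (rule low_rank_rank1_mult[OF low_rank_power[OF assms], where x = "\<lambda>_. c d" and z = "\<lambda>_. 1"])
  from low_rank_add[OF Suc this] show ?case by (simp add: mult.commute)
qed (simp add: low_rank_zero)

text \<open>Gram-Schmidt on the left factors, with the coefficients moved into the right factors. A
  left factor already in the span adds no direction, hence \<open>D' \<le> D\<close> and not
  equality.\<close>

lemma low_rank_orthonormal:
  assumes "low_rank D m n F"
  shows "\<exists>D' y c. D' \<le> D \<and> orthonormal m {..<D'} y \<and> (\<forall>i<m. \<forall>j<n. F i j = (\<Sum>b<D'. y b i * c b j))"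
  using assms
proof (induction D arbitrary: F)
  case 0
  then show ?case by (intro exI[of _ 0]) (auto simp: low_rank_def orthonormal_def)
next
  case (Suc D)
  then obtain a b where F: "\<forall>i<m. \<forall>j<n. F i j = (\<Sum>d<Suc D. a d i * b d j)"
    by (auto simp: low_rank_def)
  have "low_rank D m n (\<lambda>i j. \<Sum>d<D. a d i * b d j)" by (auto simp: low_rank_def)
  from Suc.IH[OF this] obtain D' y c where D': "D' \<le> D" and y: "orthonormal m {..<D'} y"
    and c: "\<forall>i<m. \<forall>j<n. (\<Sum>d<D. a d i * b d j) = (\<Sum>b<D'. y b i * c b j)" by blast
  define x where "x = resid m {..<D'} y (a D)"
  define g where "g l = ip m (a D) (y l)" for l
  have a: "a D i = (\<Sum>l<D'. g l * y l i) + x i" for i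
    by (simp add: x_def g_def resid_def proj_def)
  have Fx: "F i j = (\<Sum>l<D'. y l i * (c l j + g l * b D j)) + x i * b D j" if "i < m" "j < n" for i j
    using F c that a[of i] by (simp add: algebra_simps sum.distrib sum_distrib_left)
  show ?case
  proof (cases "ip m x x = 0")
    case True
    then have "x i = 0" if "i < m" for i using that by (simp add: ip_self_eq_0_iff)
    then show ?thesis
      using D' y Fx by (intro exI[of _ D'] exI[of _ y] exI[of _ "\<lambda>l j. c l j + g l * b D j"]) auto
  next
    case False
    define s where "s = sqrt (ip m x x)"
    have s: "s \<noteq> 0" "s * s = ip m x x" using False by (auto simp: s_def)
    define y' where "y' = y(D' := \<lambda>i. (1 / s) * x i)"
    have xy: "ip m x (y l) = 0" "ip m (y l) x = 0" if "l < D'" for l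
      using resid_orthogonal[OF y, of l] that by (simp_all add: x_def ip_commute)
    have "ip m (y' D') (y' D') = (1 / s) * ((1 / s) * ip m x x)"
      by (simp only: y'_def fun_upd_same ip_scale_left ip_scale_right)
    then have "ip m (y' D') (y' D') = 1" using s(1) by (simp add: s(2)[symmetric])
    moreover have "ip m (y' D') (y' l) = 0" "ip m (y' l) (y' D') = 0" if "l < D'" for l
      using xy[OF that] that unfolding y'_def by (simp_all add: ip_scale_left ip_scale_right del: times_divide_eq_left)
    moreover have "ip m (y' l) (y' l') = of_bool (l = l')" if "l < D'" "l' < D'" for l l'
      using orthonormalD[OF y, of l l'] that by (simp add: y'_def)
    ultimately have "orthonormal m {..<Suc D'} y'"
      by (auto simp: orthonormal_def less_Suc_eq)
    moreover have "F i j = (\<Sum>l<Suc D'. y' l i * (if l < D' then c l j + g l * b D j else s * b D j))"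
      if "i < m" "j < n" for i j
      using Fx[OF that] s(1) by (simp add: y'_def)
    ultimately show ?thesis using D'
      by (intro exI[of _ "Suc D'"] exI[of _ y'] exI[of _ "\<lambda>l j. if l < D' then c l j + g l * b D j else s * b D j"]) auto
  qed
qed

text \<open>Weierstrass approximation picks the polynomial from \<open>h\<close> and
  \<open>\<epsilon>\<close> before any matrix is seen; this makes \<open>D\<close> uniform over all
  dimensions and all \<open>F\<close> of rank at most \<open>r\<close>.\<close>

lemma continuous_image_low_rank_approx:
  fixes h :: "real \<Rightarrow> real"
  assumes h: "continuous_on {-1..1} h" and \<epsilon>: "0 < \<epsilon>"
  shows "\<exists>D. \<forall>m n F. low_rank r m n F \<longrightarrow> (\<forall>i<m. \<forall>j<n. F i j \<in> {-1..1}) \<longrightarrow>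
    (\<exists>D' y c. D' \<le> D \<and> orthonormal m {..<D'} y \<and>
      (\<forall>i<m. \<forall>j<n. \<bar>h (F i j) - (\<Sum>b<D'. y b i * c b j)\<bar> \<le> \<epsilon>))"
proof -
  obtain g where g: "real_polynomial_function g" "\<And>x. x \<in> {-1..1} \<Longrightarrow> \<bar>h x - g x\<bar> < \<epsilon>"
    using Stone_Weierstrass_real_polynomial_function[OF compact_Icc h \<epsilon>] by blast
  obtain a d where "g = (\<lambda>x. \<Sum>i\<le>d. a i * x ^ i)"
    using g(1) unfolding real_polynomial_function_iff_sum by blast
  then have ga: "g = (\<lambda>x. \<Sum>e<Suc d. a e * x ^ e)" by (simp only: lessThan_Suc_atMost)
  show ?thesis
  proof (rule exI[of _ "\<Sum>e<Suc d. r ^ e"], intro allI impI)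
    fix m n F assume F: "low_rank r m n F" and b: "\<forall>i<m. \<forall>j<n. F i j \<in> {-1..1}"
    have "low_rank (\<Sum>e<Suc d. r ^ e) m n (\<lambda>i j. g (F i j))"
      unfolding ga by (rule low_rank_polynomial[OF F])
    from low_rank_orthonormal[OF this] obtain D' y c where "D' \<le> (\<Sum>e<Suc d. r ^ e)"
      "orthonormal m {..<D'} y" and gy: "\<forall>i<m. \<forall>j<n. g (F i j) = (\<Sum>b<D'. y b i * c b j)" by blast
    moreover have "\<bar>h (F i j) - (\<Sum>b<D'. y b i * c b j)\<bar> \<le> \<epsilon>" if "i < m" "j < n" for i j
    proof -
      have "\<bar>h (F i j) - g (F i j)\<bar> \<le> \<epsilon>" using g(2)[of "F i j"] b that by (intro less_imp_le) auto
      then show ?thesis using gy that by simp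
    qed
    ultimately show "\<exists>D' y c. D' \<le> (\<Sum>e<Suc d. r ^ e) \<and> orthonormal m {..<D'} y \<and>
      (\<forall>i<m. \<forall>j<n. \<bar>h (F i j) - (\<Sum>b<D'. y b i * c b j)\<bar> \<le> \<epsilon>)" by blast
  qed
qed

section \<open>From matrix rank to a factorization\<close>

lemma (in vec_space) cols_in_span_of_rank_many:
  assumes A: "A \<in> carrier_mat n nc"
  obtains U where "finite U" "U \<subseteq> carrier_vec n" "card U = rank A" "set (cols A) \<subseteq> span U"
proof -
  have C: "set (cols A) \<subseteq> carrier_vec n" using A cols_dim by blast
  let ?P = "\<lambda>T. T \<subseteq> set (cols A) \<and> lin_indpt T"
  have "lin_indpt {}" by (simp add: lin_dep_def)
  then obtain U where U: "finite U" "maximal U ?P"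
    using maximal_exists_superset[of "set (cols A)" ?P "{}"] by auto
  then have U': "U \<subseteq> set (cols A)" "lin_indpt U" by (auto simp: maximal_def)
  \<comment> \<open>A column outside the span could be added to \<open>U\<close>, against
    maximality.\<close>
  have "c \<in> span U" if c: "c \<in> set (cols A)" for c
  proof (rule ccontr)
    assume n: "c \<notin> span U"
    have cU: "c \<notin> U" using n U' C in_own_span[of U] by blast
    have "lin_indpt (U \<union> {c})"
      using lin_dep_iff_in_span[of U c] U' C c n cU by blast
    then have "?P (U \<union> {c})" using U' c by simp
    then have "U \<union> {c} = U" using U(2) unfolding maximal_def by blast
    then show False using cU by blast
  qed
  then show thesis using that[of U] U U' C rank_card_indpt[OF A U(2)] by auto
qed

lemma low_rank_of_rank:
  fixes A :: "real mat"
  assumes A: "A \<in> carrier_mat m n" and r: "vec_space.rank m A \<le> r"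
  shows "low_rank r m n (\<lambda>i j. A $$ (i, j))"
proof -
  interpret vec_space "TYPE(real)" m .
  obtain U where U: "finite U" "U \<subseteq> carrier_vec m" "card U = rank A" "set (cols A) \<subseteq> span U"
    by (rule cols_in_span_of_rank_many[OF A])
  obtain f where f: "bij_betw f {..<card U} U"
    using ex_bij_betw_nat_finite[OF U(1)] by (auto simp: atLeast0LessThan)
  have "\<exists>c. \<forall>i<m. A $$ (i, j) = (\<Sum>x\<in>U. vec_index x i * c x)" if j: "j < n" for j
  proof -
    have "col A j \<in> set (cols A)" using j A by (simp add: cols_def)
    then have "col A j \<in> span U" by (rule subsetD[OF U(4)])
    from in_spanE[OF this] obtain a B where B: "col A j = lincomb a B" "finite B" "B \<subseteq> U"
      by (elim exE conjE) (rule that)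
    have "A $$ (i, j) = (\<Sum>x\<in>U. vec_index x i * (if x \<in> B then a x else 0))" if i: "i < m" for i
    proof -
      have "A $$ (i, j) = vec_index (col A j) i" using A i j by simp
      also have "\<dots> = (\<Sum>x\<in>B. a x * vec_index x i)"
        unfolding B(1) using i B U by (intro lincomb_index) auto
      also have "\<dots> = (\<Sum>x\<in>U. vec_index x i * (if x \<in> B then a x else 0))"
        using U(1) B by (intro sum.mono_neutral_cong_left) auto
      finally show ?thesis .
    qed
    then show ?thesis by (intro exI[of _ "\<lambda>x. if x \<in> B then a x else 0"]) simp
  qed
  then obtain c where c: "\<And>i j. i < m \<Longrightarrow> j < n \<Longrightarrow> A $$ (i, j) = (\<Sum>x\<in>U. vec_index x i * c j x)"
    by metis
  have "A $$ (i, j) = (\<Sum>d<rank A. vec_index (f d) i * c j (f d))" if "i < m" "j < n" for i j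
    unfolding c[OF that] U(3)[symmetric] by (rule sum.reindex_bij_betw[OF f, symmetric])
  then have "low_rank (rank A) m n (\<lambda>i j. A $$ (i, j))"
    unfolding low_rank_def by (intro exI[of _ "\<lambda>d. vec_index (f d)"] exI[of _ "\<lambda>d j. c j (f d)"]) auto
  then show ?thesis using r by (rule low_rank_mono)
qed

text \<open>Stated for a general \<open>h\<close> because it is applied to \<open>x * g x\<close>
  for the data and to \<open>g\<close> for the mask. The rank bound \<open>r\<close> makes one
  \<open>D\<close> serve all \<open>k\<close>.\<close>

lemma usvt_consistent:
  fixes h :: "real \<Rightarrow> real" and m n :: "nat \<Rightarrow> nat" and M :: "nat \<Rightarrow> real mat"
    and \<Omega> :: "nat \<Rightarrow> 'a measure" and Y :: "nat \<Rightarrow> 'a \<Rightarrow> real mat"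
  assumes \<eta>: "0 < \<eta>" "\<eta> < 1"
    and rm: "\<And>k. random_matrix (\<Omega> k) (m k) (n k) (Y k) (\<lambda>i j. h (M k $$ (i, j)))"
    and lr: "\<And>k. low_rank r (m k) (n k) (\<lambda>i j. M k $$ (i, j))"
    and M_bd: "\<And>k i j. i < m k \<Longrightarrow> j < n k \<Longrightarrow> M k $$ (i, j) \<in> {-1..1}"
    and dims: "filterlim m at_top sequentially" "filterlim n at_top sequentially"
    and h: "continuous_on {-1..1} h"
  shows "(\<lambda>k. prob_space.expectation (\<Omega> k) (\<lambda>\<omega>. \<Sum>i<m k. \<Sum>j<n k.
    (usvt \<eta> (Y k \<omega>) $$ (i, j) - h (M k $$ (i, j)))\<^sup>2) / (real (m k) * real (n k))) \<longlonglongrightarrow> 0"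
proof (rule LIMSEQ_I)
  fix \<kappa> :: real assume \<kappa>: "0 < \<kappa>"
  let ?E = "\<lambda>k. prob_space.expectation (\<Omega> k) (\<lambda>\<omega>. \<Sum>i<m k. \<Sum>j<n k.
    (usvt \<eta> (Y k \<omega>) $$ (i, j) - h (M k $$ (i, j)))\<^sup>2)"
  obtain \<epsilon> p where \<epsilon>: "0 < \<epsilon>" and p: "1 \<le> p"
    and small: "\<forall>D. \<exists>N0. \<forall>m\<ge>N0. \<forall>n\<ge>N0. 0 < m \<longrightarrow> 0 < n \<longrightarrow>
      error_bound \<eta> \<epsilon> D (2 ^ p) m n \<le> \<kappa> / 2 * (real m * real n)"
    using error_bound_small[OF \<eta>(1), of "\<kappa> / 2"] \<kappa> by (metis half_gt_zero)
  obtain D where D: "\<And>m n F. low_rank r m n F \<Longrightarrow> (\<forall>i<m. \<forall>j<n. F i j \<in> {-1..1}) \<Longrightarrow>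
    (\<exists>D' y c. D' \<le> D \<and> orthonormal m {..<D'} y \<and>
      (\<forall>i<m. \<forall>j<n. \<bar>h (F i j) - (\<Sum>b<D'. y b i * c b j)\<bar> \<le> \<epsilon>))"
    using continuous_image_low_rank_approx[OF h \<epsilon>, of r] by blast
  obtain N0 where N0: "\<And>m n. N0 \<le> m \<Longrightarrow> N0 \<le> n \<Longrightarrow> 0 < m \<Longrightarrow> 0 < n \<Longrightarrow>
      error_bound \<eta> \<epsilon> D (2 ^ p) m n \<le> \<kappa> / 2 * (real m * real n)"
    using small by blast
  have "\<forall>\<^sub>F k in sequentially. N0 \<le> m k \<and> N0 \<le> n k"
    using dims by (auto simp: filterlim_at_top eventually_conj_iff)
  then obtain K where K: "\<And>k. k \<ge> K \<Longrightarrow> N0 \<le> m k \<and> N0 \<le> n k"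
    by (auto simp: eventually_sequentially)
  have "norm (?E k / (real (m k) * real (n k)) - 0) < \<kappa>" if k: "K \<le> k" for k
  proof -
    interpret random_matrix "\<Omega> k" "m k" "n k" "Y k" "\<lambda>i j. h (M k $$ (i, j))" by (rule rm)
    obtain D' y c where D': "D' \<le> D" and y: "orthonormal (m k) {..<D'} y"
      and close: "\<And>i j. i < m k \<Longrightarrow> j < n k \<Longrightarrow> \<bar>h (M k $$ (i, j)) - (\<Sum>b<D'. y b i * c b j)\<bar> \<le> \<epsilon>"
      using D[OF lr[of k]] M_bd[of _ k] by blast
    have "?E k \<le> error_bound \<eta> \<epsilon> D' (2 ^ p) (m k) (n k)"
      by (rule usvt_expected_error_le[OF \<eta> y close p])
    also have "\<dots> \<le> error_bound \<eta> \<epsilon> D (2 ^ p) (m k) (n k)"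
      by (rule error_bound_mono[OF \<eta>(1) D'])
    also have "\<dots> \<le> \<kappa> / 2 * (real (m k) * real (n k))"
      using N0 K[OF k] pos by blast
    finally have "?E k / (real (m k) * real (n k)) \<le> \<kappa> / 2"
      using pos by (simp add: pos_divide_le_eq)
    moreover have "0 \<le> ?E k / (real (m k) * real (n k))"
      by (intro divide_nonneg_nonneg integral_nonneg_AE AE_I2 sum_nonneg) auto
    ultimately show ?thesis using \<kappa> unfolding real_norm_def by linarith
  qed
  then show "\<exists>K. \<forall>k\<ge>K. norm (?E k / (real (m k) * real (n k)) - 0) < \<kappa>" by blast
qed

section \<open>The modified estimator\<close>

abbreviation entry_mean :: "nat \<Rightarrow> nat \<Rightarrow> (real \<Rightarrow> real) \<Rightarrow> real mat \<Rightarrow> real" where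
  "entry_mean m n F A \<equiv> (\<Sum>i<m. \<Sum>j<n. F (A $$ (i, j))) / (real m * real n)"

section \<open>Empirical distributions and weak limits\<close>

lemma integral_empirical_distribution:
  fixes F :: "real \<Rightarrow> real"
  assumes M: "M \<in> carrier_mat m n" and F: "F \<in> borel_measurable borel"
  shows "integral\<^sup>L (empirical_distribution M) F = entry_mean m n F M"
proof -
  have d: "dim_row M = m" "dim_col M = n" using M by auto
  have "integral\<^sup>L (empirical_distribution M) F =
      integral\<^sup>L (uniform_count_measure ({..<m} \<times> {..<n})) (\<lambda>ij. F (M $$ ij))"
    unfolding empirical_distribution_def d by (rule integral_distr) (use F in auto)
  also have "\<dots> = (\<Sum>ij\<in>{..<m} \<times> {..<n}. F (M $$ ij)) / (real m * real n)"
    by (simp add: integral_uniform_count_measure)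
  finally show ?thesis by (simp add: sum.cartesian_product case_prod_unfold)
qed

lemma real_distribution_empirical:
  assumes M: "M \<in> carrier_mat m n" and pos: "0 < m" "0 < n"
  shows "real_distribution (empirical_distribution M)"
proof -
  have "prob_space (uniform_count_measure ({..<dim_row M} \<times> {..<dim_col M}))"
    using M pos by (intro prob_space_uniform_count_measure) auto
  then have "prob_space (empirical_distribution M)"
    unfolding empirical_distribution_def by (rule prob_space.prob_space_distr) simp
  then show ?thesis
    by (simp add: real_distribution_def real_distribution_axioms_def empirical_distribution_def)
qed

text \<open>All mass lies in \<open>{-1..1}\<close>; \<open>{-2<..2}\<close> is a half-open
  interval, as tightness demands, that contains it.\<close>

lemma tight_empirical:
  assumes M: "\<And>k. M k \<in> carrier_mat (m k) (n k)" and pos: "\<And>k. 0 < m k" "\<And>k. 0 < n k"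
    and bd: "\<And>k i j. i < m k \<Longrightarrow> j < n k \<Longrightarrow> M k $$ (i, j) \<in> {-1..1}"
  shows "tight (\<lambda>k. empirical_distribution (M k))"
  unfolding tight_def
proof (intro conjI allI impI)
  show "real_distribution (empirical_distribution (M k))" for k
    by (rule real_distribution_empirical[OF M pos])
  have "measure (empirical_distribution (M k)) {-2<..2} = 1" for k
  proof -
    interpret E: real_distribution "empirical_distribution (M k)" by (rule real_distribution_empirical[OF M pos])
    have "integral\<^sup>L (empirical_distribution (M k)) (indicator {-2<..2}) =
        (\<Sum>i<m k. \<Sum>j<n k. indicator {-2<..2} (M k $$ (i, j))) / (real (m k) * real (n k))"
      by (rule integral_empirical_distribution[OF M]) simp
    also have "(\<Sum>i<m k. \<Sum>j<n k. indicator {-2<..2} (M k $$ (i, j)) :: real) = (\<Sum>i<m k. \<Sum>j<n k. 1)"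
      using bd[of _ k] by (intro sum.cong refl) (force simp: indicator_def)
    finally show ?thesis using pos[of k] by simp
  qed
  then show "\<exists>a b. a < b \<and> (\<forall>k. 1 - \<epsilon> < measure (empirical_distribution (M k)) {a<..b})" if "0 < \<epsilon>" for \<epsilon>
    using that by (intro exI[of _ "-2"] exI[of _ 2]) simp
qed

text \<open>The complement of the support is a union of null open sets, and by Lindelof countably
  many of them suffice.\<close>

lemma AE_measure_support:
  assumes "real_distribution \<mu>"
  shows "AE x in \<mu>. x \<in> measure_support \<mu>"
proof -
  interpret real_distribution \<mu> by fact
  define \<F> where "\<F> = {U. open U \<and> emeasure \<mu> U = 0}"
  obtain \<F>' where F': "\<F>' \<subseteq> \<F>" "countable \<F>'" "\<Union>\<F>' = \<Union>\<F>"
    using Lindelof[of \<F>] by (auto simp: \<F>_def)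
  have "(\<Union>U\<in>\<F>'. U) \<in> null_sets \<mu>"
    using F' by (intro null_sets_UN') (auto simp: \<F>_def null_sets_def)
  moreover have "{x \<in> space \<mu>. x \<notin> measure_support \<mu>} \<subseteq> (\<Union>U\<in>\<F>'. U)"
    using F'(3) by (auto simp: measure_support_def \<F>_def)
  ultimately show ?thesis by (rule AE_I')
qed

lemma weak_conv_integral_empirical:
  fixes F :: "real \<Rightarrow> real"
  assumes M: "\<And>k. M k \<in> carrier_mat (m k) (n k)" and pos: "\<And>k. 0 < m k" "\<And>k. 0 < n k"
    and \<mu>: "real_distribution \<mu>" and conv: "weak_conv_m (\<lambda>k. empirical_distribution (M k)) \<mu>"
    and F: "continuous_on UNIV F" "\<And>x. \<bar>F x\<bar> \<le> 1"
  shows "(\<lambda>k. entry_mean (m k) (n k) F (M k)) \<longlonglongrightarrow> integral\<^sup>L \<mu> F"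
proof -
  have "(\<lambda>k. integral\<^sup>L (empirical_distribution (M k)) F) \<longlonglongrightarrow> integral\<^sup>L \<mu> F"
    by (rule weak_conv_imp_integral_bdd_continuous_conv[OF real_distribution_empirical[OF M pos] \<mu> conv, where B = 1])
      (use F in \<open>auto simp: continuous_on_eq_continuous_at\<close>)
  then show ?thesis
    using integral_empirical_distribution[OF M borel_measurable_continuous_onI[OF F(1)]] by simp
qed

text \<open>The indicator of \<open>g x < c\<close> need not be continuous, so weak convergence is
  not applied to it but to a continuous function that dominates half of it and has integral 0 under
  \<open>\<mu>\<close>.\<close>

lemma low_values_fraction:
  fixes g :: "real \<Rightarrow> real"
  assumes M: "\<And>k. M k \<in> carrier_mat (m k) (n k)" and pos: "\<And>k. 0 < m k" "\<And>k. 0 < n k"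
    and bd: "\<And>k i j. i < m k \<Longrightarrow> j < n k \<Longrightarrow> M k $$ (i, j) \<in> {-1..1}"
    and \<mu>: "real_distribution \<mu>" and conv: "weak_conv_m (\<lambda>k. empirical_distribution (M k)) \<mu>"
    and g: "continuous_on {-1..1} g" "g ` {-1..1} \<subseteq> {0..1}" and nz: "\<And>x. x \<in> measure_support \<mu> \<Longrightarrow> g x \<noteq> 0"
  shows "\<exists>c>0. (\<lambda>k. entry_mean (m k) (n k) (\<lambda>x. of_bool (g x < c)) (M k)) \<longlonglongrightarrow> 0"
proof -
  interpret \<mu>: real_distribution \<mu> by fact
  note lim = weak_conv_integral_empirical[OF M pos \<mu> conv]
  have int: "integrable \<mu> F" if "continuous_on UNIV F" "\<And>x. \<bar>F x\<bar> \<le> 1" for F :: "real \<Rightarrow> real"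
    using that borel_measurable_continuous_onI[OF that(1)]
    by (intro \<mu>.integrable_const_bound[where B = 1]) auto
  \<comment> \<open>A test function that vanishes exactly on \<open>{-1..1}\<close>: its empirical
    means are 0, so \<open>\<mu>\<close> is carried by that interval.\<close>
  define \<psi> :: "real \<Rightarrow> real" where "\<psi> x = min 1 (max 0 (\<bar>x\<bar> - 1))" for x
  have \<psi>c: "continuous_on UNIV \<psi>" unfolding \<psi>_def by (intro continuous_intros)
  have \<psi>b: "\<bar>\<psi> x\<bar> \<le> 1" "0 \<le> \<psi> x" for x by (auto simp: \<psi>_def)
  have "\<psi> (M k $$ (i, j)) = 0" if "i < m k" "j < n k" for k i j
    using bd[OF that] by (auto simp: \<psi>_def)
  then have "(\<lambda>k. entry_mean (m k) (n k) \<psi> (M k)) = (\<lambda>k. 0)"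
    by (intro ext) simp
  then have "integral\<^sup>L \<mu> \<psi> = 0"
    using lim[OF \<psi>c \<psi>b(1)] by (simp add: LIMSEQ_const_iff)
  then have "AE x in \<mu>. \<psi> x = 0"
    using integral_nonneg_eq_0_iff_AE[OF int[OF \<psi>c \<psi>b(1)]] \<psi>b(2) by simp
  then have AE1: "AE x in \<mu>. x \<in> measure_support \<mu> \<inter> {-1..1}"
    using AE_measure_support[OF \<mu>] by eventually_elim (auto simp: \<psi>_def min_def max_def split: if_splits)
  have clo: "closed (measure_support \<mu>)"
  proof -
    have "- measure_support \<mu> = \<Union>{U. open U \<and> \<not> 0 < emeasure \<mu> U}"
      by (auto simp: measure_support_def)
    then show ?thesis unfolding closed_def by (metis (no_types, lifting) mem_Collect_eq open_Union)
  qed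
  \<comment> \<open>A positive minimum on a compact set. The factor 2 leaves a gap between
    \<open>c\<close> and \<open>2 * c\<close> in which the test function can decay.\<close>
  have "\<exists>c>0. \<forall>x\<in>measure_support \<mu> \<inter> {-1..1}. 2 * c \<le> g x"
  proof (cases "measure_support \<mu> \<inter> {-1..1} = {}")
    case False
    have "compact (measure_support \<mu> \<inter> {-1..1})" using clo by (intro closed_Int_compact compact_Icc)
    then have "\<exists>x\<in>measure_support \<mu> \<inter> {-1..1}. \<forall>y\<in>measure_support \<mu> \<inter> {-1..1}. g x \<le> g y"
      using False g(1) by (intro continuous_attains_inf continuous_on_subset[OF g(1)]) auto
    then obtain x where x: "x \<in> measure_support \<mu> \<inter> {-1..1}"
      and min: "\<forall>y\<in>measure_support \<mu> \<inter> {-1..1}. g x \<le> g y" by blast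
    have "g x \<in> {0..1}" using x g(2) by blast
    moreover have "g x \<noteq> 0" using x nz by blast
    ultimately show ?thesis using min by (intro exI[of _ "g x / 2"]) simp
  qed (auto intro: exI[of _ 1])
  then obtain c where c: "0 < c" "\<And>x. x \<in> measure_support \<mu> \<inter> {-1..1} \<Longrightarrow> 2 * c \<le> g x" by blast
  \<comment> \<open>On \<open>{-1..1}\<close> this is 0 where \<open>2 * c \<le> g x\<close> and
    exceeds 1/2 where \<open>g x < c\<close>. Composition with \<open>truncate_entry\<close> extends
    \<open>g\<close> continuously to the line.\<close>
  define \<phi> where "\<phi> x = max 0 (1 - g (truncate_entry x) / (2 * c))" for x
  have tr: "truncate_entry x = x" if "x \<in> {-1..1}" for x using that by (simp add: truncate_entry_def)
  have g01: "0 \<le> g (truncate_entry x)" for x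
    using g(2) truncate_entry_bounded[of x] by (auto simp: abs_le_iff image_subset_iff)
  have \<phi>c: "continuous_on UNIV \<phi>"
  proof -
    have "continuous_on UNIV (\<lambda>x. g (truncate_entry x))"
      by (rule continuous_on_compose2[OF g(1)])
        (auto simp: truncate_entry_def intro!: continuous_intros)
    then show ?thesis unfolding \<phi>_def using c by (intro continuous_intros) auto
  qed
  have \<phi>b: "\<bar>\<phi> x\<bar> \<le> 1" "0 \<le> \<phi> x" for x
    using g01[of x] c(1) by (auto simp: \<phi>_def)
  have "AE x in \<mu>. \<phi> x = 0"
    using AE1
  proof eventually_elim
    case (elim x)
    then have "2 * c \<le> g x" by (rule c(2))
    then show ?case using c(1) tr[of x] elim by (simp add: \<phi>_def)
  qed
  then have "integral\<^sup>L \<mu> \<phi> = 0"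
    using integral_nonneg_eq_0_iff_AE[OF int[OF \<phi>c \<phi>b(1)]] \<phi>b(2) by simp
  then have "(\<lambda>k. 2 * entry_mean (m k) (n k) \<phi> (M k)) \<longlonglongrightarrow> 2 * 0"
    using lim[OF \<phi>c \<phi>b(1)] by (intro tendsto_mult tendsto_const) simp
  then have lim0: "(\<lambda>k. 2 * entry_mean (m k) (n k) \<phi> (M k)) \<longlonglongrightarrow> 0"
    by simp
  have le: "entry_mean (m k) (n k) (\<lambda>x. of_bool (g x < c)) (M k)
      \<le> 2 * entry_mean (m k) (n k) \<phi> (M k)" for k
  proof -
    have "(\<Sum>i<m k. \<Sum>j<n k. of_bool (g (M k $$ (i, j)) < c)) \<le> (\<Sum>i<m k. \<Sum>j<n k. 2 * \<phi> (M k $$ (i, j)))"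
    proof (intro sum_mono)
      fix i j assume "i \<in> {..<m k}" "j \<in> {..<n k}"
      then have "truncate_entry (M k $$ (i, j)) = M k $$ (i, j)" using bd by (intro tr) auto
      then show "of_bool (g (M k $$ (i, j)) < c) \<le> 2 * \<phi> (M k $$ (i, j))"
        using c(1) \<phi>b(2)[of "M k $$ (i, j)"] by (auto simp: \<phi>_def field_simps max_def)
    qed
    also have "\<dots> = 2 * (\<Sum>i<m k. \<Sum>j<n k. \<phi> (M k $$ (i, j)))" by (simp add: sum_distrib_left)
    finally show ?thesis by (simp add: divide_right_mono)
  qed
  have "(\<lambda>k. entry_mean (m k) (n k) (\<lambda>x. of_bool (g x < c)) (M k)) \<longlonglongrightarrow> 0"
    by (rule tendsto_sandwich[OF always_eventually[OF allI] always_eventually[OF allI[OF le]] tendsto_const lim0])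
      (intro divide_nonneg_nonneg sum_nonneg; simp)
  then show ?thesis using c(1) by blast
qed

text \<open>Small \<open>F\<close> is given up at the maximal cost 4. If \<open>r\<close> misses
  \<open>F\<close> by more than \<open>c / 2\<close>, its squared error already pays for this 4.
  Otherwise \<open>c / 2 \<le> r\<close>, and the error of the quotient is
  \<open>(q - x * r) / r\<close> with \<open>q - x * r = (q - x * F) + x * (F - r)\<close>.\<close>

lemma ratio_error_le:
  fixes q r x F c :: real
  assumes x: "\<bar>x\<bar> \<le> 1" and c: "0 < c"
  shows "(truncate_entry (q / r) - x)\<^sup>2 \<le> 4 * of_bool (F < c) + 16 / c\<^sup>2 * ((q - x * F)\<^sup>2 + (r - F)\<^sup>2)"
proof -
  have triv: "(truncate_entry (q / r) - x)\<^sup>2 \<le> 4"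
  proof -
    have "\<bar>truncate_entry (q / r) - x\<bar> \<le> 2" using truncate_entry_bounded[of "q / r"] x by linarith
    then have "\<bar>truncate_entry (q / r) - x\<bar>\<^sup>2 \<le> 2\<^sup>2" by (intro power_mono) auto
    then show ?thesis by simp
  qed
  have nn: "0 \<le> 16 / c\<^sup>2 * (q - x * F)\<^sup>2" "0 \<le> 16 / c\<^sup>2 * (r - F)\<^sup>2" by simp_all
  note exp = distrib_left[of "16 / c\<^sup>2" "(q - x * F)\<^sup>2" "(r - F)\<^sup>2"]
  have ob: "0 \<le> (of_bool (F < c) :: real)" by simp
  consider "F < c" | "c \<le> F" "c / 2 < \<bar>r - F\<bar>" | "c \<le> F" "\<bar>r - F\<bar> \<le> c / 2" by linarith
  then show ?thesis
  proof cases
    case 1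
    then have "(of_bool (F < c) :: real) = 1" by simp
    then show ?thesis using triv nn unfolding exp by linarith
  next
    case 2
    have "(c / 2)\<^sup>2 \<le> \<bar>r - F\<bar>\<^sup>2" using 2 c by (intro power_mono) auto
    then have "4 \<le> 16 / c\<^sup>2 * (r - F)\<^sup>2" using c by (simp add: field_simps)
    then show ?thesis using triv nn ob unfolding exp by linarith
  next
    case 3
    have r: "c / 2 \<le> r" using 3 by linarith
    then have r0: "0 < r" using c by linarith
    have "\<bar>truncate_entry (q / r) - x\<bar> \<le> \<bar>q / r - x\<bar>" by (rule truncate_entry_contract[OF x])
    also have "\<dots> = \<bar>q - x * r\<bar> / r" using r0 by (simp add: field_simps flip: abs_div_pos)
    also have "\<dots> \<le> \<bar>q - x * r\<bar> / (c / 2)" using r r0 c by (intro divide_left_mono) auto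
    also have "\<dots> \<le> (\<bar>q - x * F\<bar> + \<bar>r - F\<bar>) / (c / 2)"
    proof (rule divide_right_mono)
      have "\<bar>q - x * r\<bar> \<le> \<bar>q - x * F\<bar> + \<bar>x * (F - r)\<bar>"
        using abs_triangle_ineq[of "q - x * F" "x * (F - r)"] by (simp add: algebra_simps)
      also have "\<bar>x * (F - r)\<bar> \<le> 1 * \<bar>r - F\<bar>"
        unfolding abs_mult using x by (intro mult_mono) auto
      finally show "\<bar>q - x * r\<bar> \<le> \<bar>q - x * F\<bar> + \<bar>r - F\<bar>" by simp
    qed (use c in simp)
    finally have "\<bar>truncate_entry (q / r) - x\<bar>\<^sup>2 \<le> ((\<bar>q - x * F\<bar> + \<bar>r - F\<bar>) / (c / 2))\<^sup>2"
      by (rule power_mono) simp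
    also have "\<dots> = 4 / c\<^sup>2 * (\<bar>q - x * F\<bar> + \<bar>r - F\<bar>)\<^sup>2"
      unfolding power_divide by simp
    also have "\<dots> \<le> 4 / c\<^sup>2 * (4 * ((q - x * F)\<^sup>2 + (r - F)\<^sup>2))"
    proof (rule mult_left_mono)
      have "(y + z)\<^sup>2 \<le> 2 * (y\<^sup>2 + z\<^sup>2)" for y z :: real
        using zero_le_power2[of "y - z"] by (simp add: power2_eq_square algebra_simps)
      from this[of "\<bar>q - x * F\<bar>" "\<bar>r - F\<bar>"]
      have "(\<bar>q - x * F\<bar> + \<bar>r - F\<bar>)\<^sup>2 \<le> 2 * ((q - x * F)\<^sup>2 + (r - F)\<^sup>2)" by (simp only: power2_abs)
      also have "\<dots> \<le> 4 * ((q - x * F)\<^sup>2 + (r - F)\<^sup>2)" by (intro mult_right_mono) auto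
      finally show "(\<bar>q - x * F\<bar> + \<bar>r - F\<bar>)\<^sup>2 \<le> 4 * ((q - x * F)\<^sup>2 + (r - F)\<^sup>2)" .
    qed (use c in simp)
    finally show ?thesis using 3 by simp
  qed
qed

text \<open>The dimensions of the random matrices are known only for \<open>\<omega>\<close> in the
  space, so the formulas for the entries of data and mask hold only there.\<close>

lemma (in prob_space) indep_vars_cong_space:
  assumes eq: "\<And>i \<omega>. i \<in> I \<Longrightarrow> \<omega> \<in> space M \<Longrightarrow> X i \<omega> = Y i \<omega>" and X: "indep_vars M' X I"
  shows "indep_vars M' Y I"
proof -
  have "X i -` A \<inter> space M = Y i -` A \<inter> space M" if "i \<in> I" for i A
    using eq[OF that] by auto
  then have s: "{X i -` A \<inter> space M |A. A \<in> sets (M' i)} = {Y i -` A \<inter> space M |A. A \<in> sets (M' i)}" if "i \<in> I" for i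
    using that by auto
  have m: "random_variable (M' i) (X i) \<longleftrightarrow> random_variable (M' i) (Y i)" if "i \<in> I" for i
    using eq[OF that] by (rule measurable_cong)
  show ?thesis
    using X indep_sets_cong[OF refl s, of I] m unfolding indep_vars_def2 by simp
qed

text \<open>The sum type as index lets one independence assumption cover entries and reveal
  indicators jointly. The probabilities \<open>B\<close> stay abstract in order to be read both as
  values of \<open>f\<close> and as values of a continuous extension.\<close>

locale revealed_matrix = prob_space +
  fixes m n :: nat and X :: "'a \<Rightarrow> real mat" and R :: "'a \<Rightarrow> (nat \<times> nat) set" and A B :: "nat \<Rightarrow> nat \<Rightarrow> real"
  assumes pos: "0 < m" "0 < n"
    and dim: "\<omega> \<in> space M \<Longrightarrow> X \<omega> \<in> carrier_mat m n"
    and bounded: "\<omega> \<in> space M \<Longrightarrow> elements_mat (X \<omega>) \<subseteq> {-1..1}"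
    and indep: "indep_vars (\<lambda>_. borel)
          (\<lambda>c \<omega>. case c of Inl ij \<Rightarrow> X \<omega> $$ ij | Inr ij \<Rightarrow> (of_bool (ij \<in> R \<omega>) :: real))
          (({..<m} \<times> {..<n}) <+> ({..<m} \<times> {..<n}))"
    and mean: "i < m \<Longrightarrow> j < n \<Longrightarrow> expectation (\<lambda>\<omega>. X \<omega> $$ (i, j)) = A i j"
    and reveal: "i < m \<Longrightarrow> j < n \<Longrightarrow> prob {\<omega> \<in> space M. (i, j) \<in> R \<omega>} = B i j"
begin

abbreviation data_mat :: "'a \<Rightarrow> real mat" where
  "data_mat \<equiv> \<lambda>\<omega>. revealed_part (X \<omega>) (R \<omega>)"

abbreviation mask_mat :: "'a \<Rightarrow> real mat" where
  "mask_mat \<equiv> \<lambda>\<omega>. reveal_mask (dim_row (X \<omega>)) (dim_col (X \<omega>)) (R \<omega>)"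

text \<open>Functions of the disjoint blocks \<open>{Inl e, Inr e}\<close> are independent;
  \<open>h\<close> is the product for the data and the second projection for the mask.\<close>

lemma indep_pairs:
  assumes h: "h \<in> borel_measurable (borel \<Otimes>\<^sub>M borel)"
  shows "indep_vars (\<lambda>_. borel) (\<lambda>e \<omega>. h (X \<omega> $$ e, of_bool (e \<in> R \<omega>) :: real) :: real) ({..<m} \<times> {..<n})"
proof -
  let ?V = "\<lambda>c \<omega>. case c of Inl ij \<Rightarrow> X \<omega> $$ ij | Inr ij \<Rightarrow> (of_bool (ij \<in> R \<omega>) :: real)"
  let ?K = "\<lambda>e. {Inl e, Inr e}"
  have "indep_vars (\<lambda>e. PiM (?K e) (\<lambda>_. borel)) (\<lambda>e \<omega>. restrict (\<lambda>c. ?V c \<omega>) (?K e)) ({..<m} \<times> {..<n})"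
    by (rule indep_vars_restrict[OF indep]) (auto simp: disjoint_family_on_def)
  then have "indep_vars (\<lambda>_. borel) (\<lambda>e \<omega>. h (restrict (\<lambda>c. ?V c \<omega>) (?K e) (Inl e), restrict (\<lambda>c. ?V c \<omega>) (?K e) (Inr e))) ({..<m} \<times> {..<n})"
    by (rule indep_vars_compose2[where Y = "\<lambda>e x. h (x (Inl e), x (Inr e))"])
      (intro measurable_compose[OF _ h] measurable_Pair measurable_component_singleton; simp)
  then show ?thesis by simp
qed

lemma entry_bounded: "\<omega> \<in> space M \<Longrightarrow> i < m \<Longrightarrow> j < n \<Longrightarrow> \<bar>X \<omega> $$ (i, j)\<bar> \<le> 1"
proof -
  assume \<omega>: "\<omega> \<in> space M" and ij: "i < m" "j < n"
  have "X \<omega> $$ (i, j) \<in> elements_mat (X \<omega>)"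
    unfolding elements_mat_def using dim[OF \<omega>] ij by (auto intro!: bexI[of _ i])
  then have "X \<omega> $$ (i, j) \<in> {-1..1}" using bounded[OF \<omega>] by (rule rev_subsetD)
  then show ?thesis by (simp add: abs_le_iff)
qed

lemma measurable_parts:
  assumes "i < m" "j < n"
  shows "(\<lambda>\<omega>. X \<omega> $$ (i, j)) \<in> borel_measurable M"
    "(\<lambda>\<omega>. of_bool ((i, j) \<in> R \<omega>) :: real) \<in> borel_measurable M"
  using indep_pairs[of fst] indep_pairs[of snd] assms by (auto simp: indep_vars_def)

lemma integrable_parts:
  assumes "i < m" "j < n"
  shows "integrable M (\<lambda>\<omega>. X \<omega> $$ (i, j))" "integrable M (\<lambda>\<omega>. of_bool ((i, j) \<in> R \<omega>) :: real)"
  using measurable_parts[OF assms] entry_bounded[OF _ assms]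
  by (auto intro!: integrable_const_bound[where B = 1] AE_I2)

lemma expectation_revealed:
  assumes ij: "i < m" "j < n"
  shows "expectation (\<lambda>\<omega>. of_bool ((i, j) \<in> R \<omega>)) = B i j"
proof -
  have eq: "expectation (\<lambda>\<omega>. of_bool ((i, j) \<in> R \<omega>)) = expectation (indicat_real {\<omega> \<in> space M. (i, j) \<in> R \<omega>})"
    by (rule Bochner_Integration.integral_cong) (auto simp: indicator_def)
  have "{\<omega> \<in> space M. (i, j) \<in> R \<omega>} = (\<lambda>\<omega>. of_bool ((i, j) \<in> R \<omega>) :: real) -` {1} \<inter> space M"
    by auto
  then have "{\<omega> \<in> space M. (i, j) \<in> R \<omega>} \<in> events"
    using measurable_sets[OF measurable_parts(2)[OF ij], of "{1}"] by simp
  then have "expectation (indicat_real {\<omega> \<in> space M. (i, j) \<in> R \<omega>}) = prob {\<omega> \<in> space M. (i, j) \<in> R \<omega>}"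
    by simp
  with eq reveal[OF ij] show ?thesis by (simp only:)
qed

lemma expectation_revealed_entry:
  assumes ij: "i < m" "j < n"
  shows "expectation (\<lambda>\<omega>. X \<omega> $$ (i, j) * of_bool ((i, j) \<in> R \<omega>)) = A i j * B i j"
proof -
  let ?V = "\<lambda>c \<omega>. case c of Inl ij \<Rightarrow> X \<omega> $$ ij | Inr ij \<Rightarrow> (of_bool (ij \<in> R \<omega>) :: real)"
  have sub: "{Inl (i, j), Inr (i, j)} \<subseteq> ({..<m} \<times> {..<n}) <+> ({..<m} \<times> {..<n})"
    using ij by auto
  have "expectation (\<lambda>\<omega>. \<Prod>c\<in>{Inl (i, j), Inr (i, j)}. ?V c \<omega>) = (\<Prod>c\<in>{Inl (i, j), Inr (i, j)}. expectation (?V c))"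
    using integrable_parts[OF ij]
    by (intro indep_vars_lebesgue_integral indep_vars_subset[OF indep sub]) auto
  then show ?thesis using expectation_revealed[OF ij] mean[OF ij] by simp
qed

sublocale data: random_matrix M m n data_mat "\<lambda>i j. A i j * B i j"
proof
  have e: "X \<omega> $$ e * of_bool (e \<in> R \<omega>) = data_mat \<omega> $$ e"
    if "\<omega> \<in> space M" "e \<in> {..<m} \<times> {..<n}" for \<omega> e
    using that dim[OF that(1)] by (auto simp: revealed_part_def)
  show "indep_vars (\<lambda>_. borel) (\<lambda>e \<omega>. data_mat \<omega> $$ e) ({..<m} \<times> {..<n})"
    by (rule indep_vars_cong_space[OF _ indep_pairs[of "\<lambda>(x, b). x * b"]]) (auto simp: e)
  fix i j assume ij: "i < m" "j < n"
  show "\<bar>data_mat \<omega> $$ (i, j)\<bar> \<le> 1" if "\<omega> \<in> space M" for \<omega>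
    using ij entry_bounded[OF that ij] e[OF that, of "(i, j)", symmetric] by (simp add: of_bool_def)
  have "expectation (\<lambda>\<omega>. data_mat \<omega> $$ (i, j)) = expectation (\<lambda>\<omega>. X \<omega> $$ (i, j) * of_bool ((i, j) \<in> R \<omega>))"
    using ij by (intro Bochner_Integration.integral_cong refl e[symmetric]) auto
  then show "expectation (\<lambda>\<omega>. data_mat \<omega> $$ (i, j)) = A i j * B i j"
    by (simp only: expectation_revealed_entry[OF ij])
next
  show "data_mat \<omega> \<in> carrier_mat m n" if "\<omega> \<in> space M" for \<omega>
    using dim[OF that] by (auto simp: revealed_part_def)
qed (use pos in auto)

sublocale mask: random_matrix M m n mask_mat B
proof
  have e: "of_bool (e \<in> R \<omega>) = mask_mat \<omega> $$ e"
    if "\<omega> \<in> space M" "e \<in> {..<m} \<times> {..<n}" for \<omega> e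
    using that dim[OF that(1)] by (auto simp: reveal_mask_def)
  show "indep_vars (\<lambda>_. borel) (\<lambda>e \<omega>. mask_mat \<omega> $$ e) ({..<m} \<times> {..<n})"
    by (rule indep_vars_cong_space[OF _ indep_pairs[of snd]]) (auto simp: e)
  fix i j assume ij: "i < m" "j < n"
  show "\<bar>mask_mat \<omega> $$ (i, j)\<bar> \<le> 1" if "\<omega> \<in> space M" for \<omega>
    using ij e[OF that, of "(i, j)", symmetric] by simp
  have "expectation (\<lambda>\<omega>. mask_mat \<omega> $$ (i, j)) = expectation (\<lambda>\<omega>. of_bool ((i, j) \<in> R \<omega>))"
    using ij by (intro Bochner_Integration.integral_cong refl e[symmetric]) auto
  then show "expectation (\<lambda>\<omega>. mask_mat \<omega> $$ (i, j)) = B i j"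
    by (simp only: expectation_revealed[OF ij])
next
  show "mask_mat \<omega> \<in> carrier_mat m n" if "\<omega> \<in> space M" for \<omega>
    using dim[OF that] by (auto simp: reveal_mask_def)
qed (use pos in auto)

abbreviation "Q \<eta> \<omega> i j \<equiv> usvt \<eta> (data_mat \<omega>) $$ (i, j)"
abbreviation "S \<eta> \<omega> i j \<equiv> usvt \<eta> (mask_mat \<omega>) $$ (i, j)"

text \<open>Division by 0 gives 0, which absorbs the case distinction of the definition into the
  plain quotient.\<close>

lemma modified_usvt_entry:
  assumes "\<omega> \<in> space M" "i < m" "j < n"
  shows "modified_usvt \<eta> (X \<omega>) (R \<omega>) $$ (i, j) = truncate_entry (Q \<eta> \<omega> i j / S \<eta> \<omega> i j)"
  using assms dim[OF assms(1)] by (simp add: modified_usvt_def Let_def)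

lemma mean_le_1: "i < m \<Longrightarrow> j < n \<Longrightarrow> \<bar>A i j\<bar> \<le> 1"
  using abs_expectation_le_1[OF integrable_parts(1) entry_bounded] mean by metis

lemma integrable_modified_usvt_error:
  assumes \<eta>: "0 < \<eta>"
  shows "integrable M (\<lambda>\<omega>. \<Sum>i<m. \<Sum>j<n. (modified_usvt \<eta> (X \<omega>) (R \<omega>) $$ (i, j) - A i j)\<^sup>2)"
proof (intro Bochner_Integration.integrable_sum)
  fix i j assume "i \<in> {..<m}" "j \<in> {..<n}"
  then have ij: "i < m" "j < n" by auto
  have "(\<lambda>\<omega>. (truncate_entry (Q \<eta> \<omega> i j / S \<eta> \<omega> i j) - A i j)\<^sup>2) \<in> borel_measurable M"
    using data.measurable_usvt[OF \<eta> ij] mask.measurable_usvt[OF \<eta> ij] by measurable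
  moreover have "(truncate_entry (Q \<eta> \<omega> i j / S \<eta> \<omega> i j) - A i j)\<^sup>2 \<le> 2\<^sup>2" for \<omega>
  proof -
    have "\<bar>truncate_entry (Q \<eta> \<omega> i j / S \<eta> \<omega> i j) - A i j\<bar> \<le> 2"
      using truncate_entry_bounded[of "Q \<eta> \<omega> i j / S \<eta> \<omega> i j"] mean_le_1[OF ij] by linarith
    then have "\<bar>truncate_entry (Q \<eta> \<omega> i j / S \<eta> \<omega> i j) - A i j\<bar>\<^sup>2 \<le> 2\<^sup>2" by (intro power_mono) auto
    then show ?thesis by simp
  qed
  ultimately have "integrable M (\<lambda>\<omega>. (truncate_entry (Q \<eta> \<omega> i j / S \<eta> \<omega> i j) - A i j)\<^sup>2)"
    by (intro integrable_const_bound[where B = "2\<^sup>2"]) auto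
  then show "integrable M (\<lambda>\<omega>. (modified_usvt \<eta> (X \<omega>) (R \<omega>) $$ (i, j) - A i j)\<^sup>2)"
    by (rule Bochner_Integration.integrable_cong[THEN iffD1, rotated -1])
      (simp_all add: modified_usvt_entry ij)
qed

lemma expectation_modified_usvt_error_le:
  assumes \<eta>: "0 < \<eta>" and c: "0 < c"
  shows "expectation (\<lambda>\<omega>. \<Sum>i<m. \<Sum>j<n. (modified_usvt \<eta> (X \<omega>) (R \<omega>) $$ (i, j) - A i j)\<^sup>2) \<le>
    4 * (\<Sum>i<m. \<Sum>j<n. of_bool (B i j < c)) +
    16 / c\<^sup>2 * (expectation (\<lambda>\<omega>. \<Sum>i<m. \<Sum>j<n. (Q \<eta> \<omega> i j - A i j * B i j)\<^sup>2) +
      expectation (\<lambda>\<omega>. \<Sum>i<m. \<Sum>j<n. (S \<eta> \<omega> i j - B i j)\<^sup>2))"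
proof -
  let ?b = "\<Sum>i<m. \<Sum>j<n. of_bool (B i j < c) :: real"
  let ?q = "\<lambda>\<omega>. \<Sum>i<m. \<Sum>j<n. (Q \<eta> \<omega> i j - A i j * B i j)\<^sup>2" and ?s = "\<lambda>\<omega>. \<Sum>i<m. \<Sum>j<n. (S \<eta> \<omega> i j - B i j)\<^sup>2"
  note int = data.integrable_usvt_error[OF \<eta>] mask.integrable_usvt_error[OF \<eta>]
  have "expectation (\<lambda>\<omega>. \<Sum>i<m. \<Sum>j<n. (modified_usvt \<eta> (X \<omega>) (R \<omega>) $$ (i, j) - A i j)\<^sup>2)
      \<le> expectation (\<lambda>\<omega>. 4 * ?b + 16 / c\<^sup>2 * (?q \<omega> + ?s \<omega>))"
  proof (rule integral_mono[OF integrable_modified_usvt_error[OF \<eta>]])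
    show "integrable M (\<lambda>\<omega>. 4 * ?b + 16 / c\<^sup>2 * (?q \<omega> + ?s \<omega>))"
      using int by (intro Bochner_Integration.integrable_add integrable_const integrable_mult_right)
    fix \<omega> assume \<omega>: "\<omega> \<in> space M"
    have "(\<Sum>i<m. \<Sum>j<n. (modified_usvt \<eta> (X \<omega>) (R \<omega>) $$ (i, j) - A i j)\<^sup>2) \<le>
      (\<Sum>i<m. \<Sum>j<n. 4 * of_bool (B i j < c) + 16 / c\<^sup>2 * ((Q \<eta> \<omega> i j - A i j * B i j)\<^sup>2 + (S \<eta> \<omega> i j - B i j)\<^sup>2))"
    proof (intro sum_mono)
      fix i j assume "i \<in> {..<m}" "j \<in> {..<n}"
      then have ij: "i < m" "j < n" by auto
      show "(modified_usvt \<eta> (X \<omega>) (R \<omega>) $$ (i, j) - A i j)\<^sup>2 \<le>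
        4 * of_bool (B i j < c) + 16 / c\<^sup>2 * ((Q \<eta> \<omega> i j - A i j * B i j)\<^sup>2 + (S \<eta> \<omega> i j - B i j)\<^sup>2)"
        unfolding modified_usvt_entry[OF \<omega> ij] by (rule ratio_error_le[OF mean_le_1[OF ij] c])
    qed
    also have "\<dots> = 4 * ?b + 16 / c\<^sup>2 * (?q \<omega> + ?s \<omega>)"
      by (simp only: sum.distrib sum_distrib_left[symmetric])
    finally show "(\<Sum>i<m. \<Sum>j<n. (modified_usvt \<eta> (X \<omega>) (R \<omega>) $$ (i, j) - A i j)\<^sup>2) \<le> 4 * ?b + 16 / c\<^sup>2 * (?q \<omega> + ?s \<omega>)" .
  qed
  also have "\<dots> = 4 * ?b + 16 / c\<^sup>2 * (expectation ?q + expectation ?s)"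
    using int by (simp add: prob_space)
  finally show ?thesis .
qed

end

section \<open>Passage to subsequences and conclusion\<close>

lemma subsequence_limits_imp_tendsto_0:
  fixes a :: "nat \<Rightarrow> real"
  assumes nonneg: "\<And>k. 0 \<le> a k"
    and sub: "\<And>s :: nat \<Rightarrow> nat. strict_mono s \<Longrightarrow> \<exists>t. strict_mono t \<and> (\<lambda>k. a (s (t k))) \<longlonglongrightarrow> 0"
  shows "a \<longlonglongrightarrow> 0"
proof (rule ccontr)
  assume "\<not> a \<longlonglongrightarrow> 0"
  then obtain e where e: "0 < e" and inf: "\<forall>K. \<exists>k\<ge>K. e \<le> a k"
    using nonneg unfolding LIMSEQ_iff by (auto simp: not_less)
  define s where "s = enumerate {k. e \<le> a k}"
  have i: "infinite {k. e \<le> a k}" unfolding infinite_nat_iff_unbounded_le using inf by auto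
  have s: "strict_mono s" unfolding s_def by (rule strict_mono_enumerate[OF i])
  have es: "e \<le> a (s k)" for k using enumerate_in_set[OF i, of k] by (simp add: s_def)
  obtain t where "(\<lambda>k. a (s (t k))) \<longlonglongrightarrow> 0" using sub[OF s] by blast
  then have "e \<le> 0" using es by (intro LIMSEQ_le_const) auto
  then show False using e by simp
qed

text \<open>The integral of a non-integrable function is 0 by convention; asserting integrability as
  well keeps the limit from holding for that reason.\<close>

theorem theorem2p1:
  fixes \<eta> :: real
    and m n :: "nat \<Rightarrow> nat"
    and M :: "nat \<Rightarrow> real mat"
    and \<Omega> :: "nat \<Rightarrow> 'a measure"
    and X :: "nat \<Rightarrow> 'a \<Rightarrow> real mat"
    and R :: "nat \<Rightarrow> 'a \<Rightarrow> (nat \<times> nat) set"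
    and f :: "real \<Rightarrow> real"
  assumes eta: "0 < \<eta>" "\<eta> < 1"
    and pos: "\<And>k. 0 < m k" "\<And>k. 0 < n k"
    and dims_inf: "filterlim m at_top sequentially" "filterlim n at_top sequentially"
    and M_dim: "\<And>k. M k \<in> carrier_mat (m k) (n k)"
    and M_bd: "\<And>k. elements_mat (M k) \<subseteq> {-1..1}"
    and prob: "\<And>k. prob_space (\<Omega> k)"
    and X_dim: "\<And>k \<omega>. \<omega> \<in> space (\<Omega> k) \<Longrightarrow> X k \<omega> \<in> carrier_mat (m k) (n k)"
    and X_bd: "\<And>k \<omega>. \<omega> \<in> space (\<Omega> k) \<Longrightarrow> elements_mat (X k \<omega>) \<subseteq> {-1..1}"
    and indep: "\<And>k. prob_space.indep_vars (\<Omega> k) (\<lambda>_. borel)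
          (\<lambda>c \<omega>. case c of Inl ij \<Rightarrow> X k \<omega> $$ ij | Inr ij \<Rightarrow> (of_bool (ij \<in> R k \<omega>) :: real))
          (({..<m k} \<times> {..<n k}) <+> ({..<m k} \<times> {..<n k}))"
    and X_mean: "\<And>k i j. i < m k \<Longrightarrow> j < n k \<Longrightarrow>
          prob_space.expectation (\<Omega> k) (\<lambda>\<omega>. X k \<omega> $$ (i, j)) = M k $$ (i, j)"
    and f_range: "\<And>x. x \<in> (\<Union>k. elements_mat (M k)) \<Longrightarrow> f x \<in> {0..1}"
    and reveal_prob: "\<And>k i j. i < m k \<Longrightarrow> j < n k \<Longrightarrow>
          prob_space.prob (\<Omega> k) {\<omega> \<in> space (\<Omega> k). (i, j) \<in> R k \<omega>} = f (M k $$ (i, j))"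
    and rank_bd: "bdd_above (range (\<lambda>k. vec_space.rank (m k) (M k)))"
    and ext: "\<And>\<mu>. subseq_weak_limit (\<lambda>k. empirical_distribution (M k)) \<mu> \<Longrightarrow>
          \<exists>g L. L-lipschitz_on {-1..1} g \<and> g ` {-1..1} \<subseteq> {0..1} \<and>
                (\<forall>x \<in> (\<Union>k. elements_mat (M k)). g x = f x) \<and>
                (\<forall>x \<in> measure_support \<mu>. g x \<noteq> 0)"
  shows "(\<forall>k. integrable (\<Omega> k) (\<lambda>\<omega>. 1 / (real (m k) * real (n k)) *
            (\<Sum>i<m k. \<Sum>j<n k. (modified_usvt \<eta> (X k \<omega>) (R k \<omega>) $$ (i, j) - M k $$ (i, j))\<^sup>2))) \<and>
         (\<lambda>k. prob_space.expectation (\<Omega> k) (\<lambda>\<omega>. 1 / (real (m k) * real (n k)) *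
            (\<Sum>i<m k. \<Sum>j<n k. (modified_usvt \<eta> (X k \<omega>) (R k \<omega>) $$ (i, j) - M k $$ (i, j))\<^sup>2)))
           \<longlonglongrightarrow> 0"
proof -
  let ?E = "\<lambda>k. prob_space.expectation (\<Omega> k) (\<lambda>\<omega>. \<Sum>i<m k. \<Sum>j<n k.
    (modified_usvt \<eta> (X k \<omega>) (R k \<omega>) $$ (i, j) - M k $$ (i, j))\<^sup>2)"
  let ?a = "\<lambda>k. ?E k / (real (m k) * real (n k))"
  have rev: "revealed_matrix (\<Omega> k) (m k) (n k) (X k) (R k) (\<lambda>i j. M k $$ (i, j)) (\<lambda>i j. f (M k $$ (i, j)))" for k
    by (rule revealed_matrix.intro[OF prob revealed_matrix_axioms.intro[OF pos X_dim X_bd indep X_mean reveal_prob]])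
  have elem: "M k $$ (i, j) \<in> elements_mat (M k)" if "i < m k" "j < n k" for k i j
    unfolding elements_mat_def using M_dim[of k] that by (auto intro!: bexI[of _ i])
  have bd: "M k $$ (i, j) \<in> {-1..1}" if "i < m k" "j < n k" for k i j
    using elem[OF that] M_bd[of k] by blast
  obtain r where "\<And>x. x \<in> range (\<lambda>k. vec_space.rank (m k) (M k)) \<Longrightarrow> x \<le> r"
    using rank_bd unfolding bdd_above_def by blast
  from this[OF rangeI] have r: "vec_space.rank (m k) (M k) \<le> r" for k .
  have lr: "low_rank r (m k) (n k) (\<lambda>i j. M k $$ (i, j))" for k
    by (rule low_rank_of_rank[OF M_dim r])
  have a_nonneg: "0 \<le> ?a k" for k
    by (intro divide_nonneg_nonneg integral_nonneg_AE AE_I2 sum_nonneg) auto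
  have sub: "\<exists>t. strict_mono t \<and> (\<lambda>k. ?a (s (t k))) \<longlonglongrightarrow> 0" if s: "strict_mono s" for s :: "nat \<Rightarrow> nat"
  proof -
    \<comment> \<open>Helly selection extracts a weakly convergent further subsequence. Only now is
      there a limit \<open>\<mu>\<close>, and with it an extension \<open>g\<close>.\<close>
    have "tight (\<lambda>k. empirical_distribution (M k))"
      by (rule tight_empirical[OF M_dim pos]) (rule bd)
    from tight_imp_convergent_subsubsequence[OF this s]
    obtain t \<mu> where t: "strict_mono t" and \<mu>: "real_distribution \<mu>"
      and conv: "weak_conv_m ((\<lambda>k. empirical_distribution (M k)) \<circ> s \<circ> t) \<mu>"
      by (elim exE conjE)
    define z where "z k = s (t k)" for k
    have z: "strict_mono z" using strict_mono_o[OF s t] by (simp add: z_def[abs_def] comp_def)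
    have conv: "weak_conv_m (\<lambda>k. empirical_distribution (M (z k))) \<mu>"
      using conv by (simp add: z_def comp_def)
    have "subseq_weak_limit (\<lambda>k. empirical_distribution (M k)) \<mu>"
      unfolding subseq_weak_limit_def by (intro conjI exI[of _ z] \<mu> z conv)
    from ext[OF this] obtain g C where g: "C-lipschitz_on {-1..1} g" "g ` {-1..1} \<subseteq> {0..1}"
      and gf: "\<forall>x\<in>(\<Union>k. elements_mat (M k)). g x = f x" and nz: "\<forall>x\<in>measure_support \<mu>. g x \<noteq> 0"
      by (elim exE conjE)
    have gc: "continuous_on {-1..1} g" by (rule lipschitz_on_continuous_on[OF g(1)])
    have fg: "f (M k $$ (i, j)) = g (M k $$ (i, j))" if "i < m k" "j < n k" for k i j
    proof -
      have "M k $$ (i, j) \<in> (\<Union>k. elements_mat (M k))" using elem[OF that] by blast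
      then show ?thesis using gf by (simp only:)
    qed
    have reveal_prob': "prob_space.prob (\<Omega> k) {\<omega> \<in> space (\<Omega> k). (i, j) \<in> R k \<omega>} = g (M k $$ (i, j))"
      if "i < m k" "j < n k" for k i j
      using reveal_prob[OF that] fg[OF that] by (simp only:)
    \<comment> \<open>The reveal probabilities are also values of \<open>g\<close>, which is
      continuous on \<open>{-1..1}\<close> and thus accessible to polynomial approximation.\<close>
    have rev': "revealed_matrix (\<Omega> k) (m k) (n k) (X k) (R k) (\<lambda>i j. M k $$ (i, j)) (\<lambda>i j. g (M k $$ (i, j)))" for k
      by (rule revealed_matrix.intro[OF prob revealed_matrix_axioms.intro[OF pos X_dim X_bd indep X_mean reveal_prob']])
    have dims: "filterlim (\<lambda>k. m (z k)) at_top sequentially" "filterlim (\<lambda>k. n (z k)) at_top sequentially"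
      by (rule filterlim_compose[OF dims_inf(1) filterlim_subseq[OF z]],
          rule filterlim_compose[OF dims_inf(2) filterlim_subseq[OF z]])
    have "\<exists>c>0. (\<lambda>k. entry_mean (m (z k)) (n (z k)) (\<lambda>x. of_bool (g x < c)) (M (z k))) \<longlonglongrightarrow> 0"
    proof (rule low_values_fraction[OF M_dim pos _ \<mu> conv gc g(2)])
      show "M (z k) $$ (i, j) \<in> {-1..1}" if "i < m (z k)" "j < n (z k)" for k i j using that by (rule bd)
      show "g x \<noteq> 0" if "x \<in> measure_support \<mu>" for x using nz that by blast
    qed
    then obtain c where c: "0 < c" and frac: "(\<lambda>k. entry_mean (m (z k)) (n (z k)) (\<lambda>x. of_bool (g x < c)) (M (z k))) \<longlonglongrightarrow> 0"
      by blast
    let ?q = "\<lambda>k. prob_space.expectation (\<Omega> (z k)) (\<lambda>\<omega>. \<Sum>i<m (z k). \<Sum>j<n (z k).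
      (usvt \<eta> (revealed_part (X (z k) \<omega>) (R (z k) \<omega>)) $$ (i, j) - M (z k) $$ (i, j) * g (M (z k) $$ (i, j)))\<^sup>2)"
    let ?s = "\<lambda>k. prob_space.expectation (\<Omega> (z k)) (\<lambda>\<omega>. \<Sum>i<m (z k). \<Sum>j<n (z k).
      (usvt \<eta> (reveal_mask (dim_row (X (z k) \<omega>)) (dim_col (X (z k) \<omega>)) (R (z k) \<omega>)) $$ (i, j) - g (M (z k) $$ (i, j)))\<^sup>2)"
    let ?d = "\<lambda>k. real (m (z k)) * real (n (z k))"
    have q: "(\<lambda>k. ?q k / ?d k) \<longlonglongrightarrow> 0"
    proof (rule usvt_consistent[OF eta, where h = "\<lambda>x. x * g x"])
      show "random_matrix (\<Omega> (z k)) (m (z k)) (n (z k)) (\<lambda>\<omega>. revealed_part (X (z k) \<omega>) (R (z k) \<omega>))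
        (\<lambda>i j. M (z k) $$ (i, j) * g (M (z k) $$ (i, j)))" for k
      proof -
        interpret revealed_matrix "\<Omega> (z k)" "m (z k)" "n (z k)" "X (z k)" "R (z k)"
          "\<lambda>i j. M (z k) $$ (i, j)" "\<lambda>i j. g (M (z k) $$ (i, j))" by (rule rev')
        show ?thesis by (rule data.random_matrix_axioms)
      qed
      show "continuous_on {-1..1} (\<lambda>x. x * g x)" by (intro continuous_intros gc)
      show "low_rank r (m (z k)) (n (z k)) (\<lambda>i j. M (z k) $$ (i, j))" for k by (rule lr)
      show "M (z k) $$ (i, j) \<in> {-1..1}" if "i < m (z k)" "j < n (z k)" for k i j using that by (rule bd)
    qed (fact dims)+
    have s: "(\<lambda>k. ?s k / ?d k) \<longlonglongrightarrow> 0"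
    proof (rule usvt_consistent[OF eta, where h = g])
      show "random_matrix (\<Omega> (z k)) (m (z k)) (n (z k))
        (\<lambda>\<omega>. reveal_mask (dim_row (X (z k) \<omega>)) (dim_col (X (z k) \<omega>)) (R (z k) \<omega>)) (\<lambda>i j. g (M (z k) $$ (i, j)))" for k
      proof -
        interpret revealed_matrix "\<Omega> (z k)" "m (z k)" "n (z k)" "X (z k)" "R (z k)"
          "\<lambda>i j. M (z k) $$ (i, j)" "\<lambda>i j. g (M (z k) $$ (i, j))" by (rule rev')
        show ?thesis by (rule mask.random_matrix_axioms)
      qed
      show "low_rank r (m (z k)) (n (z k)) (\<lambda>i j. M (z k) $$ (i, j))" for k by (rule lr)
      show "M (z k) $$ (i, j) \<in> {-1..1}" if "i < m (z k)" "j < n (z k)" for k i j using that by (rule bd)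
    qed (fact dims gc)+
    let ?b = "\<lambda>k. \<Sum>i<m (z k). \<Sum>j<n (z k). of_bool (g (M (z k) $$ (i, j)) < c) :: real"
    have alg: "(4 * x + y * (p + q)) / d = 4 * (x / d) + y * (p / d + q / d)" for x y p q d :: real
      by (simp add: add_divide_distrib distrib_left)
    \<comment> \<open>The level \<open>c\<close> belongs to the subsequence and not to
      \<open>k\<close>, so the factor \<open>16 / c\<^sup>2\<close> stays fixed while both errors
      vanish.\<close>
    have le: "?a (z k) \<le> 4 * (?b k / ?d k) + 16 / c\<^sup>2 * (?q k / ?d k + ?s k / ?d k)" for k
    proof -
      interpret revealed_matrix "\<Omega> (z k)" "m (z k)" "n (z k)" "X (z k)" "R (z k)"
        "\<lambda>i j. M (z k) $$ (i, j)" "\<lambda>i j. g (M (z k) $$ (i, j))" by (rule rev')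
      have "?a (z k) \<le> (4 * ?b k + 16 / c\<^sup>2 * (?q k + ?s k)) / ?d k"
        by (intro divide_right_mono expectation_modified_usvt_error_le eta c) simp
      also have "\<dots> = 4 * (?b k / ?d k) + 16 / c\<^sup>2 * (?q k / ?d k + ?s k / ?d k)"
        by (rule alg)
      finally show ?thesis .
    qed
    have "(\<lambda>k. 4 * (?b k / ?d k) + 16 / c\<^sup>2 * (?q k / ?d k + ?s k / ?d k)) \<longlonglongrightarrow> 4 * 0 + 16 / c\<^sup>2 * (0 + 0)"
      by (intro tendsto_add tendsto_mult tendsto_const frac q s)
    then have lim: "(\<lambda>k. 4 * (?b k / ?d k) + 16 / c\<^sup>2 * (?q k / ?d k + ?s k / ?d k)) \<longlonglongrightarrow> 0" by (simp only: mult_zero_right add_0)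
    have "(\<lambda>k. ?a (z k)) \<longlonglongrightarrow> 0"
      by (rule tendsto_sandwich[OF always_eventually[OF allI[OF a_nonneg]] always_eventually[OF allI[OF le]] tendsto_const lim])
    then show ?thesis using t unfolding z_def by (intro exI[of _ t] conjI)
  qed
  have lim: "?a \<longlonglongrightarrow> 0"
    by (rule subsequence_limits_imp_tendsto_0[OF a_nonneg sub])
  show ?thesis
  proof (intro conjI allI)
    fix k
    \<comment> \<open>Integrability concerns every \<open>k\<close> and involves no limit, so here
      \<open>f\<close> itself provides the reveal probabilities.\<close>
    interpret revealed_matrix "\<Omega> k" "m k" "n k" "X k" "R k" "\<lambda>i j. M k $$ (i, j)" "\<lambda>i j. f (M k $$ (i, j))" by (rule rev)
    show "integrable (\<Omega> k) (\<lambda>\<omega>. 1 / (real (m k) * real (n k)) *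
        (\<Sum>i<m k. \<Sum>j<n k. (modified_usvt \<eta> (X k \<omega>) (R k \<omega>) $$ (i, j) - M k $$ (i, j))\<^sup>2))"
      by (intro integrable_mult_right integrable_modified_usvt_error eta)
  next
    show "(\<lambda>k. prob_space.expectation (\<Omega> k) (\<lambda>\<omega>. 1 / (real (m k) * real (n k)) *
        (\<Sum>i<m k. \<Sum>j<n k. (modified_usvt \<eta> (X k \<omega>) (R k \<omega>) $$ (i, j) - M k $$ (i, j))\<^sup>2))) \<longlonglongrightarrow> 0"
      using lim unfolding integral_mult_right_zero by (simp only: times_divide_eq_left mult_1)
  qed
qed

end
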